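(* Consider the Cox model counting process setting of the context. Suppose that $$\max_{i<i'\le n}\ \sup_{0\le t<\infty}\ \max_{j\le p}|Z_{i,j}(t)-Z_{i',j}(t)|\le K$$ with a constant $K>0$, and that $N_i(\infty)\le1$ for all $i\le n$. Let $\xi>1$, let $\varepsilon>0$ be small (in particular $\varepsilon<1$), and set $$\lambda=\frac{\xi+1}{\xi-1}K\sqrt{(2/n)\log(2p/\varepsilon)} .$$ Let $C_\kappa>0$ satisfy $\tau=K(\xi+1)d_o\lambda/(2C_\kappa^2)\le1/e$, and let $\eta\le1$ be the smaller solution of $\eta e^{-\eta}=\tau$. Let $\hat\beta$ be a lasso estimator with penalty level $\lambda$, i.e. a minimizer over $\beta\in\mathbb{R}^p$ of $\ell(\beta)+\lambda|\beta|_1$. Then, for any $q\ge1$ and any $C_{F,q}>0$, the inequalities $$D^s(\hat\beta,\beta^o)\le\frac{4e^\eta\xi^2\lambda^2d_o}{(1+\xi)^2C_\kappa^2},\qquad|\hat\beta-\beta^o|_1\le\frac{e^\eta(\xi+1)d_o\lambda}{2C_\kappa^2},\qquad|\hat\beta-\beta^o|_q\le\frac{2e^\eta\xi d_o^{1/q}\lambda}{(\xi+1)C_{F,q}}$$ all hold with at least probability $$P\{\kappa(\xi,\mathcal{O})\ge C_\kappa,\ F_q(\xi,\mathcal{O})\ge C_{F,q}\}-\varepsilon ,$$ where $\kappa(\xi,\mathcal{O})=\kappa(\xi,\mathcal{O};\ddot\ell(\beta^o))$ and $F_q(\xi,\mathcal{O})=F_q(\xi,\mathcal{O};\ddot\e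ll(\beta^o))$.
   Context: Cox model. Let $N_1,\dots,N_n$ be counting processes on $[0,\infty)$ (sample paths are step functions, zero at $t=0$, with jumps of size $+1$ only, no two components jumping at the same time), adapted to a filtration $\{\mathcal{F}_t\}$. Let $Y_i(t)\in\{0,1\}$ be predictable at-risk indicator processes and $Z_i(t)=(Z_{i,1}(t),\dots,Z_{i,p}(t))'\in\mathbb{R}^p$ predictable covariate processes. Assume $N_i$ has predictable compensator $\Lambda_i$ with $d\Lambda_i(t)=Y_i(t)\exp\{Z_i'(t)\beta^o\}\,d\Lambda_0(t)$, where $\beta^o\in\mathbb{R}^p$ is the vector of true regression coefficients and $\Lambda_0$ is a baseline cumulative hazard function; thus $M_i(t)=N_i(t)-\int_0^tY_i(s)\exp(Z_i'(s)\beta^o)d\Lambda_0(s)$ are (local) martingales. Write $\bar N=\sum_{i=1}^nN_i$. Negative log-partial likelihood (divided by $n$): $$\ell(\beta)=-\frac1n\Big\{\sum_{i=1}^n\int_0^\infty Z_i'(s)\beta\,dN_i(s)-\int_0^\infty\log\Big[\sum_{i=1}^nY_i(s)e^{Z_i'(s)\beta}\Big]d\bar N(s)\Big\}.$$ $\dot\ell(\beta)$ and $\ddot\ell(\beta)$ denote its gradient and Hessian. Explicitly, with $w_{ni}(t,\beta)=Y_i(t)e^{Z_i'(t)\beta}/\sum_kY_k(t)e^{Z_k'(t)\beta}$, $\bar Z_n(t,\beta)=\sum_iw_{ni}(t,\beta)Z_i(t)$ and $V_n(t,\beta)=\sum_iw_{ni}(t,\beta)(Z_i(t)-\bar Z_n(t,\beta))(Z_i(t)-\bar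 Z_n(t,\beta))'$, one has $\dot\ell(\beta)=-\frac1n\sum_i\int_0^\infty[Z_i(s)-\bar Z_n(s,\beta)]dN_i(s)$ and $\ddot\ell(\beta)=\frac1n\int_0^\infty V_n(s,\beta)\,d\bar N(s)$ (times when no individual is at risk do not contribute). Norms: $|v|_q=(\sum_j|v_j|^q)^{1/q}$ for $1\le q<\infty$, $|v|_\infty=\max_j|v_j|$. Symmetric Bregman divergence: $D^s(b,\beta)=(b-\beta)'(\dot\ell(b)-\dot\ell(\beta))$. Sparsity: $\mathcal{O}=\{j:\beta^o_j\ne0\}$, $\mathcal{O}^c=\{j:\beta_j^o=0\}$, $d_o=|\mathcal{O}|$; $b_{\mathcal{O}},b_{\mathcal{O}^c}$ denote subvectors. Cone: $\mathscr{C}(\xi,\mathcal{O})=\{b\in\mathbb{R}^p:|b_{\mathcal{O}^c}|_1\le\xi|b_{\mathcal{O}}|_1\}$. For a $p\times p$ nonnegative-definite matrix $\bar\Sigma$, the compatibility factor and weak cone invertibility factor are $$\kappa(\xi,\mathcal{O};\bar\Sigma)=\inf_{0\ne b\in\mathscr{C}(\xi,\mathcal{O})}\frac{d_o^{1/2}(b'\bar\Sigma b)^{1/2}}{|b_{\mathcal{O}}|_1},\qquad F_q(\xi,\mathcal{O};\bar\Sigma)=\inf_{0\ne b\in\mathscr{C}(\xi,\mathcal{O})}\frac{d_o^{1/q}\,b'\bar\Sigma b}{|b_{\mathcal{O}}|_1|b|_q},$$ with the infimum over the empty set equal to $+\infty$. *)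

theory Defs
  imports "HOL-Probability.Probability"
begin

subsection \<open>Martingales and predictability in continuous time\<close>

text \<open>Processes and filtrations are indexed by \<^typ>\<open>real\<close>; only their values at times
  \<open>t \<ge> 0\<close> are meaningful. No usual conditions are imposed on filtrations.\<close>

definition predictable_sigma :: "'a set \<Rightarrow> (real \<Rightarrow> 'a measure) \<Rightarrow> (real \<times> 'a) measure" where
  "predictable_sigma \<Omega> F = sigma ({0..} \<times> \<Omega>)
     ({{0} \<times> A | A. A \<in> sets (F 0)} \<union>
      {{s<..t} \<times> A | s t A. 0 \<le> s \<and> s < t \<and> A \<in> sets (F s)})"

definition predictable ::
  "'a measure \<Rightarrow> (real \<Rightarrow> 'a measure) \<Rightarrow> (real \<Rightarrow> 'a \<Rightarrow> 'b::topological_space) \<Rightarrow> bool" where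
  "predictable M F X \<longleftrightarrow>
     (\<lambda>(t, \<omega>). X t \<omega>) \<in> borel_measurable (predictable_sigma (space M) F)"

definition martingale ::
  "'a measure \<Rightarrow> (real \<Rightarrow> 'a measure) \<Rightarrow> (real \<Rightarrow> 'a \<Rightarrow> real) \<Rightarrow> bool" where
  "martingale M F X \<longleftrightarrow>
     (\<forall>t\<ge>0. X t \<in> borel_measurable (F t) \<and> integrable M (X t)) \<and>
     (\<forall>s t. 0 \<le> s \<and> s \<le> t \<longrightarrow> (AE \<omega> in M. real_cond_exp M (F s) (X t) \<omega> = X s \<omega>))"

text \<open>Finite localizing times suffice: times \<open>T k\<close> with values in \<open>[0,\<infinity>]\<close> can be
  replaced by \<open>min (T k) k\<close>.\<close>

definition local_martingale ::
  "'a measure \<Rightarrow> (real \<Rightarrow> 'a measure) \<Rightarrow> (real \<Rightarrow> 'a \<Rightarrow> real) \<Rightarrow> bool" where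
  "local_martingale M F X \<longleftrightarrow>
     (\<exists>T :: nat \<Rightarrow> 'a \<Rightarrow> real.
        (\<forall>k. stopping_time F (T k)) \<and>
        (\<forall>k. \<forall>\<omega>\<in>space M. 0 \<le> T k \<omega>) \<and>
        (AE \<omega> in M. incseq (\<lambda>k. T k \<omega>) \<and> filterlim (\<lambda>k. T k \<omega>) at_top sequentially) \<and>
        (\<forall>k. martingale M F (\<lambda>t \<omega>. X (min t (T k \<omega>)) \<omega>)))"

definition is_compensator ::
  "'a measure \<Rightarrow> (real \<Rightarrow> 'a measure) \<Rightarrow> (real \<Rightarrow> 'a \<Rightarrow> real) \<Rightarrow> (real \<Rightarrow> 'a \<Rightarrow> real) \<Rightarrow> bool" where
  "is_compensator M F X A \<longleftrightarrow>
     predictable M F A \<and>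
     (AE \<omega> in M. A 0 \<omega> = 0 \<and> mono_on {0..} (\<lambda>t. A t \<omega>) \<and>
                 (\<forall>t\<ge>0. continuous (at_right t) (\<lambda>t. A t \<omega>))) \<and>
     local_martingale M F (\<lambda>t \<omega>. X t \<omega> - A t \<omega>)"

subsection \<open>Counting processes and Stieltjes integrals\<close>

text \<open>Natural number values together with monotonicity make the path a step function.\<close>

definition counting_path :: "(real \<Rightarrow> nat) \<Rightarrow> bool" where
  "counting_path f \<longleftrightarrow>
     f 0 = 0 \<and> mono_on {0..} f \<and>
     (\<forall>t\<ge>0. \<forall>\<^sub>F s in at_right t. f s = f t) \<and>
     (\<forall>t>0. \<forall>\<^sub>F s in at_left t. f t \<le> f s + 1)"

definition jumps_at :: "(real \<Rightarrow> nat) \<Rightarrow> real \<Rightarrow> bool" where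
  "jumps_at f t \<longleftrightarrow> \<not> (\<forall>\<^sub>F s in at_left t. f s = f t)"

definition count_at_infinity :: "(real \<Rightarrow> nat) \<Rightarrow> enat" where
  "count_at_infinity f = (SUP t\<in>{0..}. enat (f t))"

text \<open>The measure \<open>dA\<close> on the positive half-line, for \<open>A\<close> nondecreasing and
  right-continuous on \<open>[0,\<infinity>)\<close>; the truncation disregards the values of \<open>A\<close> at negative times.\<close>

definition stieltjes :: "(real \<Rightarrow> real) \<Rightarrow> real measure" where
  "stieltjes A = interval_measure (\<lambda>t. A (max 0 t))"

subsection \<open>The Cox model\<close>

definition cox_compensator ::
  "(real \<Rightarrow> 'a \<Rightarrow> real) \<Rightarrow> (real \<Rightarrow> 'a \<Rightarrow> real ^ 'p) \<Rightarrow> real ^ 'p \<Rightarrow> (real \<Rightarrow> real) \<Rightarrow> real \<Rightarrow> 'a \<Rightarrow> real"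
  where
  "cox_compensator Y Z \<beta> \<Lambda>0 t \<omega> =
     (LINT s:{0<..t}|stieltjes \<Lambda>0. Y s \<omega> * exp (Z s \<omega> \<bullet> \<beta>))"

locale cox_model = prob_space M + filtration "space M" F
  for M :: "'a measure" and F :: "real \<Rightarrow> 'a measure" +
  fixes n :: nat
    and N :: "nat \<Rightarrow> real \<Rightarrow> 'a \<Rightarrow> nat"
    and Y :: "nat \<Rightarrow> real \<Rightarrow> 'a \<Rightarrow> real"
    and Z :: "nat \<Rightarrow> real \<Rightarrow> 'a \<Rightarrow> real ^ 'p"
    and \<beta>o :: "real ^ 'p"
    and \<Lambda>0 :: "real \<Rightarrow> real"
  assumes n_pos: "n \<ge> 1"
    and F_subset: "\<And>t. 0 \<le> t \<Longrightarrow> sets (F t) \<subseteq> sets M"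
    and N_adapted: "\<And>i t. i \<in> {1..n} \<Longrightarrow> 0 \<le> t \<Longrightarrow> N i t \<in> measurable (F t) (count_space UNIV)"
    and N_path: "\<And>i \<omega>. i \<in> {1..n} \<Longrightarrow> \<omega> \<in> space M \<Longrightarrow> counting_path (\<lambda>t. N i t \<omega>)"
    and N_no_common_jumps: "\<And>i k t \<omega>. i \<in> {1..n} \<Longrightarrow> k \<in> {1..n} \<Longrightarrow> i \<noteq> k \<Longrightarrow> 0 < t \<Longrightarrow>
           \<omega> \<in> space M \<Longrightarrow> \<not> (jumps_at (\<lambda>t. N i t \<omega>) t \<and> jumps_at (\<lambda>t. N k t \<omega>) t)"
    and Y_indicator: "\<And>i t \<omega>. i \<in> {1..n} \<Longrightarrow> 0 \<le> t \<Longrightarrow> \<omega> \<in> space M \<Longrightarrow> Y i t \<omega> \<in> {0, 1}"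
    and Y_predictable: "\<And>i. i \<in> {1..n} \<Longrightarrow> predictable M F (Y i)"
    and Z_predictable: "\<And>i. i \<in> {1..n} \<Longrightarrow> predictable M F (Z i)"
    and \<Lambda>0_zero: "\<Lambda>0 0 = 0"
    and \<Lambda>0_mono: "mono_on {0..} \<Lambda>0"
    and \<Lambda>0_right_cont: "\<And>t. 0 \<le> t \<Longrightarrow> continuous (at_right t) \<Lambda>0"
    and compensator_finite: "\<And>i. i \<in> {1..n} \<Longrightarrow>
           AE \<omega> in M. \<forall>t\<ge>0. set_integrable (stieltjes \<Lambda>0) {0<..t} (\<lambda>s. Y i s \<omega> * exp (Z i s \<omega> \<bullet> \<beta>o))"
    and compensator: "\<And>i. i \<in> {1..n} \<Longrightarrow>
           is_compensator M F (\<lambda>t \<omega>. real (N i t \<omega>)) (cox_compensator (Y i) (Z i) \<beta>o \<Lambda>0)"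

definition at_risk_times :: "nat \<Rightarrow> (nat \<Rightarrow> real \<Rightarrow> 'a \<Rightarrow> real) \<Rightarrow> 'a \<Rightarrow> real set" where
  "at_risk_times n Y \<omega> = {s. 0 < s \<and> (\<exists>i\<in>{1..n}. Y i s \<omega> \<noteq> 0)}"

text \<open>Times at which nobody is at risk, where the logarithm would be that of \<open>0\<close>, do not
  contribute, so the integrals over \<open>(0,\<infinity>)\<close> are restricted to \<^const>\<open>at_risk_times\<close>. In the
  Cox model almost surely no jump occurs outside these times.\<close>

definition neg_log_partial_lik ::
  "nat \<Rightarrow> (nat \<Rightarrow> real \<Rightarrow> 'a \<Rightarrow> nat) \<Rightarrow> (nat \<Rightarrow> real \<Rightarrow> 'a \<Rightarrow> real) \<Rightarrow>
   (nat \<Rightarrow> real \<Rightarrow> 'a \<Rightarrow> real ^ 'p) \<Rightarrow> 'a \<Rightarrow> real ^ 'p \<Rightarrow> real" where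
  "neg_log_partial_lik n N Y Z \<omega> \<beta> =
     - (1 / real n) *
       ((\<Sum>i=1..n. LINT s:at_risk_times n Y \<omega>|stieltjes (\<lambda>t. real (N i t \<omega>)). Z i s \<omega> \<bullet> \<beta>)
        - (LINT s:at_risk_times n Y \<omega>|stieltjes (\<lambda>t. \<Sum>i=1..n. real (N i t \<omega>)).
             ln (\<Sum>i=1..n. Y i s \<omega> * exp (Z i s \<omega> \<bullet> \<beta>))))"

subsection \<open>Gradient, Hessian and symmetric Bregman divergence\<close>

definition gradient :: "(real ^ 'p \<Rightarrow> real) \<Rightarrow> real ^ 'p \<Rightarrow> real ^ 'p" where
  "gradient f x = (THE D. GDERIV f x :> D)"

definition hessian :: "(real ^ 'p \<Rightarrow> real) \<Rightarrow> real ^ 'p \<Rightarrow> real ^ 'p ^ 'p" where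
  "hessian f x = matrix (frechet_derivative (gradient f) (at x))"

definition sym_bregman :: "(real ^ 'p \<Rightarrow> real) \<Rightarrow> real ^ 'p \<Rightarrow> real ^ 'p \<Rightarrow> real" where
  "sym_bregman f b \<beta> = (b - \<beta>) \<bullet> (gradient f b - gradient f \<beta>)"

subsection \<open>Norms, cone, compatibility and weak cone invertibility factors\<close>

definition lq_norm :: "ereal \<Rightarrow> real ^ 'p \<Rightarrow> real" where
  "lq_norm q v =
     (if q = \<infinity> then Max (range (\<lambda>j. \<bar>v $ j\<bar>))
      else (\<Sum>j\<in>UNIV. \<bar>v $ j\<bar> powr real_of_ereal q) powr (1 / real_of_ereal q))"

definition support :: "real ^ 'p \<Rightarrow> 'p set" where
  "support \<beta> = {j. \<beta> $ j \<noteq> 0}"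

text \<open>The subvector \<open>b\<^sub>S\<close>, padded with zeros, which leaves its norms unchanged.\<close>

definition subvec :: "'p set \<Rightarrow> real ^ 'p \<Rightarrow> real ^ 'p" where
  "subvec S b = (\<chi> j. if j \<in> S then b $ j else 0)"

definition cone_set :: "real \<Rightarrow> 'p set \<Rightarrow> (real ^ 'p) set" where
  "cone_set \<xi> S = {b. lq_norm 1 (subvec (- S) b) \<le> \<xi> * lq_norm 1 (subvec S b)}"

definition compat_factor :: "real \<Rightarrow> 'p set \<Rightarrow> real ^ 'p ^ 'p \<Rightarrow> ereal" where
  "compat_factor \<xi> S A =
     (INF b \<in> cone_set \<xi> S - {0}.
        ereal (sqrt (real (card S)) * sqrt (b \<bullet> (A *v b)) / lq_norm 1 (subvec S b)))"

text \<open>\<open>real_of_ereal (1 / q)\<close> is \<open>1/q\<close> for finite \<open>q\<close> and \<open>0\<close> for \<open>q = \<infinity>\<close>.\<close>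

definition cone_invertibility_factor ::
  "ereal \<Rightarrow> real \<Rightarrow> 'p set \<Rightarrow> real ^ 'p ^ 'p \<Rightarrow> ereal" where
  "cone_invertibility_factor q \<xi> S A =
     (INF b \<in> cone_set \<xi> S - {0}.
        ereal (real (card S) powr real_of_ereal (1 / q) * (b \<bullet> (A *v b))
               / (lq_norm 1 (subvec S b) * lq_norm q b)))"

end

theory Submission
  imports Defs
begin

text \<open>
  The proof separates a deterministic statement about the lasso from a probabilistic bound on the
  score \<open>\<ell>'(\<beta>o)\<close>.

  For the deterministic part, put \<open>\<theta> = \<beta>hat - \<beta>o\<close> and \<open>L = |\<theta>|\<^sub>1\<close>. Minimality of \<open>\<beta>hat\<close>, compared with
  the points of the segment towards \<open>\<beta>o\<close>, together with a sup-norm bound \<open>lam (\<xi> - 1) / (\<xi> + 1)\<close>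
  on the score, bounds the symmetric Bregman divergence by a linear functional of the two parts of
  \<open>\<theta>\<close> and puts \<open>\<theta>\<close> into the cone. The negative log-partial likelihood is a sum of log-sum-exp
  functions, whose gradients are means of the covariates under exponentially tilted weights. When
  the covariates of two individuals differ by at most \<open>K\<close>, the tilted mean in direction \<open>\<theta>\<close> grows
  over a step \<open>s\<close> strictly faster than \<open>s exp (- s K L)\<close> times its variance, if that is positive
  (\<open>tilted_mean_increment\<close>, \<open>score_increment\<close>). If \<open>\<theta> \<noteq> 0\<close> and \<open>K L \<ge> \<eta>\<close>, then at \<open>s = \<eta> / (K L) \<le> 1\<close> this
  strict growth together with the compatibility factor gives \<open>\<eta> exp (- \<eta>) < \<tau>\<close>, contradicting the
  choice of \<open>\<eta>\<close>. Strictness is what covers the boundary case \<open>\<tau> = 1 / e\<close>, where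
  \<open>x exp (- x) \<le> \<tau>\<close> holds for every \<open>x\<close>. The remaining inequalities follow from \<open>K L \<le> \<eta>\<close>
  (\<open>lasso_error_bounds\<close>).

  For the probabilistic part, each individual has at most one event, at a time \<open>\<tau> i\<close>, so a
  coordinate of \<open>- n \<ell>'(\<beta>o)\<close> is the sum over the events of the predictable residuals
  \<open>Z i - Zbar\<close>, evaluated at the event times. The one fact about martingales that enters is the
  compensation formula: for a nonnegative predictable \<open>H\<close>, the expectation of \<open>H (\<tau> i)\<close> over
  the event equals that of the integral of \<open>H\<close> against the compensator of \<open>N i\<close>. It is a
  statement about two measures on the predictable \<open>\<sigma>\<close>-algebra and is checked on
  rectangles, where it is the martingale property (\<open>compensation_formula\<close>). It is applied to
  the exponential process \<open>W\<close>, the product over past events of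
  \<open>exp (c residual - c\<^sup>2 K\<^sup>2 / 2)\<close>: the final value of \<open>W\<close> is one plus the sum of its jumps, and
  this sum has nonpositive mean because the residuals are centred under the intensities and bounded
  by \<open>K\<close>. Hence the final value has mean at most \<open>1\<close> (\<open>exp_moment_bound\<close>), and the
  exponential Markov inequality with a union bound over coordinates and signs gives the score bound
  outside a set of probability \<open>\<epsilon>\<close> (\<open>score_tail\<close>).
\<close>

section \<open>Exponentially tilted weighted means\<close>

text \<open>Writing a covariance as a sum over pairs makes its sign visible: each summand is nonnegative as
  soon as \<open>f\<close> and \<open>g\<close> are ordered in the same way.\<close>

lemma weighted_covariance_pairwise:
  fixes v f g :: "'i \<Rightarrow> real"
  shows "(\<Sum>k\<in>I. v k) * (\<Sum>k\<in>I. v k * f k * g k) - (\<Sum>k\<in>I. v k * f k) * (\<Sum>k\<in>I. v k * g k)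
    = (\<Sum>k\<in>I. \<Sum>l\<in>I. v k * v l * ((f k - f l) * (g k - g l))) / 2"
proof -
  have "(\<Sum>k\<in>I. \<Sum>l\<in>I. v k * v l * ((f k - f l) * (g k - g l)))
      = (\<Sum>k\<in>I. \<Sum>l\<in>I. v l * (v k * f k * g k)) + (\<Sum>k\<in>I. \<Sum>l\<in>I. v k * (v l * f l * g l))
        - (\<Sum>k\<in>I. \<Sum>l\<in>I. (v k * f k) * (v l * g l)) - (\<Sum>k\<in>I. \<Sum>l\<in>I. (v l * f l) * (v k * g k))"
    unfolding sum.distrib[symmetric] sum_subtractf[symmetric]
    by (intro sum.cong refl) (simp add: algebra_simps)
  also have "(\<Sum>k\<in>I. \<Sum>l\<in>I. v l * (v k * f k * g k)) = (\<Sum>k\<in>I. v k) * (\<Sum>k\<in>I. v k * f k * g k)"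
    by (subst sum.swap) (simp add: sum_product)
  also have "(\<Sum>k\<in>I. \<Sum>l\<in>I. v k * (v l * f l * g l)) = (\<Sum>k\<in>I. v k) * (\<Sum>k\<in>I. v k * f k * g k)"
    by (simp add: sum_product)
  also have "(\<Sum>k\<in>I. \<Sum>l\<in>I. (v k * f k) * (v l * g l)) = (\<Sum>k\<in>I. v k * f k) * (\<Sum>k\<in>I. v k * g k)"
    by (simp add: sum_product)
  also have "(\<Sum>k\<in>I. \<Sum>l\<in>I. (v l * f l) * (v k * g k)) = (\<Sum>k\<in>I. v k * f k) * (\<Sum>k\<in>I. v k * g k)"
    by (subst sum.swap) (simp add: sum_product)
  finally show ?thesis by simp
qed

text \<open>The slope of \<open>x \<mapsto> exp (s x)\<close> on \<open>[m, \<infinity>)\<close> is at least \<open>s exp (s m)\<close>, and a chord over a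
  nondegenerate interval is steeper than that because the exponential is strictly convex.\<close>

lemma exp_increment_lower:
  fixes s m a b :: real
  assumes "0 < s" "m \<le> a" "m \<le> b"
  shows "s * exp (s * m) * (a - b)\<^sup>2 \<le> (a - b) * (exp (s * a) - exp (s * b))"
    and "a \<noteq> b \<Longrightarrow> s * exp (s * m) * (a - b)\<^sup>2 < (a - b) * (exp (s * a) - exp (s * b))"
proof -
  have strict: "s * exp (s * m) * (a - b)\<^sup>2 < (a - b) * (exp (s * a) - exp (s * b))"
    if "b < a" "m \<le> b" for a b
  proof -
    have "s * exp (s * m) * (a - b) \<le> s * exp (s * b) * (a - b)"
      using that assms by (intro mult_right_mono mult_left_mono) auto
    also have "\<dots> = exp (s * b) * (s * (a - b))" by simp
    also have "\<dots> < exp (s * b) * (exp (s * (a - b)) - 1)"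
      using exp_minus_greater[of "- (s * (a-b))"] exp_ge_add_one_self[of "s * (a-b)"] that assms
      by (smt (verit) exp_gt_zero mult_less_cancel_left_pos mult_pos_pos exp_minus_greater)
    also have "\<dots> = exp (s * a) - exp (s * b)" by (simp add: algebra_simps flip: exp_add)
    finally show ?thesis using that mult_strict_left_mono[of _ _ "a - b"]
      by (simp add: power2_eq_square mult.assoc mult.left_commute)
  qed
  show "s * exp (s * m) * (a - b)\<^sup>2 < (a - b) * (exp (s * a) - exp (s * b))" if "a \<noteq> b"
  proof (cases "b < a")
    case True then show ?thesis using strict assms by blast
  next
    case False
    then show ?thesis using strict[of a b] assms that
      by (simp add: algebra_simps power2_eq_square)
  qed
  then show "s * exp (s * m) * (a - b)\<^sup>2 \<le> (a - b) * (exp (s * a) - exp (s * b))"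
    by (cases "a = b") auto
qed

text \<open>Tilting the weights \<open>v\<close> by \<open>exp (s x)\<close> raises the mean of \<open>x\<close> by a covariance of \<open>x\<close> with
  \<open>exp (s x)\<close>, divided by the total tilted mass. With \<open>m\<close> the minimum of \<open>x\<close>, every pair contributes
  at least \<open>s exp (s m) (x k - x l)\<^sup>2\<close> to the covariance, while the tilt inflates the mass by at most
  \<open>exp (s (m + R))\<close>; the quotient leaves the factor \<open>exp (- s R)\<close>.\<close>

lemma tilted_mean_increment:
  fixes v x :: "'i \<Rightarrow> real"
  assumes I: "finite I" and v: "\<And>k. k \<in> I \<Longrightarrow> 0 \<le> v k" and S: "0 < (\<Sum>k\<in>I. v k)"
    and R: "\<And>k l. k \<in> I \<Longrightarrow> l \<in> I \<Longrightarrow> x k - x l \<le> R" and s: "0 < s"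
  defines "V \<equiv> (\<Sum>k\<in>I. v k * (x k)\<^sup>2) / (\<Sum>k\<in>I. v k) - ((\<Sum>k\<in>I. v k * x k) / (\<Sum>k\<in>I. v k))\<^sup>2"
  defines "\<Delta> \<equiv> (\<Sum>k\<in>I. v k * exp (s * x k) * x k) / (\<Sum>k\<in>I. v k * exp (s * x k))
           - (\<Sum>k\<in>I. v k * x k) / (\<Sum>k\<in>I. v k)"
  shows "0 \<le> V" "s * exp (- (s * R)) * V \<le> \<Delta>" "0 < V \<Longrightarrow> s * exp (- (s * R)) * V < \<Delta>"
proof -
  let ?S = "\<Sum>k\<in>I. v k" and ?E = "\<Sum>k\<in>I. v k * exp (s * x k)"
  define Q where "Q = (\<Sum>k\<in>I. \<Sum>l\<in>I. v k * v l * (x k - x l)\<^sup>2) / 2"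
  define P where "P = (\<Sum>k\<in>I. \<Sum>l\<in>I. v k * v l * ((x k - x l) * (exp (s * x k) - exp (s * x l)))) / 2"
  have ne: "I \<noteq> {}" using S by auto
  define m where "m = Min (x ` I)"
  have m: "m \<le> x k" if "k \<in> I" for k using that I by (auto simp: m_def)
  have "m \<in> x ` I" unfolding m_def using I ne by (intro Min_in) auto
  then have M: "x k \<le> m + R" if "k \<in> I" for k using R that by (smt (verit) imageE)
  have E_le: "?E \<le> ?S * exp (s * (m + R))"
    unfolding sum_distrib_right using v M s by (intro sum_mono mult_left_mono) auto
  obtain k0 where k0: "k0 \<in> I" "0 < v k0"
    using S v by (meson linorder_not_less sum_nonpos)
  have "0 < ?E" by (rule sum_pos2[OF I k0(1)]) (use k0 v in auto)
  have Q0: "0 \<le> Q" unfolding Q_def using v by (intro divide_nonneg_pos sum_nonneg) auto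
  have VQ: "V = Q / ?S\<^sup>2"
    using weighted_covariance_pairwise[of v I x x] S
    by (simp add: V_def Q_def power2_eq_square field_simps)
  then show V0: "0 \<le> V" using Q0 by simp
  have frac: "d / e - c / a = (a * d - c * e) / (a * e)" if "a \<noteq> 0" "e \<noteq> 0" for a c d e :: real
    using that by (simp add: field_simps)
  have "?S * (\<Sum>k\<in>I. v k * exp (s * x k) * x k) - (\<Sum>k\<in>I. v k * x k) * ?E = P"
    using weighted_covariance_pairwise[of v I x "\<lambda>k. exp (s * x k)"]
    by (simp only: P_def mult.assoc mult.commute[of "exp _" "x _"])
  then have DP: "\<Delta> = P / (?S * ?E)"
    unfolding \<Delta>_def using S \<open>0 < ?E\<close> by (subst frac) auto
  let ?a = "\<lambda>k l. s * exp (s * m) * (v k * v l * (x k - x l)\<^sup>2)"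
  let ?b = "\<lambda>k l. v k * v l * ((x k - x l) * (exp (s * x k) - exp (s * x l)))"
  have le: "?a k l \<le> ?b k l" if "k \<in> I" "l \<in> I" for k l
  proof -
    have "(v k * v l) * (s * exp (s * m) * (x k - x l)\<^sup>2)
        \<le> (v k * v l) * ((x k - x l) * (exp (s * x k) - exp (s * x l)))"
      by (intro mult_left_mono exp_increment_lower(1) mult_nonneg_nonneg s m v that)
    then show ?thesis by (simp only: mult_ac)
  qed
  have PQ: "s * exp (s * m) * Q \<le> P"
  proof -
    have "s * exp (s * m) * Q = (\<Sum>k\<in>I. \<Sum>l\<in>I. ?a k l) / 2"
      by (simp add: Q_def sum_distrib_left)
    also have "(\<Sum>k\<in>I. \<Sum>l\<in>I. ?a k l) \<le> (\<Sum>k\<in>I. \<Sum>l\<in>I. ?b k l)"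
    proof (rule sum_mono)
      fix k assume "k \<in> I"
      then show "(\<Sum>l\<in>I. ?a k l) \<le> (\<Sum>l\<in>I. ?b k l)" by (rule sum_mono[OF le])
    qed
    finally show ?thesis by (simp add: P_def)
  qed
  have PQ': "s * exp (s * m) * Q < P" if "0 < Q"
  proof -
    have "\<exists>k\<in>I. \<exists>l\<in>I. v k * v l * (x k - x l)\<^sup>2 > 0"
    proof (rule ccontr)
      assume "\<not> ?thesis"
      then have "Q \<le> 0" unfolding Q_def
        by (auto simp: not_less intro!: divide_nonpos_pos sum_nonpos)
      then show False using that by simp
    qed
    then obtain k l where kl: "k \<in> I" "l \<in> I" "v k * v l * (x k - x l)\<^sup>2 > 0" by blast
    have "0 < v k * v l" "x k \<noteq> x l" using kl v[of k] v[of l]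
      by (auto simp: zero_less_mult_iff)
    then have "(v k * v l) * (s * exp (s * m) * (x k - x l)\<^sup>2)
        < (v k * v l) * ((x k - x l) * (exp (s * x k) - exp (s * x l)))"
      by (intro mult_strict_left_mono exp_increment_lower(2) s m kl)
    then have lt: "?a k l < ?b k l" by (simp only: mult_ac)
    have "(\<Sum>k\<in>I. \<Sum>l\<in>I. ?a k l) < (\<Sum>k\<in>I. \<Sum>l\<in>I. ?b k l)"
    proof (rule sum_strict_mono_ex1[OF I])
      show "\<forall>k\<in>I. (\<Sum>l\<in>I. ?a k l) \<le> (\<Sum>l\<in>I. ?b k l)"
        by (rule ballI, rule sum_mono[OF le])
      have "(\<Sum>l\<in>I. ?a k l) < (\<Sum>l\<in>I. ?b k l)"
      proof (rule sum_strict_mono_ex1[OF I])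
        show "\<forall>l\<in>I. ?a k l \<le> ?b k l" using le kl(1) by blast
        show "\<exists>l\<in>I. ?a k l < ?b k l" using lt kl(2) by blast
      qed
      then show "\<exists>k\<in>I. (\<Sum>l\<in>I. ?a k l) < (\<Sum>l\<in>I. ?b k l)" using kl(1) by blast
    qed
    then show ?thesis by (simp add: P_def Q_def sum_distrib_left)
  qed
  have low: "s * exp (- (s * R)) * V \<le> s * exp (s * m) * Q / (?S * ?E)"
  proof -
    have "s * exp (- (s * R)) * V = s * exp (s * m) * Q / (?S * (?S * exp (s * (m + R))))"
      using S by (simp add: VQ power2_eq_square field_simps exp_add exp_minus)
    also have "\<dots> \<le> s * exp (s * m) * Q / (?S * ?E)"
      using s Q0 S \<open>0 < ?E\<close> E_le by (intro divide_left_mono mult_left_mono) auto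
    finally show ?thesis .
  qed
  show "s * exp (- (s * R)) * V \<le> \<Delta>"
    using low divide_right_mono[OF PQ, of "?S * ?E"] S \<open>0 < ?E\<close> by (simp add: DP)
  show "s * exp (- (s * R)) * V < \<Delta>" if "0 < V"
  proof -
    have "0 < Q" using that S by (simp add: VQ zero_less_divide_iff)
    then show ?thesis
      using low divide_strict_right_mono[OF PQ', of "?S * ?E"] S \<open>0 < ?E\<close> by (simp add: DP)
  qed
qed

definition risk_sum :: "'i set \<Rightarrow> ('i \<Rightarrow> real) \<Rightarrow> ('i \<Rightarrow> 'v::real_inner) \<Rightarrow> 'v \<Rightarrow> real" where
  "risk_sum I y z \<beta> = (\<Sum>k\<in>I. y k * exp (z k \<bullet> \<beta>))"

definition risk_mean :: "'i set \<Rightarrow> ('i \<Rightarrow> real) \<Rightarrow> ('i \<Rightarrow> 'v::real_inner) \<Rightarrow> 'v \<Rightarrow> 'v" where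
  "risk_mean I y z \<beta> = (1 / risk_sum I y z \<beta>) *\<^sub>R (\<Sum>k\<in>I. (y k * exp (z k \<bullet> \<beta>)) *\<^sub>R z k)"

text \<open>The derivative of \<open>risk_mean\<close> in direction \<open>h\<close>: the covariance matrix of \<open>z\<close> under the
  normalized weights, applied to \<open>h\<close>.\<close>

definition risk_cov :: "'i set \<Rightarrow> ('i \<Rightarrow> real) \<Rightarrow> ('i \<Rightarrow> 'v::real_inner) \<Rightarrow> 'v \<Rightarrow> 'v \<Rightarrow> 'v" where
  "risk_cov I y z \<beta> h =
     (1 / risk_sum I y z \<beta>) *\<^sub>R (\<Sum>k\<in>I. (y k * exp (z k \<bullet> \<beta>) * (z k \<bullet> h)) *\<^sub>R z k)
     - (risk_mean I y z \<beta> \<bullet> h) *\<^sub>R risk_mean I y z \<beta>"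

lemma risk_sum_pos:
  assumes "finite I" "\<And>k. k \<in> I \<Longrightarrow> 0 \<le> y k" "\<exists>k\<in>I. y k \<noteq> 0"
  shows "0 < risk_sum I y z \<beta>"
proof -
  obtain k where k: "k \<in> I" "y k > 0" using assms by (metis order_le_less)
  show ?thesis unfolding risk_sum_def by (rule sum_pos2[OF assms(1) k(1)]) (use k assms in auto)
qed

lemma GDERIV_ln_risk_sum:
  assumes "finite I" "0 < risk_sum I y z \<beta>"
  shows "GDERIV (\<lambda>\<beta>. ln (risk_sum I y z \<beta>)) \<beta> :> risk_mean I y z \<beta>"
  using assms unfolding gderiv_def risk_sum_def risk_mean_def
  by (auto intro!: derivative_eq_intros ext
      simp: inner_sum_right inner_commute sum_distrib_left sum_distrib_right divide_simps mult_ac)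

lemma has_derivative_risk_mean:
  assumes "finite I" "0 < risk_sum I y z \<beta>"
  shows "(risk_mean I y z has_derivative risk_cov I y z \<beta>) (at \<beta>)"
proof -
  let ?e = "\<lambda>k. y k * exp (z k \<bullet> \<beta>)"
  have "((\<lambda>\<beta>. (1 / risk_sum I y z \<beta>) *\<^sub>R (\<Sum>k\<in>I. (y k * exp (z k \<bullet> \<beta>)) *\<^sub>R z k)) has_derivative
     (\<lambda>h. (1 / risk_sum I y z \<beta>) *\<^sub>R (\<Sum>k\<in>I. (?e k * (z k \<bullet> h)) *\<^sub>R z k)
        + (- (\<Sum>k\<in>I. ?e k * (z k \<bullet> h)) / (risk_sum I y z \<beta>)\<^sup>2) *\<^sub>R (\<Sum>k\<in>I. ?e k *\<^sub>R z k))) (at \<beta>)"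
    using assms unfolding risk_sum_def
    by (auto intro!: derivative_eq_intros ext sum.cong arg_cong2[where f="(*\<^sub>R)"] arg_cong2[where f="(+)"]
        simp: power2_eq_square divide_simps mult_ac)
  also have "(\<lambda>\<beta>. (1 / risk_sum I y z \<beta>) *\<^sub>R (\<Sum>k\<in>I. (y k * exp (z k \<bullet> \<beta>)) *\<^sub>R z k)) = risk_mean I y z"
    by (simp add: risk_mean_def fun_eq_iff)
  also have "(\<lambda>h. (1 / risk_sum I y z \<beta>) *\<^sub>R (\<Sum>k\<in>I. (?e k * (z k \<bullet> h)) *\<^sub>R z k)
        + (- (\<Sum>k\<in>I. ?e k * (z k \<bullet> h)) / (risk_sum I y z \<beta>)\<^sup>2) *\<^sub>R (\<Sum>k\<in>I. ?e k *\<^sub>R z k))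
      = risk_cov I y z \<beta>"
    by (auto simp: fun_eq_iff risk_cov_def risk_mean_def inner_sum_left power2_eq_square)
  finally show ?thesis .
qed

text \<open>In direction \<open>\<theta>\<close> the weighted mean of \<open>z\<close> becomes a scalar mean of \<open>z k \<bullet> \<theta>\<close>, and moving \<open>\<beta>\<close> by
  \<open>s \<theta>\<close> is the exponential tilt by these scalars.\<close>

lemma risk_mean_increment:
  fixes z :: "'i \<Rightarrow> 'v::real_inner"
  assumes I: "finite I" and y: "\<And>k. k \<in> I \<Longrightarrow> 0 \<le> y k" and S: "0 < risk_sum I y z \<beta>"
    and R: "\<And>k l. k \<in> I \<Longrightarrow> l \<in> I \<Longrightarrow> z k \<bullet> \<theta> - z l \<bullet> \<theta> \<le> R" and s: "0 < s"
  shows "0 \<le> \<theta> \<bullet> risk_cov I y z \<beta> \<theta>"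
    "s * exp (- (s * R)) * (\<theta> \<bullet> risk_cov I y z \<beta> \<theta>)
       \<le> \<theta> \<bullet> (risk_mean I y z (\<beta> + s *\<^sub>R \<theta>) - risk_mean I y z \<beta>)"
    "0 < \<theta> \<bullet> risk_cov I y z \<beta> \<theta> \<Longrightarrow> s * exp (- (s * R)) * (\<theta> \<bullet> risk_cov I y z \<beta> \<theta>)
       < \<theta> \<bullet> (risk_mean I y z (\<beta> + s *\<^sub>R \<theta>) - risk_mean I y z \<beta>)"
proof -
  let ?v = "\<lambda>k. y k * exp (z k \<bullet> \<beta>)" and ?x = "\<lambda>k. z k \<bullet> \<theta>"
  have cov: "\<theta> \<bullet> risk_cov I y z \<beta> \<theta> =
    (\<Sum>k\<in>I. ?v k * (?x k)\<^sup>2) / (\<Sum>k\<in>I. ?v k) - ((\<Sum>k\<in>I. ?v k * ?x k) / (\<Sum>k\<in>I. ?v k))\<^sup>2"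
    by (simp add: risk_cov_def risk_mean_def risk_sum_def inner_diff_right inner_sum_right inner_sum_left
        power2_eq_square inner_commute[of \<theta>] mult_ac)
  have inc: "\<theta> \<bullet> (risk_mean I y z (\<beta> + s *\<^sub>R \<theta>) - risk_mean I y z \<beta>) =
    (\<Sum>k\<in>I. ?v k * exp (s * ?x k) * ?x k) / (\<Sum>k\<in>I. ?v k * exp (s * ?x k))
           - (\<Sum>k\<in>I. ?v k * ?x k) / (\<Sum>k\<in>I. ?v k)"
    by (simp add: risk_mean_def risk_sum_def inner_diff_right inner_sum_right inner_add_right
        inner_commute[of \<theta>] exp_add mult_ac)
  have v: "0 \<le> ?v k" if "k \<in> I" for k using y[OF that] by simp
  note t = tilted_mean_increment[of I ?v ?x, OF I v S[unfolded risk_sum_def] R s, folded cov inc]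
  show "0 \<le> \<theta> \<bullet> risk_cov I y z \<beta> \<theta>"
    "s * exp (- (s * R)) * (\<theta> \<bullet> risk_cov I y z \<beta> \<theta>)
       \<le> \<theta> \<bullet> (risk_mean I y z (\<beta> + s *\<^sub>R \<theta>) - risk_mean I y z \<beta>)"
    "0 < \<theta> \<bullet> risk_cov I y z \<beta> \<theta> \<Longrightarrow> s * exp (- (s * R)) * (\<theta> \<bullet> risk_cov I y z \<beta> \<theta>)
       < \<theta> \<bullet> (risk_mean I y z (\<beta> + s *\<^sub>R \<theta>) - risk_mean I y z \<beta>)"
    using t by blast+
qed

section \<open>Error bounds for the lasso under a curvature condition\<close>

lemma lq_norm_1: "lq_norm 1 v = (\<Sum>j\<in>UNIV. \<bar>v $ j\<bar>)"
  by (simp add: lq_norm_def sum_nonneg one_ereal_def[symmetric])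

lemma gradient_eqI: "GDERIV f x :> D \<Longrightarrow> gradient f x = D"
  unfolding gradient_def
proof (rule the_equality)
  fix D' assume "GDERIV f x :> D'" "GDERIV f x :> D"
  then have "(\<lambda>h. h \<bullet> D') = (\<lambda>h. h \<bullet> D)"
    unfolding gderiv_def by (rule has_derivative_unique)
  then show "D' = D" by (metis inner_commute vector_eq_ldot)
qed

lemma hessian_mult_vec:
  fixes g :: "real ^ 'p \<Rightarrow> real ^ 'p"
  assumes "\<And>x. GDERIV f x :> g x" "(g has_derivative H) (at x)"
  shows "hessian f x *v h = H h"
proof -
  have "gradient f = g" using gradient_eqI assms(1) by blast
  then have "frechet_derivative (gradient f) (at x) = H"
    using frechet_derivative_at[OF assms(2)] by simp
  then show ?thesis
    unfolding hessian_def using has_derivative_linear[OF assms(2)] by (simp add: matrix_works)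
qed

lemma inner_le_sup_mult_l1:
  fixes v w :: "real ^ 'p"
  assumes "\<And>j. \<bar>w $ j\<bar> \<le> c"
  shows "v \<bullet> w \<le> c * lq_norm 1 v"
proof -
  have "v \<bullet> w \<le> (\<Sum>j\<in>UNIV. \<bar>v $ j\<bar> * c)"
    unfolding inner_vec_def
  proof (rule sum_mono)
    fix j show "v $ j \<bullet> w $ j \<le> \<bar>v $ j\<bar> * c"
      using mult_left_mono[OF assms[of j], of "\<bar>v $ j\<bar>"] abs_ge_self[of "v $ j * w $ j"]
      by (simp add: abs_mult)
  qed
  then show ?thesis by (simp add: lq_norm_1 sum_distrib_left mult.commute)
qed

lemma lq_norm_1_split: "lq_norm 1 v = lq_norm 1 (subvec S v) + lq_norm 1 (subvec (- S) v)"
proof -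
  have "\<bar>v $ j\<bar> = \<bar>subvec S v $ j\<bar> + \<bar>subvec (- S) v $ j\<bar>" for j
    by (simp add: subvec_def)
  then show ?thesis by (simp add: lq_norm_1 sum.distrib)
qed

lemma lq_norm_1_nonneg: "0 \<le> lq_norm 1 v"
  by (simp add: lq_norm_1 sum_nonneg)

lemma lq_norm_1_eq_0: "lq_norm 1 v = 0 \<longleftrightarrow> v = 0"
  by (simp add: lq_norm_1 sum_nonneg_eq_0_iff vec_eq_iff)

text \<open>Off the support of \<open>\<beta>\<close> the coordinates of \<open>b\<close> and \<open>\<theta>\<close> coincide, so they only enter negatively; on the
  support the triangle inequality applies.\<close>

lemma l1_difference_support:
  fixes b \<beta> :: "real ^ 'p"
  defines "\<theta> \<equiv> b - \<beta>"
  shows "lq_norm 1 \<beta> - lq_norm 1 b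
    \<le> lq_norm 1 (subvec (support \<beta>) \<theta>) - lq_norm 1 (subvec (- support \<beta>) \<theta>)"
  unfolding lq_norm_1 sum_subtractf[symmetric]
  by (rule sum_mono) (auto simp: \<theta>_def subvec_def support_def)

text \<open>The optimality condition in the single direction from the minimizer \<open>b\<close> to \<open>\<beta>\<close>. Convexity
  bounds the penalty on that segment by linear interpolation, so the differentiable function
  \<open>\<phi>\<close> below has a minimum at the left end of the segment and cannot have a negative derivative there.\<close>

lemma lasso_directional_bound:
  fixes f :: "real ^ 'p \<Rightarrow> real"
  assumes der: "GDERIV f b :> g" and lam: "0 \<le> lam"
    and min: "\<And>x. f b + lam * lq_norm 1 b \<le> f x + lam * lq_norm 1 x"
  shows "(b - \<beta>) \<bullet> g \<le> lam * (lq_norm 1 \<beta> - lq_norm 1 b)"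
proof -
  define \<phi> where "\<phi> = (\<lambda>t. f (b + t *\<^sub>R (\<beta> - b)) + t * (lam * (lq_norm 1 \<beta> - lq_norm 1 b)))"
  have "((\<lambda>t. b + t *\<^sub>R (\<beta> - b)) has_derivative (\<lambda>t. t *\<^sub>R (\<beta> - b))) (at 0)"
    by (auto intro!: derivative_eq_intros)
  moreover have "(f has_derivative (\<lambda>h. h \<bullet> g)) (at (b + 0 *\<^sub>R (\<beta> - b)))"
    using der by (simp add: gderiv_def)
  ultimately have "((\<lambda>t. f (b + t *\<^sub>R (\<beta> - b))) has_derivative (\<lambda>t. (t *\<^sub>R (\<beta> - b)) \<bullet> g)) (at 0)"
    by (rule has_derivative_compose)
  then have "(\<phi> has_real_derivative (\<beta> - b) \<bullet> g + lam * (lq_norm 1 \<beta> - lq_norm 1 b)) (at 0)"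
    unfolding \<phi>_def has_field_derivative_def
    by (auto intro!: derivative_eq_intros simp: fun_eq_iff algebra_simps)
  then have deriv: "(\<phi> has_real_derivative (\<beta> - b) \<bullet> g + lam * (lq_norm 1 \<beta> - lq_norm 1 b)) (at_right 0)"
    by (rule has_field_derivative_at_within)
  have ge: "\<phi> t \<ge> \<phi> 0" if t: "0 < t" "t \<le> 1" for t
  proof -
    have "lq_norm 1 (b + t *\<^sub>R (\<beta> - b)) \<le> (1 - t) * lq_norm 1 b + t * lq_norm 1 \<beta>"
      unfolding lq_norm_1 sum_distrib_left sum.distrib[symmetric]
    proof (rule sum_mono)
      fix j
      have "\<bar>(1 - t) * b $ j + t * \<beta> $ j\<bar> \<le> (1 - t) * \<bar>b $ j\<bar> + t * \<bar>\<beta> $ j\<bar>"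
        using abs_triangle_ineq[of "(1 - t) * b $ j" "t * \<beta> $ j"] t by (simp add: abs_mult)
      then show "\<bar>(b + t *\<^sub>R (\<beta> - b)) $ j\<bar> \<le> (1 - t) * \<bar>b $ j\<bar> + t * \<bar>\<beta> $ j\<bar>"
        by (simp add: algebra_simps)
    qed
    from mult_left_mono[OF this lam] min[of "b + t *\<^sub>R (\<beta> - b)"] show ?thesis
      by (simp add: \<phi>_def algebra_simps)
  qed
  have "0 \<le> (\<beta> - b) \<bullet> g + lam * (lq_norm 1 \<beta> - lq_norm 1 b)"
  proof (rule ccontr)
    assume "\<not> ?thesis"
    then have "(\<beta> - b) \<bullet> g + lam * (lq_norm 1 \<beta> - lq_norm 1 b) < 0" by simp
    from has_real_derivative_neg_dec_right[OF deriv this] obtain d where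
      d: "0 < d" "\<And>h. 0 < h \<Longrightarrow> h < d \<Longrightarrow> \<phi> h < \<phi> 0" by auto
    have "\<phi> (min (d / 2) 1) < \<phi> 0" "\<phi> (min (d / 2) 1) \<ge> \<phi> 0"
      using d(1) by (auto intro!: d(2) ge)
    then show False by simp
  qed
  then show ?thesis by (simp add: algebra_simps)
qed

text \<open>The hypotheses \<open>mono\<close> and \<open>curv\<close> say that the gradient increases along the segment from \<open>\<beta>\<close> to the
  minimizer, and that its increase dominates the quadratic form \<open>H\<close> up to a factor that decays
  exponentially in the distance travelled. The decay is harmless once the distance is known to be
  at most \<open>\<eta> / K\<close>, and that is obtained by playing the decayed curvature against the linear upper
  bound for the Bregman divergence at the single step where the factor is \<open>exp (- \<eta>)\<close>.\<close>

lemma lasso_error_bounds: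
  fixes f :: "real ^ 'p \<Rightarrow> real" and g :: "real ^ 'p \<Rightarrow> real ^ 'p" and H :: "real ^ 'p ^ 'p"
    and b \<beta> :: "real ^ 'p" and q :: ereal and K \<xi> lam \<eta> C\<kappa> CF :: real
  defines "\<theta> \<equiv> b - \<beta>" and "d \<equiv> real (card (support \<beta>))"
  assumes der: "\<And>x. GDERIV f x :> g x"
    and psd: "0 \<le> \<theta> \<bullet> (H *v \<theta>)"
    and mono: "\<And>s. 0 \<le> s \<Longrightarrow> s \<le> 1 \<Longrightarrow> \<theta> \<bullet> g (\<beta> + s *\<^sub>R \<theta>) \<le> \<theta> \<bullet> g b"
    and curv: "\<And>s. 0 < s \<Longrightarrow> 0 < \<theta> \<bullet> (H *v \<theta>) \<Longrightarrow>
      s * exp (- (s * (K * lq_norm 1 \<theta>))) * (\<theta> \<bullet> (H *v \<theta>)) < \<theta> \<bullet> (g (\<beta> + s *\<^sub>R \<theta>) - g \<beta>)"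
    and min: "\<And>x. f b + lam * lq_norm 1 b \<le> f x + lam * lq_norm 1 x"
    and score: "\<And>j. \<bar>g \<beta> $ j\<bar> \<le> lam * (\<xi> - 1) / (\<xi> + 1)"
    and pos: "0 < K" "1 < \<xi>" "0 < lam" "0 < C\<kappa>" "0 < CF"
    and \<eta>: "0 \<le> \<eta>" "\<eta> * exp (- \<eta>) = K * (\<xi> + 1) * d * lam / (2 * C\<kappa>\<^sup>2)"
    and compat: "ereal C\<kappa> \<le> compat_factor \<xi> (support \<beta>) H"
    and cif: "ereal CF \<le> cone_invertibility_factor q \<xi> (support \<beta>) H"
  shows "sym_bregman f b \<beta> \<le> 4 * exp \<eta> * \<xi>\<^sup>2 * lam\<^sup>2 * d / ((1 + \<xi>)\<^sup>2 * C\<kappa>\<^sup>2)" (is ?D)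
    and "lq_norm 1 \<theta> \<le> exp \<eta> * (\<xi> + 1) * d * lam / (2 * C\<kappa>\<^sup>2)" (is ?L)
    and "lq_norm q \<theta> \<le> 2 * exp \<eta> * \<xi> * d powr real_of_ereal (1 / q) * lam / ((\<xi> + 1) * CF)" (is ?Q)
proof -
  define u where "u = lq_norm 1 (subvec (support \<beta>) \<theta>)"
  define w where "w = lq_norm 1 (subvec (- support \<beta>) \<theta>)"
  define L where "L = lq_norm 1 \<theta>"
  define D where "D = \<theta> \<bullet> (g b - g \<beta>)"
  define h where "h = \<theta> \<bullet> (H *v \<theta>)"
  have L: "L = u + w" unfolding L_def u_def w_def by (rule lq_norm_1_split)
  have nn: "0 \<le> u" "0 \<le> w" by (simp_all add: u_def w_def lq_norm_1_nonneg)
  have breg: "sym_bregman f b \<beta> = D"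
    by (simp add: sym_bregman_def D_def \<theta>_def gradient_eqI[OF der])
  have "0 \<le> D" using mono[of 0] by (simp add: D_def inner_diff_right)
  have D_le: "D \<le> 2 * lam * \<xi> / (\<xi> + 1) * u - 2 * lam / (\<xi> + 1) * w"
  proof -
    have "\<theta> \<bullet> g b \<le> lam * (lq_norm 1 \<beta> - lq_norm 1 b)"
      unfolding \<theta>_def using der pos min by (intro lasso_directional_bound) auto
    also have "\<dots> \<le> lam * (u - w)"
      using l1_difference_support[of \<beta> b] pos by (simp add: u_def w_def \<theta>_def)
    finally have 1: "\<theta> \<bullet> g b \<le> lam * (u - w)" .
    have "\<theta> \<bullet> (- g \<beta>) \<le> lam * (\<xi> - 1) / (\<xi> + 1) * (u + w)"
      unfolding L[symmetric] L_def by (rule inner_le_sup_mult_l1) (use score in simp)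
    with 1 have "D \<le> lam * (u - w) + lam * (\<xi> - 1) / (\<xi> + 1) * (u + w)"
      by (simp add: D_def inner_diff_right)
    also have "\<dots> = 2 * lam * \<xi> / (\<xi> + 1) * u - 2 * lam / (\<xi> + 1) * w"
      using pos by (simp add: divide_simps) (simp add: algebra_simps)
    finally show ?thesis .
  qed
  have "2 * lam / (\<xi> + 1) * w \<le> 2 * lam / (\<xi> + 1) * (\<xi> * u)"
    using D_le \<open>0 \<le> D\<close> by (simp add: mult_ac)
  then have "w \<le> \<xi> * u" using pos by (subst (asm) mult_le_cancel_left_pos) auto
  then have cone: "\<theta> \<in> cone_set \<xi> (support \<beta>)"
    by (simp add: cone_set_def u_def w_def)
  have main: "?D \<and> ?L \<and> ?Q"
  proof (cases "\<theta> = 0")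
    case True
    have "lq_norm q \<theta> = 0"
      using True by (auto simp: lq_norm_def)
    moreover have "D = 0" "lq_norm 1 \<theta> = 0" using True by (simp_all add: D_def lq_norm_1)
    ultimately show ?thesis using pos breg by (auto simp: d_def)
  next
    case False
    then have b: "\<theta> \<in> cone_set \<xi> (support \<beta>) - {0}" using cone by simp
    have "0 < L" using False lq_norm_1_eq_0[of \<theta>] lq_norm_1_nonneg[of \<theta>] by (auto simp: L_def)
    then have "0 < u" using L nn \<open>w \<le> \<xi> * u\<close> by (cases "u = 0") auto
    have k: "C\<kappa> \<le> sqrt d * sqrt h / u"
      using order_trans[OF compat[unfolded compat_factor_def] INF_lower[OF b]]
      by (simp add: d_def h_def u_def)
    then have "C\<kappa> * u \<le> sqrt d * sqrt h" using \<open>0 < u\<close> by (simp add: field_simps)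
    then have "(C\<kappa> * u)\<^sup>2 \<le> (sqrt d * sqrt h)\<^sup>2"
      using pos \<open>0 < u\<close> by (intro power_mono) auto
    then have k2: "C\<kappa>\<^sup>2 * u\<^sup>2 \<le> d * h"
      using psd by (simp add: power_mult_distrib h_def d_def)
    have "0 < C\<kappa>\<^sup>2 * u\<^sup>2" using pos \<open>0 < u\<close> by simp
    with k2 have "0 < d * h" by linarith
    then have "0 < d" "0 < h" using psd by (auto simp: zero_less_mult_iff h_def)
    have F: "CF \<le> d powr real_of_ereal (1 / q) * h / (u * lq_norm q \<theta>)"
      using order_trans[OF cif[unfolded cone_invertibility_factor_def] INF_lower[OF b]]
      by (simp add: d_def h_def u_def)
    have Fpos: "0 < u * lq_norm q \<theta>"
      using F pos \<open>0 < h\<close> \<open>0 < d\<close>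
      by (smt (verit) divide_nonneg_nonpos mult_nonneg_nonneg powr_gt_zero)
    have "0 < \<eta>" using \<eta> pos \<open>0 < d\<close> by (cases "\<eta> = 0") auto
    have KL: "K * L < \<eta>"
    proof (rule ccontr)
      assume neg: "\<not> K * L < \<eta>"
      \<comment> \<open>At this step the decay factor in the curvature bound equals \<open>exp (- \<eta>)\<close>.\<close>
      define s where "s = \<eta> / (K * L)"
      have s: "0 < s" "s \<le> 1" "s * (K * L) = \<eta>"
        using neg \<open>0 < \<eta>\<close> \<open>0 < L\<close> pos by (auto simp: s_def divide_simps)
      have "s * exp (- \<eta>) * h < \<theta> \<bullet> (g (\<beta> + s *\<^sub>R \<theta>) - g \<beta>)"
        using curv[OF s(1)] \<open>0 < h\<close> s(3) by (simp add: h_def L_def)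
      also have "\<dots> \<le> D" using mono[of s] s by (simp add: D_def inner_diff_right)
      finally have "s * exp (- \<eta>) * h * L < D * L" using \<open>0 < L\<close> by simp
      also have "\<dots> \<le> (2 * lam * \<xi> / (\<xi> + 1) * u - 2 * lam / (\<xi> + 1) * w) * (u + w)"
        unfolding L using D_le nn by (intro mult_right_mono) auto
      also have "\<dots> \<le> lam * (\<xi> + 1) * u\<^sup>2 / 2"
      proof -
        \<comment> \<open>This is \<open>2 x y \<le> x\<^sup>2 + y\<^sup>2\<close> for \<open>x = (\<xi> + 1) u\<close> and \<open>y = 2 L\<close>.\<close>
        have "lam * (\<xi> + 1) * u\<^sup>2 / 2 - (2 * lam * \<xi> / (\<xi> + 1) * u - 2 * lam / (\<xi> + 1) * w) * (u + w)
          = lam / (2 * (\<xi> + 1)) * ((\<xi> + 1) * u - 2 * (u + w))\<^sup>2"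
          using pos by (simp add: divide_simps power2_eq_square) (simp add: algebra_simps)
        moreover have "\<dots> \<ge> 0" using pos by simp
        ultimately show ?thesis by linarith
      qed
      finally have "s * exp (- \<eta>) * h * L < lam * (\<xi> + 1) * u\<^sup>2 / 2" .
      then have "\<eta> * exp (- \<eta>) * h < K * (\<xi> + 1) * lam * u\<^sup>2 / 2"
        using pos s(3) mult_strict_left_mono[of _ _ K] by (simp add: s(3)[symmetric] mult_ac)
      then have "C\<kappa>\<^sup>2 * (\<eta> * exp (- \<eta>) * h) < C\<kappa>\<^sup>2 * (K * (\<xi> + 1) * lam * u\<^sup>2 / 2)"
        using pos by simp
      also have "\<dots> = K * (\<xi> + 1) * lam / 2 * (C\<kappa>\<^sup>2 * u\<^sup>2)" by simp
      also have "\<dots> \<le> K * (\<xi> + 1) * lam / 2 * (d * h)"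
        using k2 pos by (intro mult_left_mono) auto
      finally show False using \<eta>(2) pos \<open>0 < h\<close> by (simp add: field_simps)
    qed
    have Dh: "exp (- \<eta>) * h \<le> D"
    proof -
      have "exp (- \<eta>) * h \<le> exp (- (K * L)) * h" using KL \<open>0 < h\<close> by simp
      also have "\<dots> < D" using curv[of 1] \<open>0 < h\<close> by (simp add: h_def L_def D_def \<theta>_def)
      finally show ?thesis by simp
    qed
    then have hD: "h \<le> exp \<eta> * D" by (simp add: exp_minus field_simps)
    define a where "a = 2 * lam * \<xi> / (\<xi> + 1)"
    have "0 < a" using pos by (simp add: a_def)
    have Du: "D \<le> a * u" using D_le nn pos unfolding a_def
      by (smt (verit) divide_nonneg_pos mult_nonneg_nonneg)
    have ?D
    proof -
      have "0 < D" using Dh \<open>0 < h\<close> by (smt (verit) exp_gt_zero mult_pos_pos)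
      have "D\<^sup>2 \<le> (a * u)\<^sup>2" using Du \<open>0 \<le> D\<close> by (intro power_mono) auto
      then have "C\<kappa>\<^sup>2 * D\<^sup>2 \<le> a\<^sup>2 * (C\<kappa>\<^sup>2 * u\<^sup>2)"
        using mult_left_mono[of "D\<^sup>2" "(a * u)\<^sup>2" "C\<kappa>\<^sup>2"] by (simp add: power_mult_distrib mult_ac)
      also have "\<dots> \<le> a\<^sup>2 * (d * (exp \<eta> * D))"
        using k2 hD \<open>0 < d\<close> by (intro mult_left_mono order_trans[OF k2]) auto
      finally have "C\<kappa>\<^sup>2 * D \<le> a\<^sup>2 * (d * exp \<eta>)"
        using \<open>0 < D\<close> by (simp add: power2_eq_square[of D] mult_ac)
      then have "D \<le> a\<^sup>2 * (d * exp \<eta>) / C\<kappa>\<^sup>2" using pos by (simp add: field_simps)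
      also have "\<dots> = 4 * exp \<eta> * \<xi>\<^sup>2 * lam\<^sup>2 * d / ((1 + \<xi>)\<^sup>2 * C\<kappa>\<^sup>2)"
        by (simp add: a_def power_mult_distrib power_divide add.commute)
      finally show ?thesis using breg by simp
    qed
    moreover have ?L
    proof -
      have "\<eta> = exp \<eta> * (\<eta> * exp (- \<eta>))" by (simp add: exp_minus)
      also have "\<dots> = K * (exp \<eta> * (\<xi> + 1) * d * lam / (2 * C\<kappa>\<^sup>2))" by (simp add: \<eta>(2))
      finally have "K * L \<le> K * (exp \<eta> * (\<xi> + 1) * d * lam / (2 * C\<kappa>\<^sup>2))" using KL by linarith
      then show ?thesis using pos by (subst (asm) mult_le_cancel_left_pos) (auto simp: L_def)
    qed
    moreover have ?Q
    proof -
      have "CF * (u * lq_norm q \<theta>) \<le> d powr real_of_ereal (1 / q) * h"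
        using F Fpos by (simp add: field_simps)
      also have "\<dots> \<le> d powr real_of_ereal (1 / q) * (exp \<eta> * (a * u))"
        using hD Du by (intro mult_left_mono order_trans[OF hD]) auto
      finally have "CF * lq_norm q \<theta> \<le> d powr real_of_ereal (1 / q) * exp \<eta> * a"
        using \<open>0 < u\<close> by (simp add: mult_ac)
      then have "lq_norm q \<theta> \<le> d powr real_of_ereal (1 / q) * exp \<eta> * a / CF"
        using pos by (simp add: pos_le_divide_eq mult.commute)
      then show ?thesis by (simp add: a_def mult_ac)
    qed
    ultimately show ?thesis by blast
  qed
  then show ?D ?L ?Q by blast+
qed

section \<open>An exponential inequality and a telescoping product\<close>

text \<open>Bernoulli case of Hoeffding's lemma with success probability \<open>1/2\<close>, rescaled.\<close>

lemma cosh_le_exp_half_square: "cosh (x::real) \<le> exp (x\<^sup>2 / 2)"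
proof -
  have *: "cosh x \<le> exp (x\<^sup>2 / 2)" if "0 \<le> x" for x :: real
  proof -
    have "- (2 * x) * (1/2) + ln (1 + 1/2 * (exp (2 * x) - 1)) \<le> (2 * x)\<^sup>2 / 8"
      using Hoeffdings_lemma_aux[of "2 * x" "1/2"] that by simp
    then have "exp (- x + ln (1 + 1/2 * (exp (2 * x) - 1))) \<le> exp (x\<^sup>2 / 2)"
      by (simp only: exp_le_cancel_iff) (simp add: power2_eq_square)
    moreover have "0 < 1 + 1/2 * (exp (2 * x) - 1)" by (simp add: algebra_simps add_pos_pos)
    moreover have "exp (2 * x) = exp x * exp x" by (simp flip: exp_add)
    moreover have "exp (- x) * (1 + 1/2 * (exp x * exp x - 1)) = cosh x"
      by (simp add: cosh_def exp_minus field_simps)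
    ultimately show ?thesis
      by (simp only: exp_add exp_ln)
  qed
  show ?thesis
    using *[of x] *[of "- x"] by (cases "0 \<le> x") auto
qed

text \<open>Hoeffding's lemma for a finite weighted sum: the chord of the exponential over \<open>[- c K, c K]\<close>
  lies above it, the linear part of the chord vanishes by centring, and its constant part is
  \<open>cosh (c K)\<close>.\<close>

lemma centered_exp_sum_le:
  fixes v a :: "'i \<Rightarrow> real"
  assumes v: "\<And>k. k \<in> I \<Longrightarrow> 0 \<le> v k" and a: "\<And>k. k \<in> I \<Longrightarrow> v k \<noteq> 0 \<Longrightarrow> \<bar>a k\<bar> \<le> K" and "0 < K"
    and center: "(\<Sum>k\<in>I. v k * a k) = 0"
  shows "(\<Sum>k\<in>I. v k * exp (c * a k)) \<le> exp (c\<^sup>2 * K\<^sup>2 / 2) * (\<Sum>k\<in>I. v k)"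
proof -
  have chord: "exp (c * x) \<le> cosh (c * K) + x * (sinh (c * K) / K)" if "\<bar>x\<bar> \<le> K" for x
  proof -
    define t where "t = (K + x) / (2 * K)"
    have t: "0 \<le> t" "t \<le> 1" using that \<open>0 < K\<close> by (auto simp: t_def divide_simps)
    have "exp ((1 - t) *\<^sub>R (- (c * K)) + t *\<^sub>R (c * K))
        \<le> (1 - t) * exp (- (c * K)) + t * exp (c * K)"
      using convex_onD[OF convex_on_exp[of 1], of t "- (c * K)" "c * K"] t by simp
    moreover have "(1 - t) *\<^sub>R (- (c * K)) + t *\<^sub>R (c * K) = c * x"
      using \<open>0 < K\<close> by (simp add: t_def field_simps)
    moreover have "(1 - t) * exp (- (c * K)) + t * exp (c * K) = cosh (c * K) + x * (sinh (c * K) / K)"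
      using \<open>0 < K\<close> by (simp add: t_def cosh_def sinh_def field_simps)
    ultimately show ?thesis by simp
  qed
  have "(\<Sum>k\<in>I. v k * exp (c * a k)) \<le> (\<Sum>k\<in>I. v k * (cosh (c * K) + a k * (sinh (c * K) / K)))"
  proof (rule sum_mono)
    fix k assume "k \<in> I"
    then show "v k * exp (c * a k) \<le> v k * (cosh (c * K) + a k * (sinh (c * K) / K))"
      using v a chord by (cases "v k = 0") (auto intro!: mult_left_mono)
  qed
  also have "\<dots> = cosh (c * K) * (\<Sum>k\<in>I. v k) + (\<Sum>k\<in>I. v k * a k) * (sinh (c * K) / K)"
    by (simp add: algebra_simps sum.distrib sum_distrib_left sum_distrib_right sum_divide_distrib)
  also have "\<dots> \<le> exp ((c * K)\<^sup>2 / 2) * (\<Sum>k\<in>I. v k)"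
    using cosh_le_exp_half_square[of "c * K"] v by (simp add: center mult_right_mono sum_nonneg)
  finally show ?thesis by (simp add: power_mult_distrib)
qed

text \<open>Discrete form of \<open>W(\<infinity>) = 1 + \<integral> W(s-) dX(s)\<close>: processing the indices in the order of \<open>T\<close>, the
  product changes by its previous value times \<open>x i - 1\<close>.\<close>

lemma prod_telescope_ordered:
  fixes T :: "'i \<Rightarrow> real" and x :: "'i \<Rightarrow> real"
  assumes "finite S" "inj_on T S"
  shows "(\<Prod>i\<in>S. x i) = 1 + (\<Sum>i\<in>S. (\<Prod>j\<in>{j\<in>S. T j < T i}. x j) * (x i - 1))"
  using assms
proof (induction S rule: finite_ranking_induct[where f = T])
  case (insert m S)
  show ?case
  proof (cases "m \<in> S")
    case True
    then show ?thesis using insert by (simp add: insert_absorb)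
  next
    case False
    then have lt: "T y < T m" if "y \<in> S" for y
      using insert.hyps(2)[OF that] inj_onD[OF insert.prems, of y m] that False
      by (auto simp: order_less_le)
    have "{j \<in> insert m S. T j < T m} = S" using lt by auto
    moreover have "{j \<in> insert m S. T j < T i} = {j \<in> S. T j < T i}" if "i \<in> S" for i
      using lt[OF that] by auto
    ultimately have "1 + (\<Sum>i\<in>insert m S. (\<Prod>j\<in>{j\<in>insert m S. T j < T i}. x j) * (x i - 1))
      = (1 + (\<Sum>i\<in>S. (\<Prod>j\<in>{j\<in>S. T j < T i}. x j) * (x i - 1))) + (\<Prod>i\<in>S. x i) * (x m - 1)"
      using insert.hyps(1) False by simp
    also have "\<dots> = (\<Prod>i\<in>S. x i) + (\<Prod>i\<in>S. x i) * (x m - 1)"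
      using insert.IH insert.prems by simp
    also have "\<dots> = (\<Prod>i\<in>insert m S. x i)"
      using insert.hyps(1) False by (simp add: algebra_simps)
    finally show ?thesis by simp
  qed
qed simp

section \<open>Counting paths with at most one event\<close>

definition event_occurs :: "(real \<Rightarrow> nat) \<Rightarrow> bool" where
  "event_occurs f \<longleftrightarrow> (\<exists>t\<ge>0. f t \<noteq> 0)"

text \<open>The default \<open>0\<close> keeps the time nonnegative, so it can be inserted into predictable functions also
  where no event occurs.\<close>

definition event_time :: "(real \<Rightarrow> nat) \<Rightarrow> real" where
  "event_time f = (if event_occurs f then Inf {t. 0 \<le> t \<and> f t \<noteq> 0} else 0)"

text \<open>Right-continuity makes the infimum of the times with a nonzero count itself such a time.\<close>

lemma counting_path_one_event:
  assumes path: "counting_path f" and le1: "count_at_infinity f \<le> 1" and t: "0 \<le> t"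
  shows "f t = (if event_occurs f \<and> event_time f \<le> t then 1 else 0)"
proof -
  have f1: "f s \<le> 1" if "0 \<le> s" for s
  proof -
    have "enat (f s) \<le> count_at_infinity f"
      unfolding count_at_infinity_def using that by (intro SUP_upper) auto
    also note le1
    finally show ?thesis by (simp add: one_enat_def)
  qed
  have mono: "f s \<le> f u" if "0 \<le> s" "s \<le> u" for s u
    using path that by (auto simp: counting_path_def mono_on_def)
  show ?thesis
  proof (cases "event_occurs f")
    case False then show ?thesis using t by (auto simp: event_occurs_def)
  next
    case True
    define A where "A = {t. 0 \<le> t \<and> f t \<noteq> 0}"
    have T: "event_time f = Inf A" using True by (simp add: event_time_def A_def)
    have ne: "A \<noteq> {}" and bd: "bdd_below A" using True by (auto simp: A_def event_occurs_def bdd_below_def)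
    have T0: "0 \<le> Inf A" using ne by (intro cInf_greatest) (auto simp: A_def)
    have "f (Inf A) \<noteq> 0"
    proof
      assume 0: "f (Inf A) = 0"
      have "\<forall>\<^sub>F s in at_right (Inf A). f s = f (Inf A)"
        using path T0 by (auto simp: counting_path_def)
      then obtain b where b: "Inf A < b" "\<And>s. Inf A < s \<Longrightarrow> s < b \<Longrightarrow> f s = 0"
        using 0 by (auto simp: eventually_at_right_field)
      obtain a where a: "a \<in> A" "a < b" using cInf_lessD[OF ne b(1)] by auto
      have "Inf A \<le> a" using a(1) bd by (rule cInf_lower)
      then show False using b(2)[of a] a 0 by (cases "a = Inf A") (auto simp: A_def)
    qed
    then have "f t = 1" if "Inf A \<le> t" using mono[OF T0 that] f1[OF t] by simp
    moreover have "f t = 0" if "t < Inf A"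
      using that cInf_lower[OF _ bd, of t] t by (force simp: A_def)
    ultimately show ?thesis using True T by (cases "Inf A \<le> t") auto
  qed
qed

lemma event_time_pos:
  assumes "counting_path f" "count_at_infinity f \<le> 1" "event_occurs f"
  shows "0 < event_time f"
proof -
  have "f 0 = 0" using assms by (simp add: counting_path_def)
  then show ?thesis using counting_path_one_event[OF assms(1,2), of 0] assms(3) by (auto split: if_splits)
qed

lemma jumps_at_event_time:
  assumes "counting_path f" "count_at_infinity f \<le> 1" "event_occurs f"
  shows "jumps_at f (event_time f)"
  unfolding jumps_at_def
proof
  let ?T = "event_time f"
  have T: "0 < ?T" by (rule event_time_pos[OF assms])
  assume "\<forall>\<^sub>F s in at_left ?T. f s = f ?T"
  moreover have "\<forall>\<^sub>F s in at_left ?T. s \<in> {0<..<?T}"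
    using T by (rule eventually_at_left_real)
  ultimately have "\<forall>\<^sub>F s in at_left ?T. False"
    by eventually_elim (use counting_path_one_event[OF assms(1,2)] T assms(3) in auto)
  then show False by simp
qed

text \<open>Both sides are finite on the half-open intervals, which generate the Borel sets, and both count the jump
  times in such an interval.\<close>

lemma stieltjes_step:
  assumes J: "finite J" and T: "\<And>i. i \<in> J \<Longrightarrow> 0 < T i"
    and A: "\<And>t. 0 \<le> t \<Longrightarrow> A t = (\<Sum>i\<in>J. if T i \<le> t then 1 else 0)"
  shows "stieltjes A = distr (count_space J) borel T"
proof -
  define G where "G = (\<lambda>t. \<Sum>i\<in>J. if T i \<le> t then 1 else 0 :: real)"
  have "(\<lambda>t. A (max 0 t)) = G"
  proof
    fix t show "A (max 0 t) = G t"
      unfolding A[OF max.cobounded1] G_def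
    proof (rule sum.cong)
      fix i assume "i \<in> J"
      then show "(if T i \<le> max 0 t then 1 else 0 :: real) = (if T i \<le> t then 1 else 0)"
        using T[of i] by (auto simp: max_def)
    qed simp
  qed
  then have S: "stieltjes A = interval_measure G" by (simp add: stieltjes_def)
  have mono: "G x \<le> G y" if "x \<le> y" for x y
    unfolding G_def using that by (intro sum_mono) auto
  have step: "continuous (at_right a) (\<lambda>t. if T i \<le> t then 1 else 0 :: real)" for a i
  proof -
    have "\<forall>\<^sub>F s in at_right a. (if T i \<le> s then 1 else 0 :: real) = (if T i \<le> a then 1 else 0)"
    proof (cases "T i \<le> a")
      case True
      then show ?thesis by (auto simp: eventually_at_right_field intro!: exI[of _ "a + 1"])
    next
      case False
      then show ?thesis by (auto simp: eventually_at_right_field intro!: exI[of _ "T i"])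
    qed
    then show ?thesis unfolding continuous_within by (rule tendsto_eventually)
  qed
  have cont: "continuous (at_right a) G" for a
    unfolding G_def by (intro continuous_sum step)
  let ?E = "range (\<lambda>(a, b). {a <.. b::real})"
  have sets: "sets borel = sigma_sets UNIV ?E"
    by (subst borel_sigma_sets_Ioc) simp
  show ?thesis unfolding S
  proof (rule measure_eqI_generator_eq[where E = ?E and \<Omega> = UNIV and A = "\<lambda>n. {- real n <.. real n}"])
    show "Int_stable ?E"
      by (auto simp: Int_stable_def image_iff split: prod.splits)
    show "?E \<subseteq> Pow UNIV" by simp
    show "sets (interval_measure G) = sigma_sets UNIV ?E" using sets by simp
    show "sets (distr (count_space J) borel T) = sigma_sets UNIV ?E" using sets by simp
    show "range (\<lambda>n. {- real n <.. real n}) \<subseteq> ?E" by auto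
    show "(\<Union>n. {- real n <.. real n}) = UNIV"
    proof (intro set_eqI iffI UNIV_I)
      fix x :: real
      obtain n :: nat where "\<bar>x\<bar> < real n" using reals_Archimedean2 by blast
      then show "x \<in> (\<Union>n. {- real n <.. real n})" by (intro UN_I[of n]) auto
    qed
    show "emeasure (interval_measure G) {- real n <.. real n} \<noteq> \<infinity>" for n
      by (subst emeasure_interval_measure_Ioc) (auto intro: mono cont)
    fix X assume "X \<in> ?E"
    then obtain a b where X: "X = {a <.. b}" by auto
    show "emeasure (interval_measure G) X = emeasure (distr (count_space J) borel T) X"
    proof (cases "a \<le> b")
      case True
      have "G b - G a = (\<Sum>i\<in>J. if a < T i \<and> T i \<le> b then 1 else 0)"
        unfolding G_def sum_subtractf[symmetric] using True by (intro sum.cong) auto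
      also have "\<dots> = real (card {i\<in>J. a < T i \<and> T i \<le> b})"
        using J by (simp add: sum.If_cases Int_def)
      finally have "emeasure (interval_measure G) X = card {i\<in>J. a < T i \<and> T i \<le> b}"
        unfolding X using True
        by (subst emeasure_interval_measure_Ioc) (auto intro: mono cont simp: ennreal_of_nat_eq_real_of_nat)
      also have "\<dots> = emeasure (distr (count_space J) borel T) X"
        unfolding X using J by (subst emeasure_distr)
          (auto simp: emeasure_count_space_finite intro!: arg_cong[where f = card])
      finally show ?thesis .
    qed (simp add: X)
  qed
qed

lemma set_integral_stieltjes_step:
  fixes f :: "real \<Rightarrow> real"
  assumes J: "finite J" and T: "\<And>i. i \<in> J \<Longrightarrow> 0 < T i"
    and A: "\<And>t. 0 \<le> t \<Longrightarrow> A t = (\<Sum>i\<in>J. if T i \<le> t then 1 else 0)"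
    and f: "(\<lambda>s. indicator S s * f s) \<in> borel_measurable borel"
  shows "(LINT s:S|stieltjes A. f s) = (\<Sum>i\<in>{i\<in>J. T i \<in> S}. f (T i))"
proof -
  have st: "stieltjes A = distr (count_space J) borel T"
    by (rule stieltjes_step[OF J]) (simp_all add: T A)
  have "(LINT s:S|stieltjes A. f s) = (\<integral>i. indicator S (T i) * f (T i) \<partial>count_space J)"
    unfolding set_lebesgue_integral_def st using f by (subst integral_distr) auto
  also have "\<dots> = (\<Sum>i\<in>J. if T i \<in> S then f (T i) else 0)"
    using J by (subst lebesgue_integral_count_space_finite) (simp_all add: indicator_def of_bool_def if_distrib[where f="\<lambda>c. c * _"] cong: if_cong)
  also have "\<dots> = (\<Sum>i\<in>{i\<in>J. T i \<in> S}. f (T i))"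
    using J by (simp add: sum.If_cases Int_def)
  finally show ?thesis .
qed

section \<open>Predictable functions and event times\<close>

lemma sets_predictable_sigma:
  assumes "\<And>t. sets (F t) \<subseteq> Pow \<Omega>"
  shows "sets (predictable_sigma \<Omega> F) = sigma_sets ({0..} \<times> \<Omega>)
     ({{0} \<times> A | A. A \<in> sets (F 0)} \<union>
      {{s<..t} \<times> A | s t A. 0 \<le> s \<and> s < t \<and> A \<in> sets (F s)})"
    and space_predictable_sigma: "space (predictable_sigma \<Omega> F) = {0..} \<times> \<Omega>"
proof -
  have sub: "({{0} \<times> A | A. A \<in> sets (F 0)} \<union>
      {{s<..t} \<times> A | s t A. 0 \<le> s \<and> s < t \<and> A \<in> sets (F s)}) \<subseteq> Pow ({0..} \<times> \<Omega>)"
    using assms by fastforce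
  show "sets (predictable_sigma \<Omega> F) = sigma_sets ({0..} \<times> \<Omega>)
     ({{0} \<times> A | A. A \<in> sets (F 0)} \<union>
      {{s<..t} \<times> A | s t A. 0 \<le> s \<and> s < t \<and> A \<in> sets (F s)})"
    unfolding predictable_sigma_def by (rule sets_measure_of[OF sub])
  show "space (predictable_sigma \<Omega> F) = {0..} \<times> \<Omega>"
    unfolding predictable_sigma_def by (rule space_measure_of[OF sub])
qed

text \<open>Measurability into the predictable \<open>\<sigma>\<close>-algebra needs to be checked on its generating rectangles only.\<close>

lemma measurable_predictable_sigma:
  assumes "\<And>t. sets (F t) \<subseteq> Pow \<Omega>" "f \<in> space X \<rightarrow> {0..} \<times> \<Omega>"
    and "\<And>A. A \<in> sets (F 0) \<Longrightarrow> f -` ({0} \<times> A) \<inter> space X \<in> sets X"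
    and "\<And>s t A. 0 \<le> s \<Longrightarrow> s < t \<Longrightarrow> A \<in> sets (F s) \<Longrightarrow> f -` ({s<..t} \<times> A) \<inter> space X \<in> sets X"
  shows "f \<in> measurable X (predictable_sigma \<Omega> F)"
  unfolding predictable_sigma_def
proof (rule measurable_measure_of)
  show "({{0} \<times> A | A. A \<in> sets (F 0)} \<union>
      {{s<..t} \<times> A | s t A. 0 \<le> s \<and> s < t \<and> A \<in> sets (F s)}) \<subseteq> Pow ({0..} \<times> \<Omega>)"
    using assms(1) by fastforce
qed (use assms in auto)

text \<open>Counting processes with at most one event are described by the indicator \<open>occ\<close> and the time \<open>\<tau>\<close>
  of the event. Distinctness of event times is the absence of common jumps.\<close>

locale one_event_cox = cox_model M F n N Y Z \<beta>o \<Lambda>0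
  for M :: "'a measure" and F n N Y and Z :: "nat \<Rightarrow> real \<Rightarrow> 'a \<Rightarrow> real ^ 'p" and \<beta>o \<Lambda>0 +
  fixes occ :: "nat \<Rightarrow> 'a \<Rightarrow> bool" and \<tau> :: "nat \<Rightarrow> 'a \<Rightarrow> real"
  assumes N_eq: "\<And>i t \<omega>. i \<in> {1..n} \<Longrightarrow> \<omega> \<in> space M \<Longrightarrow> 0 \<le> t \<Longrightarrow>
      N i t \<omega> = (if occ i \<omega> \<and> \<tau> i \<omega> \<le> t then 1 else 0)"
    and \<tau>_pos: "\<And>i \<omega>. i \<in> {1..n} \<Longrightarrow> \<omega> \<in> space M \<Longrightarrow> occ i \<omega> \<Longrightarrow> 0 < \<tau> i \<omega>"
    and \<tau>_default: "\<And>i \<omega>. i \<in> {1..n} \<Longrightarrow> \<omega> \<in> space M \<Longrightarrow> \<not> occ i \<omega> \<Longrightarrow> \<tau> i \<omega> = 0"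
    and \<tau>_distinct: "\<And>i k \<omega>. i \<in> {1..n} \<Longrightarrow> k \<in> {1..n} \<Longrightarrow> i \<noteq> k \<Longrightarrow> \<omega> \<in> space M \<Longrightarrow>
      occ i \<omega> \<Longrightarrow> occ k \<omega> \<Longrightarrow> \<tau> i \<omega> \<noteq> \<tau> k \<omega>"
begin

abbreviation PS :: "(real \<times> 'a) measure" where "PS \<equiv> predictable_sigma (space M) F"

lemma F_Pow: "sets (F t) \<subseteq> Pow (space M)"
  using sets.space_closed[of "F t"] by (simp add: space_F)

lemma subalgebra_F: "0 \<le> t \<Longrightarrow> subalgebra M (F t)"
  using F_subset by (auto simp: subalgebra_def space_F)

lemma space_PS: "space PS = {0..} \<times> space M"
  by (rule space_predictable_sigma[OF F_Pow])

lemma Ioc_times_in_PS: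
  assumes "0 \<le> s" "s < t" "A \<in> sets (F s)" shows "{s<..t} \<times> A \<in> sets PS"
  unfolding sets_predictable_sigma[OF F_Pow] using assms by (intro sigma_sets.Basic) auto

lemma Ioi_times_in_PS:
  assumes "0 \<le> s" "A \<in> sets (F s)" shows "{s<..} \<times> A \<in> sets PS"
proof -
  have "{s<..} \<times> A = (\<Union>k. {s<..s + real (Suc k)} \<times> A)"
  proof (intro set_eqI iffI)
    fix x assume x: "x \<in> {s<..} \<times> A"
    obtain k where "fst x - s < real k" using reals_Archimedean2 by blast
    then show "x \<in> (\<Union>k. {s<..s + real (Suc k)} \<times> A)" using x by (intro UN_I[of k]) auto
  qed auto
  also have "\<dots> \<in> sets PS" using assms by (intro sets.countable_UN) (auto intro!: Ioc_times_in_PS)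
  finally show ?thesis .
qed

text \<open>Predictable functions live on nonnegative times. Composing with \<open>clip\<close> extends them to
  all real times, where they can be integrated against product measures on \<open>borel \<Otimes>\<^sub>M M\<close>.\<close>

definition clip :: "real \<times> 'a \<Rightarrow> real \<times> 'a" where "clip = (\<lambda>(s, \<omega>). (max 0 s, \<omega>))"

lemma measurable_clip: "clip \<in> measurable (borel \<Otimes>\<^sub>M M) PS"
proof (rule measurable_predictable_sigma[OF F_Pow])
  show "clip \<in> space (borel \<Otimes>\<^sub>M M) \<rightarrow> {0..} \<times> space M"
    by (auto simp: clip_def space_pair_measure)
  fix A assume A: "A \<in> sets (F 0)"
  then have "A \<in> sets M" using F_subset by blast
  moreover have "clip -` ({0} \<times> A) \<inter> space (borel \<Otimes>\<^sub>M M) = {..0} \<times> A"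
    using F_Pow A by (auto simp: clip_def space_pair_measure max_def split: if_splits)
  ultimately show "clip -` ({0} \<times> A) \<inter> space (borel \<Otimes>\<^sub>M M) \<in> sets (borel \<Otimes>\<^sub>M M)" by auto
next
  fix s t :: real and A assume st: "0 \<le> s" "s < t" "A \<in> sets (F s)"
  then have "A \<in> sets M" using F_subset by blast
  moreover have "clip -` ({s<..t} \<times> A) \<inter> space (borel \<Otimes>\<^sub>M M) = {s<..t} \<times> A"
    using F_Pow st by (auto simp: clip_def space_pair_measure max_def split: if_splits)
  ultimately show "clip -` ({s<..t} \<times> A) \<inter> space (borel \<Otimes>\<^sub>M M) \<in> sets (borel \<Otimes>\<^sub>M M)" by auto
qed

lemma measurable_clip_time:
  assumes "f \<in> measurable PS X" shows "(\<lambda>(s, \<omega>). f (max 0 s, \<omega>)) \<in> measurable (borel \<Otimes>\<^sub>M M) X"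
  using measurable_compose[OF measurable_clip assms] by (simp add: clip_def case_prod_unfold)

lemma measurable_section:
  assumes "f \<in> measurable PS X" "\<omega> \<in> space M" shows "(\<lambda>s. f (max 0 s, \<omega>)) \<in> measurable borel X"
  using measurable_compose[OF measurable_Pair2'[OF assms(2)] measurable_clip_time[OF assms(1)]] by simp

lemma occ_sets: assumes "i \<in> {1..n}" shows "{\<omega> \<in> space M. occ i \<omega>} \<in> sets M"
proof -
  have "{\<omega> \<in> space M. occ i \<omega>} = (\<Union>k::nat. {\<omega> \<in> space M. N i (real k) \<omega> \<noteq> 0})"
    using N_eq[OF assms] real_arch_simple by (auto split: if_splits)
  moreover have "{\<omega> \<in> space M. N i (real k) \<omega> \<noteq> 0} \<in> sets M" for k
  proof -
    have [measurable]: "N i (real k) \<in> measurable M (count_space UNIV)"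
      using measurable_from_subalg[OF subalgebra_F N_adapted] assms by simp
    show ?thesis by measurable
  qed
  ultimately show ?thesis by (auto intro!: sets.countable_UN)
qed

lemma event_before_sets:
  assumes "i \<in> {1..n}" "0 \<le> t" shows "{\<omega> \<in> space M. occ i \<omega> \<and> \<tau> i \<omega> \<le> t} \<in> sets (F t)"
proof -
  have [measurable]: "N i t \<in> measurable (F t) (count_space UNIV)" using N_adapted assms by simp
  have "{\<omega> \<in> space (F t). N i t \<omega> \<noteq> 0} \<in> sets (F t)" by measurable
  also have "{\<omega> \<in> space (F t). N i t \<omega> \<noteq> 0} = {\<omega> \<in> space M. occ i \<omega> \<and> \<tau> i \<omega> \<le> t}"
    using N_eq[OF assms(1) _ assms(2)] by (auto simp: space_F split: if_splits)
  finally show ?thesis .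
qed

lemma event_between_sets:
  assumes "i \<in> {1..n}" "0 \<le> s" "s \<le> t"
  shows "{\<omega> \<in> space M. occ i \<omega> \<and> s < \<tau> i \<omega> \<and> \<tau> i \<omega> \<le> t} \<in> sets (F t)"
proof -
  have "{\<omega> \<in> space M. occ i \<omega> \<and> \<tau> i \<omega> \<le> t} - {\<omega> \<in> space M. occ i \<omega> \<and> \<tau> i \<omega> \<le> s} \<in> sets (F t)"
    using event_before_sets[of i t] event_before_sets[of i s] sets_F_mono[of s t] assms by auto
  also have "{\<omega> \<in> space M. occ i \<omega> \<and> \<tau> i \<omega> \<le> t} - {\<omega> \<in> space M. occ i \<omega> \<and> \<tau> i \<omega> \<le> s}
    = {\<omega> \<in> space M. occ i \<omega> \<and> s < \<tau> i \<omega> \<and> \<tau> i \<omega> \<le> t}" by auto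
  finally show ?thesis .
qed

lemma measurable_\<tau>: assumes "i \<in> {1..n}" shows "\<tau> i \<in> borel_measurable M"
proof (rule borel_measurable_iff_le[THEN iffD2], rule allI)
  fix a :: real
  have nonneg: "0 \<le> \<tau> i \<omega>" if "\<omega> \<in> space M" for \<omega>
    using \<tau>_pos[OF assms that] \<tau>_default[OF assms that] by (cases "occ i \<omega>") auto
  show "{\<omega> \<in> space M. \<tau> i \<omega> \<le> a} \<in> sets M"
  proof (cases "0 \<le> a")
    case True
    have "{\<omega> \<in> space M. \<tau> i \<omega> \<le> a}
      = {\<omega> \<in> space M. occ i \<omega> \<and> \<tau> i \<omega> \<le> a} \<union> (space M - {\<omega> \<in> space M. occ i \<omega>})"
      using True \<tau>_default[OF assms] by fastforce
    then show ?thesis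
      using event_before_sets[OF assms True] F_subset[OF True] occ_sets[OF assms] by auto
  next
    case False
    then have "{\<omega> \<in> space M. \<tau> i \<omega> \<le> a} = {}" using nonneg by fastforce
    then show ?thesis by (simp only: sets.empty_sets)
  qed
qed

lemma measurable_at_\<tau>:
  assumes "i \<in> {1..n}" "f \<in> measurable PS X" shows "(\<lambda>\<omega>. f (\<tau> i \<omega>, \<omega>)) \<in> measurable M X"
proof -
  note measurable_\<tau>[OF assms(1), measurable] measurable_clip_time[OF assms(2), measurable]
  have "(\<lambda>\<omega>. case (\<tau> i \<omega>, \<omega>) of (s, \<omega>) \<Rightarrow> f (max 0 s, \<omega>)) \<in> measurable M X" by measurable
  also have "?this \<longleftrightarrow> ?thesis"
  proof (rule measurable_cong)
    fix \<omega> assume "\<omega> \<in> space M"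
    then have "0 \<le> \<tau> i \<omega>"
      using \<tau>_pos[OF assms(1)] \<tau>_default[OF assms(1)] by (cases "occ i \<omega>") (auto intro: less_imp_le)
    then show "(case (\<tau> i \<omega>, \<omega>) of (s, \<omega>) \<Rightarrow> f (max 0 s, \<omega>)) = f (\<tau> i \<omega>, \<omega>)" by simp
  qed
  finally show ?thesis .
qed

text \<open>The second claim is that a predictable function evaluated at a past event time is again
  predictable. On a rectangle \<open>{a<..b} \<times> A\<close> the preimage requires an event in \<open>{a<..b}\<close> before the
  current time \<open>s\<close>; separating the event from \<open>s\<close> by a rational \<open>r\<close> shows it as a countable union of
  sets \<open>{r<..} \<times> A'\<close> with \<open>A'\<close> known at time \<open>r\<close>.\<close>

lemma past_event_predictable:
  assumes i: "i \<in> {1..n}"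
  defines "R \<equiv> {(s, \<omega>). 0 \<le> s \<and> \<omega> \<in> space M \<and> occ i \<omega> \<and> \<tau> i \<omega> < s}"
  shows "R \<in> sets PS"
    and "(\<lambda>(s, \<omega>). (\<tau> i \<omega>, \<omega>)) \<in> measurable (restrict_space PS R) PS"
proof -
  have cut: "{(s, \<omega>). \<omega> \<in> A \<and> occ i \<omega> \<and> a < \<tau> i \<omega> \<and> \<tau> i \<omega> \<le> b \<and> \<tau> i \<omega> < s} \<in> sets PS"
    if a: "0 \<le> a" "A \<in> sets (F a)" for a b A
  proof -
    have "{(s, \<omega>). \<omega> \<in> A \<and> occ i \<omega> \<and> a < \<tau> i \<omega> \<and> \<tau> i \<omega> \<le> b \<and> \<tau> i \<omega> < s}
      = (\<Union>r\<in>{r \<in> \<rat>. a \<le> r}. {r<..} \<times> (A \<inter> {\<omega> \<in> space M. occ i \<omega> \<and> a < \<tau> i \<omega> \<and> \<tau> i \<omega> \<le> max a (min r b)}))"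
      (is "?l = ?r")
    proof (intro set_eqI iffI)
      fix x assume "x \<in> ?l"
      then obtain s \<omega> where x: "x = (s, \<omega>)" "\<omega> \<in> A" "occ i \<omega>" "a < \<tau> i \<omega>" "\<tau> i \<omega> \<le> b" "\<tau> i \<omega> < s"
        by auto
      obtain r where "r \<in> \<rat>" "\<tau> i \<omega> < r" "r < s" using Rats_dense_in_real[OF x(6)] by auto
      then show "x \<in> ?r" using x a F_Pow by (intro UN_I[of r]) auto
    next
      fix x assume "x \<in> ?r"
      then show "x \<in> ?l" by (auto simp: max_def split: if_splits)
    qed
    also have "\<dots> \<in> sets PS"
    proof (rule sets.countable_UN'')
      show "countable {r \<in> \<rat>. a \<le> r}" using countable_rat by (rule countable_subset[rotated]) auto
      fix r assume r: "r \<in> {r \<in> \<rat>. a \<le> r}"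
      have "{\<omega> \<in> space M. occ i \<omega> \<and> a < \<tau> i \<omega> \<and> \<tau> i \<omega> \<le> max a (min r b)} \<in> sets (F r)"
        using event_between_sets[OF i a(1), of "max a (min r b)"] r sets_F_mono[of "max a (min r b)" r] by auto
      moreover have "A \<in> sets (F r)" using a sets_F_mono[of a r] r by auto
      ultimately show "{r<..} \<times> (A \<inter> {\<omega> \<in> space M. occ i \<omega> \<and> a < \<tau> i \<omega> \<and> \<tau> i \<omega> \<le> max a (min r b)}) \<in> sets PS"
        using r a by (intro Ioi_times_in_PS) auto
    qed
    finally show ?thesis .
  qed
  have "R = (\<Union>k::nat. {(s, \<omega>). \<omega> \<in> space M \<and> occ i \<omega> \<and> 0 < \<tau> i \<omega> \<and> \<tau> i \<omega> \<le> real k \<and> \<tau> i \<omega> < s})"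
    using \<tau>_pos[OF i] real_arch_simple by (fastforce simp: R_def)
  also have "\<dots> \<in> sets PS"
    using sets.top[of "F 0"] by (intro sets.countable_UN) (auto intro!: cut simp: space_F)
  finally show R: "R \<in> sets PS" .
  show "(\<lambda>(s, \<omega>). (\<tau> i \<omega>, \<omega>)) \<in> measurable (restrict_space PS R) PS"
  proof (rule measurable_predictable_sigma[OF F_Pow])
    show "(\<lambda>(s, \<omega>). (\<tau> i \<omega>, \<omega>)) \<in> space (restrict_space PS R) \<rightarrow> {0..} \<times> space M"
      using \<tau>_pos[OF i] by (auto simp: space_restrict_space R_def intro: less_imp_le)
    fix A assume "A \<in> sets (F 0)"
    have "(\<lambda>(s, \<omega>). (\<tau> i \<omega>, \<omega>)) -` ({0} \<times> A) \<inter> space (restrict_space PS R) = {}"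
      using \<tau>_pos[OF i] by (force simp: space_restrict_space R_def)
    then show "(\<lambda>(s, \<omega>). (\<tau> i \<omega>, \<omega>)) -` ({0} \<times> A) \<inter> space (restrict_space PS R) \<in> sets (restrict_space PS R)"
      by simp
  next
    fix a b :: real and A assume ab: "0 \<le> a" "a < b" "A \<in> sets (F a)"
    have "(\<lambda>(s, \<omega>). (\<tau> i \<omega>, \<omega>)) -` ({a<..b} \<times> A) \<inter> space (restrict_space PS R)
      = {(s, \<omega>). \<omega> \<in> A \<and> occ i \<omega> \<and> a < \<tau> i \<omega> \<and> \<tau> i \<omega> \<le> b \<and> \<tau> i \<omega> < s}"
      using F_Pow ab by (auto simp: space_restrict_space R_def space_PS)
    moreover have "\<dots> \<subseteq> R" using F_Pow ab by (auto simp: R_def)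
    ultimately show "(\<lambda>(s, \<omega>). (\<tau> i \<omega>, \<omega>)) -` ({a<..b} \<times> A) \<inter> space (restrict_space PS R)
        \<in> sets (restrict_space PS R)"
      using cut[OF ab(1,3), of b] R by (simp add: sets_restrict_space_iff)
  qed
qed

lemma past_value_predictable:
  assumes i: "i \<in> {1..n}" and f: "f \<in> borel_measurable PS"
  shows "(\<lambda>(s, \<omega>). if occ i \<omega> \<and> \<tau> i \<omega> < s then f (\<tau> i \<omega>, \<omega>) else (1::real)) \<in> borel_measurable PS"
proof -
  let ?R = "{(s, \<omega>). 0 \<le> s \<and> \<omega> \<in> space M \<and> occ i \<omega> \<and> \<tau> i \<omega> < s}"
  have "(\<lambda>x. if x \<in> ?R then f (case x of (s, \<omega>) \<Rightarrow> (\<tau> i \<omega>, \<omega>)) else 1) \<in> borel_measurable PS"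
  proof (rule measurable_restrict_space_iff[THEN iffD1])
    show "?R \<inter> space PS \<in> sets PS" using past_event_predictable(1)[OF i] by auto
    show "(\<lambda>x. f (case x of (s, \<omega>) \<Rightarrow> (\<tau> i \<omega>, \<omega>))) \<in> borel_measurable (restrict_space PS ?R)"
      using measurable_compose[OF past_event_predictable(2)[OF i] f] .
  qed simp
  also have "?this \<longleftrightarrow> ?thesis"
    by (rule measurable_cong) (auto simp: space_PS split: if_splits)
  finally show ?thesis .
qed

end

section \<open>The compensation formula\<close>

text \<open>Monotone convergence for sequences that reach their limit after finitely many steps, as
  localized quantities do once the localizing time has passed.\<close>

lemma nn_integral_SUP_eventually:
  fixes h :: "nat \<Rightarrow> 'b \<Rightarrow> ennreal"
  assumes h: "\<And>k. h k \<in> borel_measurable M"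
    and ae: "AE \<omega> in M. (\<forall>k. h k \<omega> \<le> h (Suc k) \<omega>) \<and> (\<forall>k. h k \<omega> \<le> h' \<omega>) \<and> (\<exists>k. h k \<omega> = h' \<omega>)"
  shows "(\<integral>\<^sup>+\<omega>. h' \<omega> \<partial>M) = (SUP k. \<integral>\<^sup>+\<omega>. h k \<omega> \<partial>M)"
proof -
  have "(\<integral>\<^sup>+\<omega>. h' \<omega> \<partial>M) = (\<integral>\<^sup>+\<omega>. (SUP k. h k \<omega>) \<partial>M)"
  proof (rule nn_integral_cong_AE)
    show "AE \<omega> in M. h' \<omega> = (SUP k. h k \<omega>)"
      using ae
    proof eventually_elim
      case (elim \<omega>)
      then obtain k where k: "h k \<omega> = h' \<omega>" by blast
      show ?case
      proof (rule antisym)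
        show "h' \<omega> \<le> (SUP k. h k \<omega>)" unfolding k[symmetric] by (rule SUP_upper) simp
        show "(SUP k. h k \<omega>) \<le> h' \<omega>" using elim by (intro SUP_least) blast
      qed
    qed
  qed
  also have "\<dots> = (SUP k. \<integral>\<^sup>+\<omega>. h k \<omega> \<partial>M)"
    using ae h by (intro nn_integral_monotone_convergence_SUP_AE) (auto elim!: eventually_mono)
  finally show ?thesis .
qed

text \<open>The defining conditional expectation, integrated over an event of the past.\<close>

lemma martingale_increment:
  assumes M: "prob_space M" and sub: "subalgebra M (F s)" and X: "martingale M F X" and st: "0 \<le> s" "s \<le> t"
    and A: "A \<in> sets (F s)"
  shows "(\<integral>\<omega>. indicator A \<omega> * (X t \<omega> - X s \<omega>) \<partial>M) = 0"
proof -
  interpret prob_space M by fact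
  interpret sub: finite_measure_subalgebra M "F s" by unfold_locales fact
  have int: "integrable M (X s)" "integrable M (X t)"
    and ce: "AE \<omega> in M. real_cond_exp M (F s) (X t) \<omega> = X s \<omega>"
    using X st by (auto simp: martingale_def)
  have AM: "A \<in> sets M" using A sub by (auto simp: subalgebra_def)
  have i: "integrable M (\<lambda>\<omega>. indicator A \<omega> * X s \<omega>)" "integrable M (\<lambda>\<omega>. indicator A \<omega> * X t \<omega>)"
    using integrable_mult_indicator[OF AM int(1)] integrable_mult_indicator[OF AM int(2)] by auto
  have "(\<integral>\<omega>. indicator A \<omega> * X t \<omega> \<partial>M) = (\<integral>\<omega>. indicator A \<omega> * real_cond_exp M (F s) (X t) \<omega> \<partial>M)"
    using sub.real_cond_exp_intA[OF int(2) A] by (simp add: set_lebesgue_integral_def)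
  also have "\<dots> = (\<integral>\<omega>. indicator A \<omega> * X s \<omega> \<partial>M)"
    using ce AM borel_measurable_integrable[OF int(1)]
    by (intro integral_cong_AE) (auto elim!: eventually_mono intro!: borel_measurable_times)
  finally show ?thesis using i by (simp add: right_diff_distrib)
qed

context one_event_cox
begin

definition intensity :: "nat \<Rightarrow> real \<times> 'a \<Rightarrow> real" where
  "intensity i = (\<lambda>(s, \<omega>). Y i s \<omega> * exp (Z i s \<omega> \<bullet> \<beta>o))"

lemma Y_PS: "i \<in> {1..n} \<Longrightarrow> (\<lambda>(s, \<omega>). Y i s \<omega>) \<in> borel_measurable PS"
  using Y_predictable by (simp add: predictable_def)

lemma Z_PS: "i \<in> {1..n} \<Longrightarrow> (\<lambda>(s, \<omega>). Z i s \<omega>) \<in> borel_measurable PS"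
  using Z_predictable by (simp add: predictable_def)

lemma intensity_PS:
  assumes i: "i \<in> {1..n}" shows "intensity i \<in> borel_measurable PS"
proof -
  have "(\<lambda>x. Z i (fst x) (snd x) \<bullet> \<beta>o) \<in> borel_measurable PS"
    using Z_PS[OF i] by (intro borel_measurable_inner) (simp_all add: case_prod_unfold)
  then have "(\<lambda>x. exp (Z i (fst x) (snd x) \<bullet> \<beta>o)) \<in> borel_measurable PS"
    by (rule measurable_compose[OF _ borel_measurable_exp])
  then show ?thesis
    using Y_PS[OF i] unfolding intensity_def case_prod_unfold by (intro borel_measurable_times)
qed

lemma intensity_nonneg: "i \<in> {1..n} \<Longrightarrow> 0 \<le> s \<Longrightarrow> \<omega> \<in> space M \<Longrightarrow> 0 \<le> intensity i (s, \<omega>)"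
  using Y_indicator[of i s \<omega>] by (auto simp: intensity_def)

abbreviation d\<Lambda> :: "real measure" where "d\<Lambda> \<equiv> stieltjes \<Lambda>0"

lemma sets_d\<Lambda> [measurable_cong]: "sets d\<Lambda> = sets borel"
  by (simp add: stieltjes_def)

lemma sigma_finite_d\<Lambda>: "sigma_finite_measure d\<Lambda>"
  unfolding stieltjes_def
proof (rule sigma_finite_interval_measure)
  show "\<Lambda>0 (max 0 x) \<le> \<Lambda>0 (max 0 y)" if "x \<le> y" for x y
    using \<Lambda>0_mono that by (auto simp: mono_on_def)
  show "continuous (at_right a) (\<lambda>t. \<Lambda>0 (max 0 t))" for a
  proof (cases "0 \<le> a")
    case True
    have "(\<Lambda>0 \<longlongrightarrow> \<Lambda>0 a) (at_right a)"
      using \<Lambda>0_right_cont[OF True] by (simp add: continuous_within)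
    moreover have "\<forall>\<^sub>F t in at_right a. \<Lambda>0 t = \<Lambda>0 (max 0 t)"
      using eventually_at_right_less[of a] by eventually_elim (use True in simp)
    ultimately have "((\<lambda>t. \<Lambda>0 (max 0 t)) \<longlongrightarrow> \<Lambda>0 a) (at_right a)"
      by (rule tendsto_cong[THEN iffD1, rotated])
    then show ?thesis using True by (simp add: continuous_within)
  next
    case False
    then have "\<forall>\<^sub>F t in at_right a. \<Lambda>0 (max 0 t) = \<Lambda>0 (max 0 a)"
      by (auto simp: eventually_at_right_field intro!: exI[of _ 0])
    then show ?thesis unfolding continuous_within by (rule tendsto_eventually)
  qed
qed

lemma measurable_d\<Lambda>_pair:
  assumes "f \<in> measurable PS X" shows "(\<lambda>(s, \<omega>). f (max 0 s, \<omega>)) \<in> measurable (d\<Lambda> \<Otimes>\<^sub>M M) X"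
  using measurable_clip_time[OF assms] by (simp cong: measurable_cong_sets sets_pair_measure_cong add: sets_d\<Lambda>)

lemma compensator_increment:
  assumes i: "i \<in> {1..n}" and \<omega>: "\<omega> \<in> space M" and ab: "0 \<le> a" "a \<le> b"
    and int: "\<And>t. 0 \<le> t \<Longrightarrow> set_integrable d\<Lambda> {0<..t} (\<lambda>s. Y i s \<omega> * exp (Z i s \<omega> \<bullet> \<beta>o))"
  shows "ennreal (cox_compensator (Y i) (Z i) \<beta>o \<Lambda>0 b \<omega> - cox_compensator (Y i) (Z i) \<beta>o \<Lambda>0 a \<omega>)
    = (\<integral>\<^sup>+s. indicator {a<..b} s * ennreal (intensity i (max 0 s, \<omega>)) \<partial>d\<Lambda>)"
    and "cox_compensator (Y i) (Z i) \<beta>o \<Lambda>0 a \<omega> \<le> cox_compensator (Y i) (Z i) \<beta>o \<Lambda>0 b \<omega>"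
proof -
  let ?g = "\<lambda>s. Y i s \<omega> * exp (Z i s \<omega> \<bullet> \<beta>o)"
  have iab: "set_integrable d\<Lambda> {a<..b} ?g"
    by (rule set_integrable_subset[OF int[of b]]) (use ab in \<open>auto simp: sets_d\<Lambda>\<close>)
  have "{0<..b} = {0<..a} \<union> {a<..b}" using ab by auto
  then have "(LINT s:{0<..b}|d\<Lambda>. ?g s) = (LINT s:{0<..a}|d\<Lambda>. ?g s) + (LINT s:{a<..b}|d\<Lambda>. ?g s)"
    using set_integral_Un[of "{0<..a}" "{a<..b}" d\<Lambda> ?g] int[of a] iab ab by auto
  then have eq: "cox_compensator (Y i) (Z i) \<beta>o \<Lambda>0 b \<omega> - cox_compensator (Y i) (Z i) \<beta>o \<Lambda>0 a \<omega>
     = (\<integral>s. indicator {a<..b} s *\<^sub>R ?g s \<partial>d\<Lambda>)"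
    by (simp add: cox_compensator_def set_lebesgue_integral_def)
  have nn: "0 \<le> indicator {a<..b} s *\<^sub>R ?g s" for s
    using intensity_nonneg[OF i _ \<omega>, of s] ab by (auto simp: intensity_def indicator_def)
  show "cox_compensator (Y i) (Z i) \<beta>o \<Lambda>0 a \<omega> \<le> cox_compensator (Y i) (Z i) \<beta>o \<Lambda>0 b \<omega>"
  proof -
    have "0 \<le> (\<integral>s. indicator {a<..b} s *\<^sub>R ?g s \<partial>d\<Lambda>)"
      by (rule Bochner_Integration.integral_nonneg) (rule nn)
    then show ?thesis using eq by linarith
  qed
  have "ennreal (\<integral>s. indicator {a<..b} s *\<^sub>R ?g s \<partial>d\<Lambda>) = (\<integral>\<^sup>+s. ennreal (indicator {a<..b} s *\<^sub>R ?g s) \<partial>d\<Lambda>)"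
    using iab nn by (intro nn_integral_eq_integral[symmetric]) (auto simp: set_integrable_def)
  also have "\<dots> = (\<integral>\<^sup>+s. indicator {a<..b} s * ennreal (intensity i (max 0 s, \<omega>)) \<partial>d\<Lambda>)"
    using ab by (intro nn_integral_cong) (auto simp: intensity_def indicator_def)
  finally show "ennreal (cox_compensator (Y i) (Z i) \<beta>o \<Lambda>0 b \<omega> - cox_compensator (Y i) (Z i) \<beta>o \<Lambda>0 a \<omega>)
    = (\<integral>\<^sup>+s. indicator {a<..b} s * ennreal (intensity i (max 0 s, \<omega>)) \<partial>d\<Lambda>)"
    unfolding eq .
qed

lemma measurable_stopping:
  fixes T :: "'a \<Rightarrow> real"
  assumes "stopping_time F T" "\<And>\<omega>. \<omega> \<in> space M \<Longrightarrow> 0 \<le> T \<omega>"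
  shows "T \<in> borel_measurable M"
proof (rule borel_measurable_iff_le[THEN iffD2], rule allI)
  fix a :: real
  show "{\<omega> \<in> space M. T \<omega> \<le> a} \<in> sets M"
  proof (cases "0 \<le> a")
    case True
    have "{\<omega> \<in> space (F a). T \<omega> \<le> a} \<in> sets (F a)"
      using stopping_timeD[OF assms(1), of a] by (simp add: pred_def)
    then show ?thesis using F_subset[OF True] by (auto simp: space_F)
  next
    case False
    then have "{\<omega> \<in> space M. T \<omega> \<le> a} = {}" using assms(2) by fastforce
    then show ?thesis by (simp only: sets.empty_sets)
  qed
qed

text \<open>The stopped compensated process is a true martingale, so its increment over \<open>(s, t]\<close> has mean zero on \<open>A\<close>.
  The increment of the counting part is the indicator of an event in \<open>(s, t]\<close> no later than \<open>T\<close>,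
  hence bounded, which makes the increment of the compensator integrable as well.\<close>

lemma event_probability_stopped:
  assumes i: "i \<in> {1..n}" and st: "0 \<le> s" "s \<le> t" and A: "A \<in> sets (F s)"
    and T: "stopping_time F T" "\<And>\<omega>. \<omega> \<in> space M \<Longrightarrow> 0 \<le> T \<omega>"
    and mart: "martingale M F (\<lambda>t \<omega>. real (N i (min t (T \<omega>)) \<omega>)
        - cox_compensator (Y i) (Z i) \<beta>o \<Lambda>0 (min t (T \<omega>)) \<omega>)"
  shows "(\<integral>\<^sup>+\<omega>. indicator {\<omega> \<in> A. occ i \<omega> \<and> s < \<tau> i \<omega> \<and> \<tau> i \<omega> \<le> t \<and> \<tau> i \<omega> \<le> T \<omega>} \<omega> \<partial>M)
    = (\<integral>\<^sup>+\<omega>. indicator A \<omega> * (\<integral>\<^sup>+u. indicator {s<..t} u * indicator {..T \<omega>} u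
          * ennreal (intensity i (max 0 u, \<omega>)) \<partial>d\<Lambda>) \<partial>M)"
proof -
  let ?L = "\<lambda>t \<omega>. cox_compensator (Y i) (Z i) \<beta>o \<Lambda>0 (min t (T \<omega>)) \<omega>"
  let ?X = "\<lambda>t \<omega>. real (N i (min t (T \<omega>)) \<omega>) - ?L t \<omega>"
  let ?B = "{\<omega> \<in> space M. occ i \<omega> \<and> s < \<tau> i \<omega> \<and> \<tau> i \<omega> \<le> t \<and> \<tau> i \<omega> \<le> T \<omega>}"
  have AM: "A \<in> sets M" using A F_subset st by blast
  note measurable_stopping[OF T, measurable]
  note measurable_\<tau>[OF i, measurable]
  have [measurable]: "Measurable.pred M (occ i)" using occ_sets[OF i] by (simp add: pred_def)
  have BM: "?B \<in> sets M" by measurable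
  have "integrable M (?X t)" "integrable M (?X s)" using mart st by (auto simp: martingale_def)
  then have intX: "integrable M (\<lambda>\<omega>. ?X t \<omega> - ?X s \<omega>)" by (rule Bochner_Integration.integrable_diff)
  have intB: "integrable M (indicator ?B :: 'a \<Rightarrow> real)" using BM by (simp add: integrable_indicator_iff emeasure_eq_measure)
  have dN: "real (N i (min t (T \<omega>)) \<omega>) - real (N i (min s (T \<omega>)) \<omega>) = indicator ?B \<omega>" if "\<omega> \<in> space M" for \<omega>
    using N_eq[OF i that, of "min t (T \<omega>)"] N_eq[OF i that, of "min s (T \<omega>)"] T(2)[OF that] st that
    by (auto simp: indicator_def)
  have dL: "?L t \<omega> - ?L s \<omega> = indicator ?B \<omega> - (?X t \<omega> - ?X s \<omega>)" if "\<omega> \<in> space M" for \<omega>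
    using dN[OF that] by simp
  have intL: "integrable M (\<lambda>\<omega>. ?L t \<omega> - ?L s \<omega>)"
    using Bochner_Integration.integrable_diff[OF intB intX] by (subst Bochner_Integration.integrable_cong[OF refl dL])
  \<comment> \<open>Stopping at \<open>T\<close> restricts the integral over \<open>(s, t]\<close> to times up to \<open>T\<close>.\<close>
  have AE_L: "AE \<omega> in M. ennreal (?L t \<omega> - ?L s \<omega>)
      = (\<integral>\<^sup>+u. indicator {s<..t} u * indicator {..T \<omega>} u * ennreal (intensity i (max 0 u, \<omega>)) \<partial>d\<Lambda>)
      \<and> 0 \<le> ?L t \<omega> - ?L s \<omega>"
    using compensator_finite[OF i] AE_space
  proof eventually_elim
    case (elim \<omega>)
    have "ennreal (?L t \<omega> - ?L s \<omega>)
      = (\<integral>\<^sup>+u. indicator {min s (T \<omega>)<..min t (T \<omega>)} u * ennreal (intensity i (max 0 u, \<omega>)) \<partial>d\<Lambda>)"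
      using st T(2) elim by (intro compensator_increment(1)[OF i]) auto
    also have "\<dots> = (\<integral>\<^sup>+u. indicator {s<..t} u * indicator {..T \<omega>} u * ennreal (intensity i (max 0 u, \<omega>)) \<partial>d\<Lambda>)"
      by (intro nn_integral_cong) (auto simp: indicator_def)
    finally show ?case
      using compensator_increment(2)[OF i, of \<omega> "min s (T \<omega>)" "min t (T \<omega>)"] st T(2) elim by auto
  qed
  have "(\<integral>\<omega>. indicator A \<omega> * (?L t \<omega> - ?L s \<omega>) \<partial>M)
    = (\<integral>\<omega>. indicator A \<omega> * indicator ?B \<omega> - indicator A \<omega> * (?X t \<omega> - ?X s \<omega>) \<partial>M)"
    by (intro Bochner_Integration.integral_cong refl) (simp only: dL right_diff_distrib)
  also have "\<dots> = (\<integral>\<omega>. indicator A \<omega> * indicator ?B \<omega> \<partial>M) - (\<integral>\<omega>. indicator A \<omega> * (?X t \<omega> - ?X s \<omega>) \<partial>M)"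
    using integrable_mult_indicator[OF AM intB] integrable_mult_indicator[OF AM intX]
    by (intro Bochner_Integration.integral_diff) simp_all
  also have "(\<integral>\<omega>. indicator A \<omega> * (?X t \<omega> - ?X s \<omega>) \<partial>M) = 0"
    using martingale_increment[OF prob_space_axioms subalgebra_F mart st A] st by simp
  finally have eq: "(\<integral>\<omega>. indicator A \<omega> * (?L t \<omega> - ?L s \<omega>) \<partial>M) = (\<integral>\<omega>. indicator A \<omega> * indicator ?B \<omega> \<partial>M)"
    by simp
  have "(\<integral>\<^sup>+\<omega>. indicator {\<omega> \<in> A. occ i \<omega> \<and> s < \<tau> i \<omega> \<and> \<tau> i \<omega> \<le> t \<and> \<tau> i \<omega> \<le> T \<omega>} \<omega> \<partial>M)
    = (\<integral>\<^sup>+\<omega>. ennreal (indicator A \<omega> * indicator ?B \<omega>) \<partial>M)"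
    using sets.sets_into_space[OF AM] by (intro nn_integral_cong) (auto simp: indicator_def)
  also have "\<dots> = ennreal (\<integral>\<omega>. indicator A \<omega> * indicator ?B \<omega> \<partial>M)"
    using integrable_mult_indicator[OF AM intB] by (intro nn_integral_eq_integral) simp_all
  also have "\<dots> = ennreal (\<integral>\<omega>. indicator A \<omega> * (?L t \<omega> - ?L s \<omega>) \<partial>M)" unfolding eq ..
  also have "\<dots> = (\<integral>\<^sup>+\<omega>. ennreal (indicator A \<omega> * (?L t \<omega> - ?L s \<omega>)) \<partial>M)"
  proof (rule nn_integral_eq_integral[symmetric])
    show "integrable M (\<lambda>\<omega>. indicator A \<omega> * (?L t \<omega> - ?L s \<omega>))"
      using integrable_mult_indicator[OF AM intL] by simp
    show "AE \<omega> in M. 0 \<le> indicator A \<omega> * (?L t \<omega> - ?L s \<omega>)"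
      using AE_L by eventually_elim simp
  qed
  also have "\<dots> = (\<integral>\<^sup>+\<omega>. indicator A \<omega> * (\<integral>\<^sup>+u. indicator {s<..t} u * indicator {..T \<omega>} u
          * ennreal (intensity i (max 0 u, \<omega>)) \<partial>d\<Lambda>) \<partial>M)"
    using AE_L by (intro nn_integral_cong_AE) (auto elim!: eventually_mono simp: indicator_def)
  finally show ?thesis .
qed

text \<open>Localization is removed by monotone convergence: both sides of the stopped identity increase with the
  localizing time.\<close>

lemma event_probability_rectangle:
  assumes i: "i \<in> {1..n}" and st: "0 \<le> s" "s \<le> t" and A: "A \<in> sets (F s)"
  shows "(\<integral>\<^sup>+\<omega>. indicator {\<omega> \<in> A. occ i \<omega> \<and> s < \<tau> i \<omega> \<and> \<tau> i \<omega> \<le> t} \<omega> \<partial>M)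
    = (\<integral>\<^sup>+\<omega>. indicator A \<omega> * (\<integral>\<^sup>+u. indicator {s<..t} u
          * ennreal (intensity i (max 0 u, \<omega>)) \<partial>d\<Lambda>) \<partial>M)"
proof -
  interpret d\<Lambda>: sigma_finite_measure d\<Lambda> by (rule sigma_finite_d\<Lambda>)
  obtain T :: "nat \<Rightarrow> 'a \<Rightarrow> real" where T: "\<And>k. stopping_time F (T k)"
    "\<And>k \<omega>. \<omega> \<in> space M \<Longrightarrow> 0 \<le> T k \<omega>"
    "AE \<omega> in M. incseq (\<lambda>k. T k \<omega>) \<and> filterlim (\<lambda>k. T k \<omega>) at_top sequentially"
    "\<And>k. martingale M F (\<lambda>t \<omega>. real (N i (min t (T k \<omega>)) \<omega>)
        - cox_compensator (Y i) (Z i) \<beta>o \<Lambda>0 (min t (T k \<omega>)) \<omega>)"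
    using compensator[OF i] unfolding is_compensator_def local_martingale_def
    by (elim conjE exE) (rule that, auto)
  have AM: "A \<in> sets M" using A F_subset st by blast
  note measurable_stopping[OF T(1,2), measurable]
  note measurable_\<tau>[OF i, measurable]
  have [measurable]: "Measurable.pred M (occ i)" using occ_sets[OF i] by (simp add: pred_def)
  note AM [measurable]
  have late: "AE \<omega> in M. (\<forall>k. T k \<omega> \<le> T (Suc k) \<omega>) \<and> (\<exists>k. t \<le> T k \<omega>)"
    using T(3)
  proof eventually_elim
    case (elim \<omega>)
    then have "\<forall>\<^sub>F k in sequentially. t \<le> T k \<omega>" by (simp add: filterlim_at_top)
    then show ?case using elim by (auto simp: incseq_Suc_iff dest: eventually_happens)
  qed
  let ?l = "\<lambda>k \<omega>. indicator {\<omega> \<in> A. occ i \<omega> \<and> s < \<tau> i \<omega> \<and> \<tau> i \<omega> \<le> t \<and> \<tau> i \<omega> \<le> T k \<omega>} \<omega> :: ennreal"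
  let ?g = "\<lambda>u \<omega>. ennreal (intensity i (max 0 u, \<omega>))"
  let ?r = "\<lambda>k \<omega>. indicator A \<omega> * (\<integral>\<^sup>+u. indicator {s<..t} u * indicator {..T k \<omega>} u * ?g u \<omega> \<partial>d\<Lambda>)"
  have "(\<integral>\<^sup>+\<omega>. indicator {\<omega> \<in> A. occ i \<omega> \<and> s < \<tau> i \<omega> \<and> \<tau> i \<omega> \<le> t} \<omega> \<partial>M) = (SUP k. \<integral>\<^sup>+\<omega>. ?l k \<omega> \<partial>M)"
  proof (rule nn_integral_SUP_eventually)
    have "{\<omega> \<in> A. occ i \<omega> \<and> s < \<tau> i \<omega> \<and> \<tau> i \<omega> \<le> t \<and> \<tau> i \<omega> \<le> T k \<omega>}
        = A \<inter> {\<omega> \<in> space M. occ i \<omega> \<and> s < \<tau> i \<omega> \<and> \<tau> i \<omega> \<le> t \<and> \<tau> i \<omega> \<le> T k \<omega>}" for k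
      using sets.sets_into_space[OF AM] by auto
    moreover have "A \<inter> {\<omega> \<in> space M. occ i \<omega> \<and> s < \<tau> i \<omega> \<and> \<tau> i \<omega> \<le> t \<and> \<tau> i \<omega> \<le> T k \<omega>} \<in> sets M" for k
      by measurable
    ultimately show "?l k \<in> borel_measurable M" for k by simp
    show "AE \<omega> in M. (\<forall>k. ?l k \<omega> \<le> ?l (Suc k) \<omega>)
      \<and> (\<forall>k. ?l k \<omega> \<le> indicator {\<omega> \<in> A. occ i \<omega> \<and> s < \<tau> i \<omega> \<and> \<tau> i \<omega> \<le> t} \<omega>)
      \<and> (\<exists>k. ?l k \<omega> = indicator {\<omega> \<in> A. occ i \<omega> \<and> s < \<tau> i \<omega> \<and> \<tau> i \<omega> \<le> t} \<omega>)"
      using late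
    proof eventually_elim
      case (elim \<omega>)
      then obtain k where k: "t \<le> T k \<omega>" by blast
      show ?case
      proof (intro conjI allI exI[of _ k])
        fix k
        show "?l k \<omega> \<le> ?l (Suc k) \<omega>"
          using elim order_trans[of "\<tau> i \<omega>" "T k \<omega>" "T (Suc k) \<omega>"] by (auto simp: indicator_def)
        show "?l k \<omega> \<le> indicator {\<omega> \<in> A. occ i \<omega> \<and> s < \<tau> i \<omega> \<and> \<tau> i \<omega> \<le> t} \<omega>"
          by (auto simp: indicator_def)
      next
        show "?l k \<omega> = indicator {\<omega> \<in> A. occ i \<omega> \<and> s < \<tau> i \<omega> \<and> \<tau> i \<omega> \<le> t} \<omega>"
          using k by (auto simp: indicator_def)
      qed
    qed
  qed
  also have "\<dots> = (SUP k. \<integral>\<^sup>+\<omega>. ?r k \<omega> \<partial>M)"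
    using event_probability_stopped[OF i st A T(1,2,4)] by simp
  also have "\<dots> = (\<integral>\<^sup>+\<omega>. indicator A \<omega> * (\<integral>\<^sup>+u. indicator {s<..t} u * ?g u \<omega> \<partial>d\<Lambda>) \<partial>M)"
  proof (rule nn_integral_SUP_eventually[symmetric])
    have [measurable]: "(\<lambda>(u, \<omega>). intensity i (max 0 u, \<omega>)) \<in> borel_measurable (borel \<Otimes>\<^sub>M M)"
      by (rule measurable_clip_time[OF intensity_PS[OF i]])
    show "?r k \<in> borel_measurable M" for k
    proof -
      have "(\<lambda>x. indicator {s<..t} (snd x) * indicator {y. snd y \<le> T k (fst y)} x * ?g (snd x) (fst x))
          \<in> borel_measurable (M \<Otimes>\<^sub>M d\<Lambda>)"
        by measurable
      then have "(\<lambda>(\<omega>, u). indicator {s<..t} u * indicator {..T k \<omega>} u * ?g u \<omega>) \<in> borel_measurable (M \<Otimes>\<^sub>M d\<Lambda>)"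
        by (simp add: case_prod_unfold indicator_def)
      then show ?thesis
        by (intro borel_measurable_times_ennreal d\<Lambda>.borel_measurable_nn_integral) auto
    qed
    show "AE \<omega> in M. (\<forall>k. ?r k \<omega> \<le> ?r (Suc k) \<omega>)
      \<and> (\<forall>k. ?r k \<omega> \<le> indicator A \<omega> * (\<integral>\<^sup>+u. indicator {s<..t} u * ?g u \<omega> \<partial>d\<Lambda>))
      \<and> (\<exists>k. ?r k \<omega> = indicator A \<omega> * (\<integral>\<^sup>+u. indicator {s<..t} u * ?g u \<omega> \<partial>d\<Lambda>))"
      using late
    proof eventually_elim
      case (elim \<omega>)
      then obtain k where k: "t \<le> T k \<omega>" by blast
      show ?case
      proof (intro conjI allI exI[of _ k])
        fix k
        have "T k \<omega> \<le> T (Suc k) \<omega>" using elim by blast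
        then show "?r k \<omega> \<le> ?r (Suc k) \<omega>"
          by (intro mult_left_mono nn_integral_mono mult_right_mono) (auto simp: indicator_def)
        show "?r k \<omega> \<le> indicator A \<omega> * (\<integral>\<^sup>+u. indicator {s<..t} u * ?g u \<omega> \<partial>d\<Lambda>)"
          by (intro mult_left_mono nn_integral_mono mult_right_mono) (auto simp: indicator_def)
      next
        show "?r k \<omega> = indicator A \<omega> * (\<integral>\<^sup>+u. indicator {s<..t} u * ?g u \<omega> \<partial>d\<Lambda>)"
          using k by (intro arg_cong2[where f="(*)"] nn_integral_cong refl) (auto simp: indicator_def)
      qed
    qed
  qed
  finally show ?thesis .
qed

end

context one_event_cox
begin

lemma occ_pred: "i \<in> {1..n} \<Longrightarrow> Measurable.pred M (occ i)"
  using occ_sets by (simp add: pred_def)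

text \<open>Two half-open strips meet in the strip from the later start, at which both events of the past
  are known; a strip and the initial section are disjoint.\<close>

lemma predictable_generator_Int_stable:
  "Int_stable ({{0} \<times> A | A. A \<in> sets (F 0)} \<union>
      {{s<..t} \<times> A | s t A. 0 \<le> s \<and> s < t \<and> A \<in> sets (F s)})" (is "Int_stable (?E0 \<union> ?E1)")
proof (rule Int_stableI)
  have empty: "{} \<in> ?E0 \<union> ?E1"
    by (rule UnI1) (rule CollectI, rule exI[of _ "{}"], simp)
  fix X X' assume "X \<in> ?E0 \<union> ?E1" "X' \<in> ?E0 \<union> ?E1"
  then consider A A' where "X = {0} \<times> A" "X' = {0} \<times> A'" "A \<in> sets (F 0)" "A' \<in> sets (F 0)"
    | A s t A' where "X = {0} \<times> A" "X' = {s<..t} \<times> A'" "0 \<le> s"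
    | A s t A' where "X = {s<..t} \<times> A" "X' = {0} \<times> A'" "0 \<le> s"
    | A s t A' s' t' where "X = {s<..t} \<times> A" "X' = {s'<..t'} \<times> A'"
       "0 \<le> s" "0 \<le> s'" "A \<in> sets (F s)" "A' \<in> sets (F s')"
    by blast
  then show "X \<inter> X' \<in> ?E0 \<union> ?E1"
  proof cases
    case 1
    then have "X \<inter> X' = {0} \<times> (A \<inter> A')" by auto
    then show ?thesis using 1 by blast
  next
    case 2
    then have "X \<inter> X' = {}" by auto
    then show ?thesis using empty by simp
  next
    case 3
    then have "X \<inter> X' = {}" by auto
    then show ?thesis using empty by simp
  next
    case 4
    have eq: "X \<inter> X' = {max s s'<..min t t'} \<times> (A \<inter> A')" using 4 by auto
    show ?thesis
    proof (cases "max s s' < min t t'")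
      case True
      have "A \<inter> A' \<in> sets (F (max s s'))"
        using 4 sets_F_mono[of s "max s s'"] sets_F_mono[of s' "max s s'"] by auto
      moreover have "0 \<le> max s s'" using 4 by simp
      ultimately have "X \<inter> X' \<in> ?E1" unfolding eq using True by blast
      then show ?thesis by (rule UnI2)
    next
      case False
      then have "X \<inter> X' = {}" unfolding eq by simp
      then show ?thesis using empty by simp
    qed
  qed
qed

text \<open>Both sides are integrals of \<open>H\<close> against measures on the predictable \<open>\<sigma>\<close>-algebra: on the left the
  law \<open>\<mu>\<close> of \<open>(\<tau> i, \<omega>)\<close> on the set where the event occurs, on the right the measure \<open>\<nu>\<close> with
  the intensity on positive times as density against \<open>d\<Lambda> \<Otimes>\<^sub>M M\<close>. They are finite and agree on the generating rectangles.\<close>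

lemma compensation_formula:
  assumes i: "i \<in> {1..n}" and H: "H \<in> borel_measurable PS"
  shows "(\<integral>\<^sup>+\<omega>. indicator {\<omega>. occ i \<omega>} \<omega> * H (\<tau> i \<omega>, \<omega>) \<partial>M)
    = (\<integral>\<^sup>+\<omega>. \<integral>\<^sup>+u. indicator {0<..} u * ennreal (intensity i (max 0 u, \<omega>)) * H (max 0 u, \<omega>) \<partial>d\<Lambda> \<partial>M)"
proof -
  interpret d\<Lambda>: sigma_finite_measure d\<Lambda> by (rule sigma_finite_d\<Lambda>)
  interpret dM: pair_sigma_finite d\<Lambda> M ..
  note occ_pred[OF i, measurable]
  have ind_occ [measurable]: "(\<lambda>\<omega>. indicator {\<omega>. occ i \<omega>} \<omega> :: ennreal) \<in> borel_measurable M"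
    unfolding indicator_def by measurable
  have pair [measurable]: "(\<lambda>\<omega>. (\<tau> i \<omega>, \<omega>)) \<in> measurable M PS"
    using measurable_at_\<tau>[OF i measurable_ident] by simp
  have clip [measurable]: "clip \<in> measurable (d\<Lambda> \<Otimes>\<^sub>M M) PS"
    using measurable_d\<Lambda>_pair[OF measurable_ident] by (simp add: clip_def)
  define w where "w = (\<lambda>(u, \<omega>). indicator {0<..} u * ennreal (intensity i (max 0 u, \<omega>)))"
  have w [measurable]: "w \<in> borel_measurable (d\<Lambda> \<Otimes>\<^sub>M M)"
  proof -
    have [measurable]: "(\<lambda>(u, \<omega>). intensity i (max 0 u, \<omega>)) \<in> borel_measurable (d\<Lambda> \<Otimes>\<^sub>M M)"
      by (rule measurable_d\<Lambda>_pair[OF intensity_PS[OF i]])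
    show ?thesis unfolding w_def by measurable
  qed
  define \<mu> where "\<mu> = distr (density M (indicator {\<omega>. occ i \<omega>})) PS (\<lambda>\<omega>. (\<tau> i \<omega>, \<omega>))"
  define \<nu> where "\<nu> = distr (density (d\<Lambda> \<Otimes>\<^sub>M M) w) PS clip"
  have int_\<mu>: "(\<integral>\<^sup>+x. G x \<partial>\<mu>) = (\<integral>\<^sup>+\<omega>. indicator {\<omega>. occ i \<omega>} \<omega> * G (\<tau> i \<omega>, \<omega>) \<partial>M)"
    if [measurable]: "G \<in> borel_measurable PS" for G :: "real \<times> 'a \<Rightarrow> ennreal"
    unfolding \<mu>_def by (subst nn_integral_distr, measurable, subst nn_integral_density) measurable
  have int_\<nu>: "(\<integral>\<^sup>+x. G x \<partial>\<nu>)
      = (\<integral>\<^sup>+\<omega>. \<integral>\<^sup>+u. indicator {0<..} u * ennreal (intensity i (max 0 u, \<omega>)) * G (max 0 u, \<omega>) \<partial>d\<Lambda> \<partial>M)"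
    if [measurable]: "G \<in> borel_measurable PS" for G :: "real \<times> 'a \<Rightarrow> ennreal"
  proof -
    have "(\<integral>\<^sup>+x. G x \<partial>\<nu>) = (\<integral>\<^sup>+x. w x * G (clip x) \<partial>(d\<Lambda> \<Otimes>\<^sub>M M))"
      unfolding \<nu>_def by (subst nn_integral_distr, measurable, subst nn_integral_density) measurable
    also have "\<dots> = (\<integral>\<^sup>+\<omega>. \<integral>\<^sup>+u. w (u, \<omega>) * G (clip (u, \<omega>)) \<partial>d\<Lambda> \<partial>M)"
      by (subst dM.nn_integral_snd[symmetric]) measurable
    finally show ?thesis by (simp add: w_def clip_def)
  qed
  let ?E = "{{0} \<times> A | A. A \<in> sets (F 0)} \<union> {{s<..t} \<times> A | s t A. 0 \<le> s \<and> s < t \<and> A \<in> sets (F s)}"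
  have E_PS: "X \<in> sets PS" if "X \<in> ?E" for X
    unfolding sets_predictable_sigma[OF F_Pow] using that by (rule sigma_sets.Basic)
  have eq: "emeasure \<mu> X = emeasure \<nu> X" if "X \<in> ?E" for X
  proof -
    have X: "X \<in> sets PS" by (rule E_PS[OF that])
    then have i\<mu>: "emeasure \<mu> X = (\<integral>\<^sup>+\<omega>. indicator {\<omega>. occ i \<omega>} \<omega> * indicator X (\<tau> i \<omega>, \<omega>) \<partial>M)"
      using int_\<mu>[of "indicator X"] by (simp add: \<mu>_def)
    from X have i\<nu>: "emeasure \<nu> X = (\<integral>\<^sup>+\<omega>. \<integral>\<^sup>+u. indicator {0<..} u * ennreal (intensity i (max 0 u, \<omega>))
        * indicator X (max 0 u, \<omega>) \<partial>d\<Lambda> \<partial>M)"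
      using int_\<nu>[of "indicator X"] by (simp add: \<nu>_def)
    from that consider A where "X = {0} \<times> A" | s t A where "X = {s<..t} \<times> A" "0 \<le> s" "s < t" "A \<in> sets (F s)"
      by blast
    then show ?thesis
    proof cases
      case 1
      have "emeasure \<mu> X = (\<integral>\<^sup>+\<omega>. 0 \<partial>M)" unfolding i\<mu>
      proof (rule nn_integral_cong)
        fix \<omega> assume "\<omega> \<in> space M"
        then show "indicator {\<omega>. occ i \<omega>} \<omega> * indicator X (\<tau> i \<omega>, \<omega>) = (0::ennreal)"
          using \<tau>_pos[OF i, of \<omega>] by (auto simp: 1 indicator_def)
      qed
      moreover have "emeasure \<nu> X = (\<integral>\<^sup>+\<omega>. \<integral>\<^sup>+u. 0 \<partial>d\<Lambda> \<partial>M)" unfolding i\<nu>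
        by (intro nn_integral_cong) (auto simp: 1 indicator_def)
      ultimately show ?thesis by simp
    next
      case 2
      have "emeasure \<mu> X = (\<integral>\<^sup>+\<omega>. indicator {\<omega> \<in> A. occ i \<omega> \<and> s < \<tau> i \<omega> \<and> \<tau> i \<omega> \<le> t} \<omega> \<partial>M)"
        unfolding i\<mu> by (intro nn_integral_cong) (auto simp: 2(1) indicator_def)
      also have "\<dots> = (\<integral>\<^sup>+\<omega>. indicator A \<omega> * (\<integral>\<^sup>+u. indicator {s<..t} u
          * ennreal (intensity i (max 0 u, \<omega>)) \<partial>d\<Lambda>) \<partial>M)"
        using 2 by (intro event_probability_rectangle[OF i]) auto
      also have "\<dots> = emeasure \<nu> X" unfolding i\<nu> unfolding 2(1)
      proof (rule nn_integral_cong)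
        fix \<omega>
        show "indicator A \<omega> * (\<integral>\<^sup>+u. indicator {s<..t} u * ennreal (intensity i (max 0 u, \<omega>)) \<partial>d\<Lambda>)
          = (\<integral>\<^sup>+u. indicator {0<..} u * ennreal (intensity i (max 0 u, \<omega>)) * indicator ({s<..t} \<times> A) (max 0 u, \<omega>) \<partial>d\<Lambda>)"
        proof (cases "\<omega> \<in> A")
          case True
          have "(\<integral>\<^sup>+u. indicator {s<..t} u * ennreal (intensity i (max 0 u, \<omega>)) \<partial>d\<Lambda>)
            = (\<integral>\<^sup>+u. indicator {0<..} u * ennreal (intensity i (max 0 u, \<omega>)) * indicator ({s<..t} \<times> A) (max 0 u, \<omega>) \<partial>d\<Lambda>)"
            using True 2(2) by (intro nn_integral_cong) (auto simp: indicator_def)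
          then show ?thesis using True by simp
        qed simp
      qed
      finally show ?thesis .
    qed
  qed
  have "\<mu> = \<nu>"
  proof (rule measure_eqI_generator_eq_countable[where E = ?E and \<Omega> = "{0..} \<times> space M"
        and A = "insert ({0} \<times> space M) (range (\<lambda>k. {0<..real (Suc k)} \<times> space M))"])
    show "Int_stable ?E" by (rule predictable_generator_Int_stable)
    show "?E \<subseteq> Pow ({0..} \<times> space M)"
      using sets.sets_into_space[OF E_PS] unfolding space_PS by blast
    show "sets \<mu> = sigma_sets ({0..} \<times> space M) ?E" "sets \<nu> = sigma_sets ({0..} \<times> space M) ?E"
      unfolding \<mu>_def \<nu>_def by (simp_all add: sets_predictable_sigma[OF F_Pow])
    have top: "space M \<in> sets (F 0)" using sets.top[of "F 0"] by (simp add: space_F)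
    show "insert ({0} \<times> space M) (range (\<lambda>k. {0<..real (Suc k)} \<times> space M)) \<subseteq> ?E"
    proof (intro insert_subsetI image_subsetI)
      show "{0} \<times> space M \<in> ?E" using top by blast
      fix k
      have "{0<..real (Suc k)} \<times> space M \<in> {{s<..t} \<times> A | s t A. 0 \<le> s \<and> s < t \<and> A \<in> sets (F s)}"
        using top by (intro CollectI exI[of _ 0] exI[of _ "real (Suc k)"] exI[of _ "space M"]) auto
      then show "{0<..real (Suc k)} \<times> space M \<in> ?E" by (rule UnI2)
    qed
    show "\<Union> (insert ({0} \<times> space M) (range (\<lambda>k. {0<..real (Suc k)} \<times> space M))) = {0..} \<times> space M"
    proof (intro set_eqI iffI)
      fix x :: "real \<times> 'a" assume x: "x \<in> {0..} \<times> space M"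
      show "x \<in> \<Union> (insert ({0} \<times> space M) (range (\<lambda>k. {0<..real (Suc k)} \<times> space M)))"
      proof (cases "fst x = 0")
        case False
        obtain k where "fst x \<le> real k" using real_arch_simple by blast
        then have "x \<in> {0<..real (Suc k)} \<times> space M" using x False by auto
        then show ?thesis by blast
      qed (use x in auto)
    qed auto
    show "countable (insert ({0} \<times> space M) (range (\<lambda>k. {0<..real (Suc k)} \<times> space M)))" by simp
    fix X assume "X \<in> insert ({0} \<times> space M) (range (\<lambda>k. {0<..real (Suc k)} \<times> space M))"
    have "emeasure \<mu> (space \<mu>) = (\<integral>\<^sup>+\<omega>. indicator {\<omega>. occ i \<omega>} \<omega> \<partial>M)"
      using int_\<mu>[of "\<lambda>_. 1"] by simp
    also have "\<dots> \<le> (\<integral>\<^sup>+\<omega>. 1 \<partial>M)" by (intro nn_integral_mono) (auto simp: indicator_def)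
    also have "\<dots> = 1" by (simp add: emeasure_space_1)
    finally have "emeasure \<mu> X \<le> 1" using emeasure_space[of \<mu> X] by (rule order_trans[rotated])
    then show "emeasure \<mu> X \<noteq> \<infinity>" by (auto simp: top_unique)
  qed (rule eq)
  then show ?thesis using int_\<mu>[OF H] int_\<nu>[OF H] by simp
qed

end

section \<open>Sub-Gaussian tails for sums over the events\<close>

context one_event_cox
begin

text \<open>With \<open>f i = exp (c a i - v)\<close> and \<open>W\<close> the product of the factors \<open>f j\<close> over the events before the current
  time, the final product is \<open>1 + \<Sum> W (f i - 1)\<close>, summed over the events. The compensation formula turns
  the mean of this sum into an integral of \<open>W \<Sum> intensity i (f i - 1)\<close>, which is nonpositive
  by Hoeffding's lemma at every time. The value of \<open>W\<close> used at an event excludes the event itself,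
  and this is what makes \<open>W\<close> predictable.\<close>

lemma exp_moment_bound:
  fixes a :: "nat \<Rightarrow> real \<times> 'a \<Rightarrow> real" and c K :: real
  assumes a: "\<And>i. i \<in> {1..n} \<Longrightarrow> a i \<in> borel_measurable PS"
    and bound: "AE \<omega> in M. \<forall>i\<in>{1..n}. \<forall>s>0. \<bar>a i (s, \<omega>)\<bar> \<le> K" and K: "0 < K"
    and center: "\<And>s \<omega>. 0 < s \<Longrightarrow> \<omega> \<in> space M \<Longrightarrow> (\<Sum>i\<in>{1..n}. intensity i (s, \<omega>) * a i (s, \<omega>)) = 0"
  shows "(\<integral>\<^sup>+\<omega>. ennreal (exp (c * (\<Sum>i\<in>{i\<in>{1..n}. occ i \<omega>}. a i (\<tau> i \<omega>, \<omega>)))) \<partial>M)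
    \<le> ennreal (exp (real n * (c\<^sup>2 * K\<^sup>2 / 2)))"
proof -
  interpret d\<Lambda>: sigma_finite_measure d\<Lambda> by (rule sigma_finite_d\<Lambda>)
  define v where "v = c\<^sup>2 * K\<^sup>2 / 2"
  define f where "f = (\<lambda>i x. exp (c * a i x - v))"
  define W where "W = (\<lambda>(s, \<omega>). \<Prod>j\<in>{1..n}. if occ j \<omega> \<and> \<tau> j \<omega> < s then f j (\<tau> j \<omega>, \<omega>) else 1)"
  define Winf where "Winf = (\<lambda>\<omega>. \<Prod>j\<in>{1..n}. if occ j \<omega> then f j (\<tau> j \<omega>, \<omega>) else 1)"
  have f_PS: "f i \<in> borel_measurable PS" if "i \<in> {1..n}" for i
    unfolding f_def using a[OF that] by measurable
  have W_PS: "W \<in> borel_measurable PS"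
  proof -
    have "(\<lambda>x. \<Prod>j\<in>{1..n}. (\<lambda>(s, \<omega>). if occ j \<omega> \<and> \<tau> j \<omega> < s then f j (\<tau> j \<omega>, \<omega>) else 1) x) \<in> borel_measurable PS"
      by (intro borel_measurable_prod past_value_predictable f_PS)
    then show ?thesis by (simp add: W_def case_prod_unfold)
  qed
  have f_pos: "0 < f i x" for i x by (simp add: f_def)
  have W_pos: "0 < W x" for x unfolding W_def case_prod_unfold by (intro prod_pos) (simp add: f_pos)
  have Winf_pos: "0 < Winf \<omega>" for \<omega> unfolding Winf_def by (intro prod_pos) (simp add: f_pos)
  have Winf_meas: "Winf \<in> borel_measurable M"
    unfolding Winf_def
    by (intro borel_measurable_prod measurable_If measurable_at_\<tau> f_PS measurable_const occ_sets) auto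
  let ?S = "\<lambda>\<omega>. {i \<in> {1..n}. occ i \<omega>}"
  let ?o = "\<lambda>i \<omega>. indicator {\<omega>. occ i \<omega>} \<omega>"
  have o_meas: "(\<lambda>\<omega>. ?o i \<omega> :: ennreal) \<in> borel_measurable M" if "i \<in> {1..n}" for i
    using occ_pred[OF that] unfolding indicator_def by measurable
  have telescope: "Winf \<omega> + (\<Sum>i\<in>{1..n}. ?o i \<omega> * W (\<tau> i \<omega>, \<omega>))
      = 1 + (\<Sum>i\<in>{1..n}. ?o i \<omega> * (W (\<tau> i \<omega>, \<omega>) * f i (\<tau> i \<omega>, \<omega>)))" if "\<omega> \<in> space M" for \<omega>
  proof -
    let ?x = "\<lambda>i. f i (\<tau> i \<omega>, \<omega>)"
    have W_eq: "W (\<tau> i \<omega>, \<omega>) = (\<Prod>j\<in>{j \<in> ?S \<omega>. \<tau> j \<omega> < \<tau> i \<omega>}. ?x j)" for i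
      unfolding W_def by (simp add: prod.inter_filter[symmetric] conj_assoc)
    have "Winf \<omega> = (\<Prod>i\<in>?S \<omega>. ?x i)" unfolding Winf_def by (simp add: prod.inter_filter[symmetric])
    also have "\<dots> = 1 + (\<Sum>i\<in>?S \<omega>. (\<Prod>j\<in>{j \<in> ?S \<omega>. \<tau> j \<omega> < \<tau> i \<omega>}. ?x j) * (?x i - 1))"
      by (rule prod_telescope_ordered) (use \<tau>_distinct that in \<open>auto simp: inj_on_def\<close>)
    also have "\<dots> = 1 + (\<Sum>i\<in>{1..n}. if occ i \<omega> then W (\<tau> i \<omega>, \<omega>) * (?x i - 1) else 0)"
      unfolding W_eq[symmetric] by (simp add: sum.inter_filter[symmetric])
    also have "\<dots> = 1 + (\<Sum>i\<in>{1..n}. ?o i \<omega> * (W (\<tau> i \<omega>, \<omega>) * ?x i) - ?o i \<omega> * W (\<tau> i \<omega>, \<omega>))"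
      by (intro arg_cong2[where f = "(+)"] sum.cong refl) (auto simp: algebra_simps)
    finally show ?thesis by (simp add: sum_subtractf)
  qed
  define I0 where "I0 = (\<Sum>i\<in>{1..n}. \<integral>\<^sup>+\<omega>. ?o i \<omega> * ennreal (W (\<tau> i \<omega>, \<omega>)) \<partial>M)"
  define I1 where "I1 = (\<Sum>i\<in>{1..n}. \<integral>\<^sup>+\<omega>. ?o i \<omega> * ennreal (W (\<tau> i \<omega>, \<omega>) * f i (\<tau> i \<omega>, \<omega>)) \<partial>M)"
  have EW_PS: "(\<lambda>x. ennreal (W x)) \<in> borel_measurable PS"
    and EWf_PS: "i \<in> {1..n} \<Longrightarrow> (\<lambda>x. ennreal (W x * f i x)) \<in> borel_measurable PS" for i
    using W_PS f_PS by measurable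
  \<comment> \<open>The telescoping identity is kept free of subtraction so that it can be integrated in \<open>ennreal\<close>;
      finiteness of \<open>I0\<close> allows the cancellation at the end.\<close>
  have balance: "(\<integral>\<^sup>+\<omega>. ennreal (Winf \<omega>) \<partial>M) + I0 = 1 + I1"
  proof -
    have m0: "(\<lambda>\<omega>. ?o i \<omega> * ennreal (W (\<tau> i \<omega>, \<omega>))) \<in> borel_measurable M" if "i \<in> {1..n}" for i
      using o_meas[OF that] measurable_at_\<tau>[OF that EW_PS] by measurable
    have m1: "(\<lambda>\<omega>. ?o i \<omega> * ennreal (W (\<tau> i \<omega>, \<omega>) * f i (\<tau> i \<omega>, \<omega>))) \<in> borel_measurable M" if "i \<in> {1..n}" for i
      using o_meas[OF that] measurable_at_\<tau>[OF that EWf_PS[OF that]] by measurable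
    have ind: "?o i \<omega> * ennreal r = ennreal (?o i \<omega> * r)" if "0 \<le> r" for i \<omega> r
      using that by (auto simp: indicator_def)
    have "(\<integral>\<^sup>+\<omega>. ennreal (Winf \<omega>) \<partial>M) + I0
        = (\<integral>\<^sup>+\<omega>. ennreal (Winf \<omega>) + (\<Sum>i\<in>{1..n}. ?o i \<omega> * ennreal (W (\<tau> i \<omega>, \<omega>))) \<partial>M)"
    proof -
      have "I0 = (\<integral>\<^sup>+\<omega>. (\<Sum>i\<in>{1..n}. ?o i \<omega> * ennreal (W (\<tau> i \<omega>, \<omega>))) \<partial>M)"
        unfolding I0_def by (rule nn_integral_sum[symmetric]) (rule m0)
      then show ?thesis
        using Winf_meas m0 by (simp only:) (intro nn_integral_add[symmetric] borel_measurable_sum, simp_all)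
    qed
    also have "\<dots> = (\<integral>\<^sup>+\<omega>. 1 + (\<Sum>i\<in>{1..n}. ?o i \<omega> * ennreal (W (\<tau> i \<omega>, \<omega>) * f i (\<tau> i \<omega>, \<omega>))) \<partial>M)"
    proof (rule nn_integral_cong)
      fix \<omega> assume \<omega>: "\<omega> \<in> space M"
      have nn: "0 \<le> W x" "0 \<le> f i x" for i x using W_pos[of x] f_pos[of i x] by simp_all
      have "ennreal (Winf \<omega>) + (\<Sum>i\<in>{1..n}. ?o i \<omega> * ennreal (W (\<tau> i \<omega>, \<omega>)))
        = ennreal (Winf \<omega> + (\<Sum>i\<in>{1..n}. ?o i \<omega> * W (\<tau> i \<omega>, \<omega>)))"
        using nn Winf_pos[of \<omega>] by (subst ennreal_plus) (auto intro!: sum_nonneg simp: ind sum_ennreal)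
      also have "\<dots> = ennreal (1 + (\<Sum>i\<in>{1..n}. ?o i \<omega> * (W (\<tau> i \<omega>, \<omega>) * f i (\<tau> i \<omega>, \<omega>))))"
        unfolding telescope[OF \<omega>] ..
      also have "\<dots> = 1 + (\<Sum>i\<in>{1..n}. ?o i \<omega> * ennreal (W (\<tau> i \<omega>, \<omega>) * f i (\<tau> i \<omega>, \<omega>)))"
        using nn by (subst ennreal_plus) (auto intro!: sum_nonneg simp: ind sum_ennreal)
      finally show "ennreal (Winf \<omega>) + (\<Sum>i\<in>{1..n}. ?o i \<omega> * ennreal (W (\<tau> i \<omega>, \<omega>)))
        = 1 + (\<Sum>i\<in>{1..n}. ?o i \<omega> * ennreal (W (\<tau> i \<omega>, \<omega>) * f i (\<tau> i \<omega>, \<omega>)))" .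
    qed
    also have "\<dots> = 1 + I1"
    proof -
      have "I1 = (\<integral>\<^sup>+\<omega>. (\<Sum>i\<in>{1..n}. ?o i \<omega> * ennreal (W (\<tau> i \<omega>, \<omega>) * f i (\<tau> i \<omega>, \<omega>))) \<partial>M)"
        unfolding I1_def by (rule nn_integral_sum[symmetric]) (rule m1)
      moreover have "(\<integral>\<^sup>+\<omega>. 1 + (\<Sum>i\<in>{1..n}. ?o i \<omega> * ennreal (W (\<tau> i \<omega>, \<omega>) * f i (\<tau> i \<omega>, \<omega>))) \<partial>M)
        = (\<integral>\<^sup>+\<omega>. 1 \<partial>M) + (\<integral>\<^sup>+\<omega>. (\<Sum>i\<in>{1..n}. ?o i \<omega> * ennreal (W (\<tau> i \<omega>, \<omega>) * f i (\<tau> i \<omega>, \<omega>))) \<partial>M)"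
        by (rule nn_integral_add[OF measurable_const]) (simp, intro borel_measurable_sum m1)
      ultimately show ?thesis by (simp only: nn_integral_const emeasure_space_1 mult_1_right)
    qed
    finally show ?thesis .
  qed
  let ?G = "\<lambda>i H u \<omega>. indicator {0<..} u * ennreal (intensity i (max 0 u, \<omega>)) * H (max 0 u, \<omega>)"
  have sum_formula: "(\<Sum>i\<in>{1..n}. \<integral>\<^sup>+\<omega>. ?o i \<omega> * H i (\<tau> i \<omega>, \<omega>) \<partial>M)
      = (\<integral>\<^sup>+\<omega>. \<integral>\<^sup>+u. (\<Sum>i\<in>{1..n}. ?G i (H i) u \<omega>) \<partial>d\<Lambda> \<partial>M)"
    if H: "\<And>i. i \<in> {1..n} \<Longrightarrow> H i \<in> borel_measurable PS" for H :: "nat \<Rightarrow> real \<times> 'a \<Rightarrow> ennreal"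
  proof -
    have meas: "(\<lambda>(\<omega>, u). ?G i (H i) u \<omega>) \<in> borel_measurable (M \<Otimes>\<^sub>M d\<Lambda>)" if i: "i \<in> {1..n}" for i
    proof -
      have [measurable]: "(\<lambda>(s, \<omega>). intensity i (max 0 s, \<omega>)) \<in> borel_measurable (borel \<Otimes>\<^sub>M M)"
        "(\<lambda>(s, \<omega>). H i (max 0 s, \<omega>)) \<in> borel_measurable (borel \<Otimes>\<^sub>M M)"
        by (rule measurable_clip_time[OF intensity_PS[OF i]], rule measurable_clip_time[OF H[OF i]])
      show ?thesis by measurable
    qed
    have "(\<Sum>i\<in>{1..n}. \<integral>\<^sup>+\<omega>. ?o i \<omega> * H i (\<tau> i \<omega>, \<omega>) \<partial>M)
      = (\<Sum>i\<in>{1..n}. \<integral>\<^sup>+\<omega>. \<integral>\<^sup>+u. ?G i (H i) u \<omega> \<partial>d\<Lambda> \<partial>M)"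
      by (intro sum.cong refl compensation_formula H)
    also have "\<dots> = (\<integral>\<^sup>+\<omega>. (\<Sum>i\<in>{1..n}. \<integral>\<^sup>+u. ?G i (H i) u \<omega> \<partial>d\<Lambda>) \<partial>M)"
      by (intro nn_integral_sum[symmetric] d\<Lambda>.borel_measurable_nn_integral meas)
    also have "\<dots> = (\<integral>\<^sup>+\<omega>. \<integral>\<^sup>+u. (\<Sum>i\<in>{1..n}. ?G i (H i) u \<omega>) \<partial>d\<Lambda> \<partial>M)"
    proof (intro nn_integral_cong nn_integral_sum[symmetric])
      fix \<omega> i assume "\<omega> \<in> space M" "i \<in> {1..n}"
      then show "(\<lambda>u. ?G i (H i) u \<omega>) \<in> borel_measurable d\<Lambda>"
        using measurable_Pair2[OF meas] by simp
    qed
    finally show ?thesis .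
  qed
  have "I1 \<le> I0"
  proof -
    have "I1 = (\<integral>\<^sup>+\<omega>. \<integral>\<^sup>+u. (\<Sum>i\<in>{1..n}. ?G i (\<lambda>x. ennreal (W x * f i x)) u \<omega>) \<partial>d\<Lambda> \<partial>M)"
      unfolding I1_def by (rule sum_formula[OF EWf_PS])
    also have "\<dots> \<le> (\<integral>\<^sup>+\<omega>. \<integral>\<^sup>+u. (\<Sum>i\<in>{1..n}. ?G i (\<lambda>x. ennreal (W x)) u \<omega>) \<partial>d\<Lambda> \<partial>M)"
    proof (rule nn_integral_mono_AE)
      show "AE \<omega> in M. (\<integral>\<^sup>+u. (\<Sum>i\<in>{1..n}. ?G i (\<lambda>x. ennreal (W x * f i x)) u \<omega>) \<partial>d\<Lambda>)
          \<le> (\<integral>\<^sup>+u. (\<Sum>i\<in>{1..n}. ?G i (\<lambda>x. ennreal (W x)) u \<omega>) \<partial>d\<Lambda>)"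
        using bound AE_space
      proof eventually_elim
        case (elim \<omega>)
        show ?case
        proof (rule nn_integral_mono)
          fix u
          show "(\<Sum>i\<in>{1..n}. ?G i (\<lambda>x. ennreal (W x * f i x)) u \<omega>)
            \<le> (\<Sum>i\<in>{1..n}. ?G i (\<lambda>x. ennreal (W x)) u \<omega>)"
          proof (cases "0 < u")
            case True
            let ?l = "\<lambda>i. intensity i (u, \<omega>)"
            have l: "0 \<le> ?l i" if "i \<in> {1..n}" for i using intensity_nonneg[OF that] True elim by auto
            have nn: "0 \<le> W x" "0 \<le> f i x" for i x using W_pos[of x] f_pos[of i x] by simp_all
            have "(\<Sum>i\<in>{1..n}. ?l i * (W (u, \<omega>) * f i (u, \<omega>)))
              = W (u, \<omega>) * exp (- v) * (\<Sum>i\<in>{1..n}. ?l i * exp (c * a i (u, \<omega>)))"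
              unfolding f_def by (simp add: sum_distrib_left exp_diff exp_minus field_simps)
            also have "\<dots> \<le> W (u, \<omega>) * exp (- v) * (exp v * (\<Sum>i\<in>{1..n}. ?l i))"
              unfolding v_def using elim True l nn K center
              by (intro mult_left_mono centered_exp_sum_le) auto
            also have "\<dots> = (\<Sum>i\<in>{1..n}. ?l i * W (u, \<omega>))"
            proof -
              have "W (u, \<omega>) * exp (- v) * (exp v * (\<Sum>i\<in>{1..n}. ?l i)) = W (u, \<omega>) * (\<Sum>i\<in>{1..n}. ?l i)"
                by (simp add: exp_minus)
              then show ?thesis by (simp only: sum_distrib_left mult.commute[of "W _"])
            qed
            finally have "ennreal (\<Sum>i\<in>{1..n}. ?l i * (W (u, \<omega>) * f i (u, \<omega>)))
              \<le> ennreal (\<Sum>i\<in>{1..n}. ?l i * W (u, \<omega>))" by (rule ennreal_leI)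
            moreover have "(\<Sum>i\<in>{1..n}. ?G i (\<lambda>x. ennreal (W x * f i x)) u \<omega>)
              = ennreal (\<Sum>i\<in>{1..n}. ?l i * (W (u, \<omega>) * f i (u, \<omega>)))"
              using True l nn
              by (subst sum_ennreal[symmetric]) (auto intro!: sum.cong simp: ennreal_mult max_def)
            moreover have "(\<Sum>i\<in>{1..n}. ?G i (\<lambda>x. ennreal (W x)) u \<omega>)
              = ennreal (\<Sum>i\<in>{1..n}. ?l i * W (u, \<omega>))"
              using True l nn
              by (subst sum_ennreal[symmetric]) (auto intro!: sum.cong simp: ennreal_mult max_def)
            ultimately show ?thesis by simp
          qed simp
        qed
      qed
    qed
    also have "\<dots> = I0" unfolding I0_def by (rule sum_formula[OF EW_PS, symmetric])
    finally show ?thesis .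
  qed
  have "I0 < \<infinity>"
  proof -
    let ?B = "exp (\<bar>c\<bar> * K)"
    have "(\<integral>\<^sup>+\<omega>. ?o i \<omega> * ennreal (W (\<tau> i \<omega>, \<omega>)) \<partial>M) \<le> (\<integral>\<^sup>+\<omega>. ennreal (?B ^ n) \<partial>M)" for i
    proof (rule nn_integral_mono_AE)
      show "AE \<omega> in M. ?o i \<omega> * ennreal (W (\<tau> i \<omega>, \<omega>)) \<le> ennreal (?B ^ n)"
        using bound AE_space
      proof eventually_elim
        case (elim \<omega>)
        have "W (\<tau> i \<omega>, \<omega>) \<le> (\<Prod>j\<in>{1..n}. ?B)"
          unfolding W_def case_prod_conv
        proof (rule prod_mono)
          fix j assume j: "j \<in> {1..n}"
          have "f j (\<tau> j \<omega>, \<omega>) \<le> ?B" if "occ j \<omega>"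
          proof -
            have "c * a j (\<tau> j \<omega>, \<omega>) \<le> \<bar>c\<bar> * \<bar>a j (\<tau> j \<omega>, \<omega>)\<bar>"
              by (metis abs_ge_self abs_mult)
            also have "\<dots> \<le> \<bar>c\<bar> * K"
              using elim j \<tau>_pos[OF j _ that] by (intro mult_left_mono) auto
            finally show ?thesis using zero_le_square[of "c * K"]
              by (simp add: f_def v_def power2_eq_square mult_ac)
          qed
          then show "0 \<le> (if occ j \<omega> \<and> \<tau> j \<omega> < \<tau> i \<omega> then f j (\<tau> j \<omega>, \<omega>) else 1)
            \<and> (if occ j \<omega> \<and> \<tau> j \<omega> < \<tau> i \<omega> then f j (\<tau> j \<omega>, \<omega>) else 1) \<le> ?B"
            using f_pos[of j] K by (auto intro: less_imp_le)
        qed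
        then show ?case by (auto simp: indicator_def intro!: ennreal_leI)
      qed
    qed
    then have "(\<integral>\<^sup>+\<omega>. ?o i \<omega> * ennreal (W (\<tau> i \<omega>, \<omega>)) \<partial>M) < \<infinity>" for i
      by (rule order_le_less_trans) (simp add: emeasure_space_1)
    then show ?thesis unfolding I0_def by (simp add: ennreal_sum_less_top)
  qed
  have "(\<integral>\<^sup>+\<omega>. ennreal (Winf \<omega>) \<partial>M) + I0 \<le> 1 + I0"
    unfolding balance using \<open>I1 \<le> I0\<close> by (rule add_left_mono)
  then have Winf1: "(\<integral>\<^sup>+\<omega>. ennreal (Winf \<omega>) \<partial>M) \<le> 1"
    using \<open>I0 < \<infinity>\<close> by (auto simp: add.commute[of _ I0] ennreal_add_left_cancel_le)
  \<comment> \<open>There are at most \<open>n\<close> events, so the normalization costs a factor of at most \<open>exp (n v)\<close>.\<close>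
  have "(\<integral>\<^sup>+\<omega>. ennreal (exp (c * (\<Sum>i\<in>?S \<omega>. a i (\<tau> i \<omega>, \<omega>)))) \<partial>M)
      \<le> (\<integral>\<^sup>+\<omega>. ennreal (exp (real n * v)) * ennreal (Winf \<omega>) \<partial>M)"
  proof (rule nn_integral_mono)
    fix \<omega>
    have "Winf \<omega> = (\<Prod>i\<in>?S \<omega>. f i (\<tau> i \<omega>, \<omega>))" unfolding Winf_def by (simp add: prod.inter_filter[symmetric])
    also have "\<dots> = exp (\<Sum>i\<in>?S \<omega>. c * a i (\<tau> i \<omega>, \<omega>) - v)" unfolding f_def by (simp add: exp_sum)
    also have "(\<Sum>i\<in>?S \<omega>. c * a i (\<tau> i \<omega>, \<omega>) - v) = c * (\<Sum>i\<in>?S \<omega>. a i (\<tau> i \<omega>, \<omega>)) - real (card (?S \<omega>)) * v"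
      by (simp add: sum_subtractf sum_distrib_left)
    finally have W: "exp (real n * v) * Winf \<omega>
        = exp (c * (\<Sum>i\<in>?S \<omega>. a i (\<tau> i \<omega>, \<omega>)) + (real n * v - real (card (?S \<omega>)) * v))"
      by (simp flip: exp_add)
    have "card (?S \<omega>) \<le> card {1..n}" by (rule card_mono) auto
    then have "real (card (?S \<omega>)) * v \<le> real n * v" by (intro mult_right_mono) (auto simp: v_def)
    then have "exp (c * (\<Sum>i\<in>?S \<omega>. a i (\<tau> i \<omega>, \<omega>))) \<le> exp (real n * v) * Winf \<omega>" unfolding W by simp
    then show "ennreal (exp (c * (\<Sum>i\<in>?S \<omega>. a i (\<tau> i \<omega>, \<omega>)))) \<le> ennreal (exp (real n * v)) * ennreal (Winf \<omega>)"
      using Winf_pos[of \<omega>] by (simp flip: ennreal_mult)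
  qed
  also have "\<dots> = ennreal (exp (real n * v)) * (\<integral>\<^sup>+\<omega>. ennreal (Winf \<omega>) \<partial>M)"
    using Winf_meas by (intro nn_integral_cmult) simp
  also have "\<dots> \<le> ennreal (exp (real n * v)) * 1" by (intro mult_left_mono Winf1) simp
  finally show ?thesis by (simp add: v_def)
qed

text \<open>The exponential Markov inequality with the minimizing exponent \<open>c = y / (n K\<^sup>2)\<close>.\<close>

lemma event_sum_tail:
  fixes a :: "nat \<Rightarrow> real \<times> 'a \<Rightarrow> real" and y K :: real
  assumes a: "\<And>i. i \<in> {1..n} \<Longrightarrow> a i \<in> borel_measurable PS"
    and bound: "AE \<omega> in M. \<forall>i\<in>{1..n}. \<forall>s>0. \<bar>a i (s, \<omega>)\<bar> \<le> K" and K: "0 < K"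
    and center: "\<And>s \<omega>. 0 < s \<Longrightarrow> \<omega> \<in> space M \<Longrightarrow> (\<Sum>i\<in>{1..n}. intensity i (s, \<omega>) * a i (s, \<omega>)) = 0"
  defines "U \<equiv> \<lambda>\<omega>. \<Sum>i\<in>{i\<in>{1..n}. occ i \<omega>}. a i (\<tau> i \<omega>, \<omega>)"
  shows "U \<in> borel_measurable M"
    and "0 \<le> y \<Longrightarrow> prob {\<omega> \<in> space M. y \<le> U \<omega>} \<le> exp (- (y\<^sup>2 / (2 * real n * K\<^sup>2)))"
proof -
  have "U = (\<lambda>\<omega>. \<Sum>i\<in>{1..n}. if occ i \<omega> then a i (\<tau> i \<omega>, \<omega>) else 0)"
    unfolding U_def by (simp add: sum.inter_filter[symmetric])
  also have "\<dots> \<in> borel_measurable M"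
    by (intro borel_measurable_sum measurable_If measurable_at_\<tau> a measurable_const occ_sets) auto
  finally show U [measurable]: "U \<in> borel_measurable M" .
  define c where "c = y / (real n * K\<^sup>2)"
  assume y: "0 \<le> y"
  then have c: "0 \<le> c" by (simp add: c_def)
  have "emeasure M {\<omega> \<in> space M. y \<le> U \<omega>} = (\<integral>\<^sup>+\<omega>. indicator {\<omega> \<in> space M. y \<le> U \<omega>} \<omega> \<partial>M)"
    by (simp add: nn_integral_indicator)
  also have "\<dots> \<le> (\<integral>\<^sup>+\<omega>. ennreal (exp (- (c * y))) * ennreal (exp (c * U \<omega>)) \<partial>M)"
  proof (rule nn_integral_mono)
    fix \<omega>
    have "1 \<le> exp (- (c * y)) * exp (c * U \<omega>)" if "y \<le> U \<omega>"
      using mult_left_mono[OF that c] by (simp flip: exp_add)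
    then show "indicator {\<omega> \<in> space M. y \<le> U \<omega>} \<omega> \<le> ennreal (exp (- (c * y))) * ennreal (exp (c * U \<omega>))"
      by (auto simp: indicator_def ennreal_mult[symmetric] ennreal_ge_1)
  qed
  also have "\<dots> = ennreal (exp (- (c * y))) * (\<integral>\<^sup>+\<omega>. ennreal (exp (c * U \<omega>)) \<partial>M)"
    by (rule nn_integral_cmult) measurable
  also have "\<dots> \<le> ennreal (exp (- (c * y))) * ennreal (exp (real n * (c\<^sup>2 * K\<^sup>2 / 2)))"
    unfolding U_def by (intro mult_left_mono exp_moment_bound a bound K center) auto
  also have "\<dots> = ennreal (exp (- (c * y) + real n * (c\<^sup>2 * K\<^sup>2 / 2)))"
    by (simp only: exp_add ennreal_mult[symmetric] exp_ge_zero)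
  also have "- (c * y) + real n * (c\<^sup>2 * K\<^sup>2 / 2) = - (y\<^sup>2 / (2 * real n * K\<^sup>2))"
    using n_pos K by (simp add: c_def field_simps power2_eq_square)
  finally show "prob {\<omega> \<in> space M. y \<le> U \<omega>} \<le> exp (- (y\<^sup>2 / (2 * real n * K\<^sup>2)))"
    by (simp add: emeasure_eq_measure)
qed

end

section \<open>The partial likelihood as a finite sum over events\<close>

context cox_model
begin

lemma one_event_coxI:
  assumes one: "\<And>i \<omega>. i \<in> {1..n} \<Longrightarrow> \<omega> \<in> space M \<Longrightarrow> count_at_infinity (\<lambda>t. N i t \<omega>) \<le> 1"
  shows "one_event_cox M F n N Y Z \<beta>o \<Lambda>0
    (\<lambda>i \<omega>. event_occurs (\<lambda>t. N i t \<omega>)) (\<lambda>i \<omega>. event_time (\<lambda>t. N i t \<omega>))"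
proof
  fix i k t \<omega> assume i: "i \<in> {1..n}" and \<omega>: "\<omega> \<in> space M"
  note path = N_path[OF i \<omega>] one[OF i \<omega>]
  show "N i t \<omega> = (if event_occurs (\<lambda>t. N i t \<omega>) \<and> event_time (\<lambda>t. N i t \<omega>) \<le> t then 1 else 0)" if "0 \<le> t"
    by (rule counting_path_one_event[OF path that])
  show "0 < event_time (\<lambda>t. N i t \<omega>)" if "event_occurs (\<lambda>t. N i t \<omega>)"
    by (rule event_time_pos[OF path that])
  show "event_time (\<lambda>t. N i t \<omega>) = 0" if "\<not> event_occurs (\<lambda>t. N i t \<omega>)"
    using that by (simp add: event_time_def)
  show "event_time (\<lambda>t. N i t \<omega>) \<noteq> event_time (\<lambda>t. N k t \<omega>)"
    if k: "k \<in> {1..n}" "i \<noteq> k" "event_occurs (\<lambda>t. N i t \<omega>)" "event_occurs (\<lambda>t. N k t \<omega>)"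
    using N_no_common_jumps[OF i k(1,2) event_time_pos[OF path k(3)] \<omega>]
      jumps_at_event_time[OF path k(3)] jumps_at_event_time[OF N_path[OF k(1) \<omega>] one[OF k(1) \<omega>] k(4)]
    by auto
qed

end

context one_event_cox
begin

definition observed :: "'a \<Rightarrow> nat set" where
  "observed \<omega> = {i \<in> {1..n}. occ i \<omega> \<and> \<tau> i \<omega> \<in> at_risk_times n Y \<omega>}"

abbreviation risk :: "nat \<Rightarrow> 'a \<Rightarrow> nat \<Rightarrow> real" where "risk i \<omega> \<equiv> \<lambda>k. Y k (\<tau> i \<omega>) \<omega>"
abbreviation covar :: "nat \<Rightarrow> 'a \<Rightarrow> nat \<Rightarrow> real ^ 'p" where "covar i \<omega> \<equiv> \<lambda>k. Z k (\<tau> i \<omega>) \<omega>"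

lemma finite_observed: "finite (observed \<omega>)"
  by (simp add: observed_def)

text \<open>The Stieltjes measures are sums of point masses at the event times, and the restriction to times
  at which somebody is at risk selects the events in \<open>observed\<close>. What remains to be
  checked is measurability of the integrands in time, which comes from predictability.\<close>

lemma neg_log_partial_lik_observed:
  assumes \<omega>: "\<omega> \<in> space M"
  shows "neg_log_partial_lik n N Y Z \<omega> \<beta> = (1 / real n) *
    (\<Sum>i\<in>observed \<omega>. ln (risk_sum {1..n} (risk i \<omega>) (covar i \<omega>) \<beta>) - covar i \<omega> i \<bullet> \<beta>)"
proof -
  let ?R = "at_risk_times n Y \<omega>"
  have Y_s: "(\<lambda>s. Y k (max 0 s) \<omega>) \<in> borel_measurable borel" if "k \<in> {1..n}" for k
    using measurable_section[OF Y_PS[OF that] \<omega>] by simp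
  have Z_s: "(\<lambda>s. Z k (max 0 s) \<omega>) \<in> borel_measurable borel" if "k \<in> {1..n}" for k
    using measurable_section[OF Z_PS[OF that] \<omega>] by simp
  have "?R = {0<..} \<inter> (\<Union>k\<in>{1..n}. {s \<in> space borel. Y k (max 0 s) \<omega> \<noteq> 0})"
    unfolding at_risk_times_def by (auto simp: max_def)
  also have "\<dots> \<in> sets borel"
  proof (intro sets.Int sets.finite_UN)
    fix k assume "k \<in> {1..n}"
    note Y_s[OF this, measurable]
    show "{s \<in> space borel. Y k (max 0 s) \<omega> \<noteq> 0} \<in> sets borel" by measurable
  qed auto
  finally have R: "?R \<in> sets borel" .
  have restrict: "(\<lambda>s. indicator ?R s * f s) \<in> borel_measurable borel"
    if f: "(\<lambda>s. f (max 0 s)) \<in> borel_measurable borel" for f :: "real \<Rightarrow> real"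
  proof -
    have "(\<lambda>s. indicator ?R s * f (max 0 s)) \<in> borel_measurable borel"
      using f R by (intro borel_measurable_times borel_measurable_indicator)
    also have "(\<lambda>s. indicator ?R s * f (max 0 s)) = (\<lambda>s. indicator ?R s * f s)"
      by (auto simp: fun_eq_iff indicator_def at_risk_times_def)
    finally show ?thesis .
  qed
  have single: "(LINT s:?R|stieltjes (\<lambda>t. real (N i t \<omega>)). Z i s \<omega> \<bullet> \<beta>)
      = (if i \<in> observed \<omega> then covar i \<omega> i \<bullet> \<beta> else 0)" if i: "i \<in> {1..n}" for i
  proof -
    let ?J = "{k \<in> {i}. occ k \<omega>}"
    have "(LINT s:?R|stieltjes (\<lambda>t. real (N i t \<omega>)). Z i s \<omega> \<bullet> \<beta>)
      = (\<Sum>k\<in>{k \<in> ?J. \<tau> k \<omega> \<in> ?R}. Z i (\<tau> k \<omega>) \<omega> \<bullet> \<beta>)"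
    proof (rule set_integral_stieltjes_step[where T = "\<lambda>k. \<tau> k \<omega>"])
      show "0 < \<tau> k \<omega>" if "k \<in> ?J" for k using that \<tau>_pos[OF i \<omega>] by auto
      show "real (N i t \<omega>) = (\<Sum>k\<in>?J. if \<tau> k \<omega> \<le> t then 1 else 0)" if "0 \<le> t" for t
        using N_eq[OF i \<omega> that] by (cases "occ i \<omega>") (auto simp: Collect_conv_if)
      show "(\<lambda>s. indicator ?R s * (Z i s \<omega> \<bullet> \<beta>)) \<in> borel_measurable borel"
        using Z_s[OF i] by (intro restrict borel_measurable_inner) auto
    qed simp
    also have "{k \<in> ?J. \<tau> k \<omega> \<in> ?R} = (if i \<in> observed \<omega> then {i} else {})"
      using i by (auto simp: observed_def)
    finally show ?thesis by simp
  qed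
  have "(\<Sum>i=1..n. LINT s:?R|stieltjes (\<lambda>t. real (N i t \<omega>)). Z i s \<omega> \<bullet> \<beta>)
    = (\<Sum>i=1..n. if i \<in> observed \<omega> then covar i \<omega> i \<bullet> \<beta> else 0)"
    by (intro sum.cong single) auto
  also have "\<dots> = (\<Sum>i\<in>observed \<omega>. covar i \<omega> i \<bullet> \<beta>)"
    by (intro sum.mono_neutral_cong_right) (auto simp: observed_def)
  finally have first: "(\<Sum>i=1..n. LINT s:?R|stieltjes (\<lambda>t. real (N i t \<omega>)). Z i s \<omega> \<bullet> \<beta>)
    = (\<Sum>i\<in>observed \<omega>. covar i \<omega> i \<bullet> \<beta>)" .
  let ?J = "{k \<in> {1..n}. occ k \<omega>}"
  have "(LINT s:?R|stieltjes (\<lambda>t. \<Sum>i=1..n. real (N i t \<omega>)). ln (\<Sum>i=1..n. Y i s \<omega> * exp (Z i s \<omega> \<bullet> \<beta>)))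
    = (\<Sum>k\<in>{k \<in> ?J. \<tau> k \<omega> \<in> ?R}. ln (\<Sum>i=1..n. Y i (\<tau> k \<omega>) \<omega> * exp (Z i (\<tau> k \<omega>) \<omega> \<bullet> \<beta>)))"
  proof (rule set_integral_stieltjes_step[where T = "\<lambda>k. \<tau> k \<omega>"])
    show "0 < \<tau> k \<omega>" if "k \<in> ?J" for k using that \<tau>_pos[OF _ \<omega>] by auto
    show "(\<Sum>i=1..n. real (N i t \<omega>)) = (\<Sum>k\<in>?J. if \<tau> k \<omega> \<le> t then 1 else 0)" if "0 \<le> t" for t
      using N_eq[OF _ \<omega> that] by (intro sum.mono_neutral_cong_right) auto
    have "(\<lambda>s. Y i (max 0 s) \<omega> * exp (Z i (max 0 s) \<omega> \<bullet> \<beta>)) \<in> borel_measurable borel" if "i \<in> {1..n}" for i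
    proof -
      have "(\<lambda>s. Z i (max 0 s) \<omega> \<bullet> \<beta>) \<in> borel_measurable borel"
        using Z_s[OF that] by (intro borel_measurable_inner) auto
      then show ?thesis
        using Y_s[OF that] by (intro borel_measurable_times measurable_compose[OF _ borel_measurable_exp])
    qed
    then have "(\<lambda>s. \<Sum>i=1..n. Y i (max 0 s) \<omega> * exp (Z i (max 0 s) \<omega> \<bullet> \<beta>)) \<in> borel_measurable borel"
      by (rule borel_measurable_sum)
    then show "(\<lambda>s. indicator ?R s * ln (\<Sum>i=1..n. Y i s \<omega> * exp (Z i s \<omega> \<bullet> \<beta>))) \<in> borel_measurable borel"
      by (intro restrict borel_measurable_ln)
  qed simp
  also have "{k \<in> ?J. \<tau> k \<omega> \<in> ?R} = observed \<omega>" by (auto simp: observed_def)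
  finally show ?thesis
    unfolding neg_log_partial_lik_def first risk_sum_def by (simp add: sum_subtractf algebra_simps)
qed

lemma observed_risk:
  assumes \<omega>: "\<omega> \<in> space M" and i: "i \<in> observed \<omega>"
  shows "\<And>k. k \<in> {1..n} \<Longrightarrow> 0 \<le> risk i \<omega> k" "0 < risk_sum {1..n} (risk i \<omega>) (covar i \<omega>) \<beta>"
proof -
  have pos: "0 < \<tau> i \<omega>" and ex: "\<exists>k\<in>{1..n}. risk i \<omega> k \<noteq> 0"
    using i by (auto simp: observed_def at_risk_times_def)
  show nn: "0 \<le> risk i \<omega> k" if "k \<in> {1..n}" for k
    using Y_indicator[OF that less_imp_le[OF pos] \<omega>] by auto
  show "0 < risk_sum {1..n} (risk i \<omega>) (covar i \<omega>) \<beta>"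
    by (rule risk_sum_pos) (use nn ex in auto)
qed

definition score :: "'a \<Rightarrow> real ^ 'p \<Rightarrow> real ^ 'p" where
  "score \<omega> \<beta> = (1 / real n) *\<^sub>R
     (\<Sum>i\<in>observed \<omega>. risk_mean {1..n} (risk i \<omega>) (covar i \<omega>) \<beta> - covar i \<omega> i)"

definition information :: "'a \<Rightarrow> real ^ 'p \<Rightarrow> real ^ 'p \<Rightarrow> real ^ 'p" where
  "information \<omega> \<beta> h = (1 / real n) *\<^sub>R
     (\<Sum>i\<in>observed \<omega>. risk_cov {1..n} (risk i \<omega>) (covar i \<omega>) \<beta> h)"

lemma GDERIV_neg_log_partial_lik:
  assumes \<omega>: "\<omega> \<in> space M"
  shows "GDERIV (neg_log_partial_lik n N Y Z \<omega>) \<beta> :> score \<omega> \<beta>"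
proof -
  have "((\<lambda>\<beta>. ln (risk_sum {1..n} (risk i \<omega>) (covar i \<omega>) \<beta>)) has_derivative
      (\<lambda>h. h \<bullet> risk_mean {1..n} (risk i \<omega>) (covar i \<omega>) \<beta>)) (at \<beta>)" if "i \<in> observed \<omega>" for i
    using GDERIV_ln_risk_sum[OF _ observed_risk(2)[OF \<omega> that], of \<beta>] by (simp add: gderiv_def)
  then have "((\<lambda>\<beta>. (1 / real n) * (\<Sum>i\<in>observed \<omega>. ln (risk_sum {1..n} (risk i \<omega>) (covar i \<omega>) \<beta>)
      - covar i \<omega> i \<bullet> \<beta>)) has_derivative
     (\<lambda>h. (1 / real n) * (\<Sum>i\<in>observed \<omega>. h \<bullet> risk_mean {1..n} (risk i \<omega>) (covar i \<omega>) \<beta> - covar i \<omega> i \<bullet> h))) (at \<beta>)"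
    by (intro has_derivative_mult_right has_derivative_sum has_derivative_diff has_derivative_inner_right
        has_derivative_ident) auto
  moreover have "neg_log_partial_lik n N Y Z \<omega> = (\<lambda>\<beta>. (1 / real n) *
     (\<Sum>i\<in>observed \<omega>. ln (risk_sum {1..n} (risk i \<omega>) (covar i \<omega>) \<beta>) - covar i \<omega> i \<bullet> \<beta>))"
    using neg_log_partial_lik_observed[OF \<omega>] by blast
  ultimately show ?thesis
    by (simp add: gderiv_def score_def inner_sum_right inner_diff_right inner_commute)
qed

lemma hessian_neg_log_partial_lik:
  assumes \<omega>: "\<omega> \<in> space M"
  shows "hessian (neg_log_partial_lik n N Y Z \<omega>) \<beta> *v h = information \<omega> \<beta> h"
proof (rule hessian_mult_vec[OF GDERIV_neg_log_partial_lik[OF \<omega>]])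
  have "(risk_mean {1..n} (risk i \<omega>) (covar i \<omega>) has_derivative
      risk_cov {1..n} (risk i \<omega>) (covar i \<omega>) \<beta>) (at \<beta>)" if "i \<in> observed \<omega>" for i
    using observed_risk(2)[OF \<omega> that] by (intro has_derivative_risk_mean) auto
  then have "((\<lambda>\<beta>. (1 / real n) *\<^sub>R (\<Sum>i\<in>observed \<omega>. risk_mean {1..n} (risk i \<omega>) (covar i \<omega>) \<beta> - covar i \<omega> i))
     has_derivative (\<lambda>h. (1 / real n) *\<^sub>R (\<Sum>i\<in>observed \<omega>. risk_cov {1..n} (risk i \<omega>) (covar i \<omega>) \<beta> h - 0))) (at \<beta>)"
    by (intro has_derivative_scaleR_right has_derivative_sum has_derivative_diff has_derivative_const) auto
  then show "(score \<omega> has_derivative information \<omega> \<beta>) (at \<beta>)"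
    unfolding score_def[abs_def] information_def[abs_def] by simp
qed

definition covariate_bound :: "real \<Rightarrow> 'a \<Rightarrow> bool" where
  "covariate_bound K \<omega> \<longleftrightarrow> (\<forall>i\<in>{1..n}. \<forall>k\<in>{1..n}. \<forall>t\<ge>0. \<forall>j. \<bar>Z i t \<omega> $ j - Z k t \<omega> $ j\<bar> \<le> K)"

text \<open>Each event contributes a tilted mean whose scalars \<open>Z k \<bullet> \<theta>\<close> have range at most \<open>K |\<theta>|\<^sub>1\<close>. The strict
  inequality only needs one event with positive variance.\<close>

lemma score_increment:
  assumes \<omega>: "\<omega> \<in> space M" and K: "covariate_bound K \<omega>" and s: "0 < s"
  shows "0 \<le> \<theta> \<bullet> information \<omega> \<beta> \<theta>"
    and "s * exp (- (s * (K * lq_norm 1 \<theta>))) * (\<theta> \<bullet> information \<omega> \<beta> \<theta>)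
       \<le> \<theta> \<bullet> (score \<omega> (\<beta> + s *\<^sub>R \<theta>) - score \<omega> \<beta>)"
    and "0 < \<theta> \<bullet> information \<omega> \<beta> \<theta> \<Longrightarrow> s * exp (- (s * (K * lq_norm 1 \<theta>))) * (\<theta> \<bullet> information \<omega> \<beta> \<theta>)
       < \<theta> \<bullet> (score \<omega> (\<beta> + s *\<^sub>R \<theta>) - score \<omega> \<beta>)"
proof -
  let ?e = "s * exp (- (s * (K * lq_norm 1 \<theta>)))"
  let ?c = "\<lambda>i. \<theta> \<bullet> risk_cov {1..n} (risk i \<omega>) (covar i \<omega>) \<beta> \<theta>"
  let ?m = "\<lambda>i. \<theta> \<bullet> (risk_mean {1..n} (risk i \<omega>) (covar i \<omega>) (\<beta> + s *\<^sub>R \<theta>)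
      - risk_mean {1..n} (risk i \<omega>) (covar i \<omega>) \<beta>)"
  have range: "covar i \<omega> k \<bullet> \<theta> - covar i \<omega> l \<bullet> \<theta> \<le> K * lq_norm 1 \<theta>"
    if "i \<in> observed \<omega>" "k \<in> {1..n}" "l \<in> {1..n}" for i k l
  proof -
    have "0 \<le> \<tau> i \<omega>" using that by (auto simp: observed_def at_risk_times_def)
    then have "\<theta> \<bullet> (covar i \<omega> k - covar i \<omega> l) \<le> K * lq_norm 1 \<theta>"
      using K that by (intro inner_le_sup_mult_l1) (auto simp: covariate_bound_def)
    then show ?thesis by (simp add: inner_diff_right inner_commute)
  qed
  have each: "0 \<le> ?c i" "?e * ?c i \<le> ?m i" "0 < ?c i \<Longrightarrow> ?e * ?c i < ?m i" if "i \<in> observed \<omega>" for i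
    using risk_mean_increment[of "{1..n}" "risk i \<omega>" "covar i \<omega>" \<beta> \<theta> "K * lq_norm 1 \<theta>" s]
      observed_risk[OF \<omega> that] range[OF that] s by blast+
  have info: "\<theta> \<bullet> information \<omega> \<beta> \<theta> = (1 / real n) * (\<Sum>i\<in>observed \<omega>. ?c i)"
    by (simp add: information_def inner_sum_right)
  have inc: "\<theta> \<bullet> (score \<omega> (\<beta> + s *\<^sub>R \<theta>) - score \<omega> \<beta>) = (1 / real n) * (\<Sum>i\<in>observed \<omega>. ?m i)"
    by (simp add: score_def scaleR_diff_right[symmetric] sum_subtractf[symmetric] inner_sum_right)
  have e: "?e * (\<theta> \<bullet> information \<omega> \<beta> \<theta>) = (1 / real n) * (\<Sum>i\<in>observed \<omega>. ?e * ?c i)"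
    unfolding info by (simp add: sum_distrib_left)
  have n: "0 < 1 / real n" using n_pos by simp
  show "0 \<le> \<theta> \<bullet> information \<omega> \<beta> \<theta>"
    unfolding info using each(1) by (intro mult_nonneg_nonneg sum_nonneg) auto
  show "?e * (\<theta> \<bullet> information \<omega> \<beta> \<theta>) \<le> \<theta> \<bullet> (score \<omega> (\<beta> + s *\<^sub>R \<theta>) - score \<omega> \<beta>)"
    unfolding e inc using each(2) n by (intro mult_left_mono sum_mono) auto
  assume pos: "0 < \<theta> \<bullet> information \<omega> \<beta> \<theta>"
  have "\<exists>i\<in>observed \<omega>. 0 < ?c i"
  proof (rule ccontr)
    assume "\<not> ?thesis"
    then have "(\<Sum>i\<in>observed \<omega>. ?c i) \<le> 0" by (intro sum_nonpos) (auto simp: not_less)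
    then have "\<theta> \<bullet> information \<omega> \<beta> \<theta> \<le> 0" unfolding info using n by (intro mult_nonneg_nonpos) auto
    then show False using pos by simp
  qed
  then have "(\<Sum>i\<in>observed \<omega>. ?e * ?c i) < (\<Sum>i\<in>observed \<omega>. ?m i)"
    using each by (intro sum_strict_mono_ex1 finite_observed) blast+
  then show "?e * (\<theta> \<bullet> information \<omega> \<beta> \<theta>) < \<theta> \<bullet> (score \<omega> (\<beta> + s *\<^sub>R \<theta>) - score \<omega> \<beta>)"
    unfolding e inc using n by (rule mult_strict_left_mono)
qed

end

section \<open>The score at the true parameter\<close>

context one_event_cox
begin

text \<open>The coordinate \<open>j\<close> of \<open>Z i - Zbar\<close> at the true parameter. It is set to \<open>0\<close> when nobody is at risk, so
  that it is bounded at all times and events at such times do not count.\<close>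

definition residual :: "'p \<Rightarrow> nat \<Rightarrow> real \<times> 'a \<Rightarrow> real" where
  "residual j i x = (if (\<Sum>k\<in>{1..n}. intensity k x) = 0 then 0
     else Z i (fst x) (snd x) $ j
       - (\<Sum>k\<in>{1..n}. intensity k x * Z k (fst x) (snd x) $ j) / (\<Sum>k\<in>{1..n}. intensity k x))"

lemma residual_PS: "i \<in> {1..n} \<Longrightarrow> residual j i \<in> borel_measurable PS"
proof -
  assume i: "i \<in> {1..n}"
  have Zj: "(\<lambda>x. Z k (fst x) (snd x) $ j) \<in> borel_measurable PS" if "k \<in> {1..n}" for k
    using measurable_compose[OF Z_PS[OF that], of "\<lambda>z. z $ j" borel]
    by (simp add: case_prod_unfold borel_measurable_continuous_onI continuous_intros)
  have S: "(\<lambda>x. \<Sum>k\<in>{1..n}. intensity k x) \<in> borel_measurable PS"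
    by (intro borel_measurable_sum intensity_PS)
  have SZ: "(\<lambda>x. \<Sum>k\<in>{1..n}. intensity k x * Z k (fst x) (snd x) $ j) \<in> borel_measurable PS"
    by (intro borel_measurable_sum borel_measurable_times intensity_PS Zj)
  note S [measurable] SZ [measurable] Zj[OF i, measurable]
  show ?thesis unfolding residual_def[abs_def] by measurable
qed

text \<open>The intensities are proportional to the weights that define the mean \<open>Zbar\<close>.\<close>

lemma residual_centered: "(\<Sum>i\<in>{1..n}. intensity i x * residual j i x) = 0"
proof (cases "(\<Sum>k\<in>{1..n}. intensity k x) = 0")
  case False
  define c where "c = (\<Sum>k\<in>{1..n}. intensity k x * Z k (fst x) (snd x) $ j) / (\<Sum>k\<in>{1..n}. intensity k x)"
  have "(\<Sum>i\<in>{1..n}. intensity i x * residual j i x)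
    = (\<Sum>i\<in>{1..n}. intensity i x * Z i (fst x) (snd x) $ j - intensity i x * c)"
    using False by (simp add: residual_def c_def right_diff_distrib)
  also have "\<dots> = (\<Sum>i\<in>{1..n}. intensity i x * Z i (fst x) (snd x) $ j) - (\<Sum>i\<in>{1..n}. intensity i x) * c"
    by (simp only: sum_subtractf sum_distrib_right)
  also have "\<dots> = 0" using False by (simp add: c_def)
  finally show ?thesis .
qed (simp add: residual_def)

text \<open>A residual is a weighted average of the differences \<open>Z i - Z k\<close>.\<close>

lemma residual_bound:
  assumes \<omega>: "\<omega> \<in> space M" and K: "covariate_bound K \<omega>" "0 \<le> K" and i: "i \<in> {1..n}" and s: "0 \<le> s"
  shows "\<bar>residual j i (s, \<omega>)\<bar> \<le> K"
proof (cases "(\<Sum>k\<in>{1..n}. intensity k (s, \<omega>)) = 0")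
  case False
  let ?l = "\<lambda>k. intensity k (s, \<omega>)"
  have l: "0 \<le> ?l k" if "k \<in> {1..n}" for k using intensity_nonneg[OF that s \<omega>] .
  then have S: "0 < (\<Sum>k\<in>{1..n}. ?l k)" using False sum_nonneg[of "{1..n}" ?l] by fastforce
  have "residual j i (s, \<omega>) = (\<Sum>k\<in>{1..n}. ?l k * (Z i s \<omega> $ j - Z k s \<omega> $ j)) / (\<Sum>k\<in>{1..n}. ?l k)"
    using False by (simp add: residual_def right_diff_distrib sum_subtractf sum_distrib_right[symmetric] diff_divide_distrib)
  moreover have "\<bar>\<Sum>k\<in>{1..n}. ?l k * (Z i s \<omega> $ j - Z k s \<omega> $ j)\<bar> \<le> (\<Sum>k\<in>{1..n}. ?l k) * K"
    unfolding sum_distrib_right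
  proof (rule order_trans[OF sum_abs sum_mono])
    fix k assume "k \<in> {1..n}"
    then show "\<bar>?l k * (Z i s \<omega> $ j - Z k s \<omega> $ j)\<bar> \<le> ?l k * K"
      using K(1) i s l[of k] by (auto simp: abs_mult covariate_bound_def intro!: mult_left_mono)
  qed
  ultimately show ?thesis using S by (simp add: pos_divide_le_eq mult.commute)
qed (simp add: residual_def K)

lemma score_residual:
  assumes \<omega>: "\<omega> \<in> space M"
  shows "score \<omega> \<beta>o $ j = - (1 / real n) * (\<Sum>i\<in>{i\<in>{1..n}. occ i \<omega>}. residual j i (\<tau> i \<omega>, \<omega>))"
proof -
  have "(\<Sum>i\<in>{i\<in>{1..n}. occ i \<omega>}. residual j i (\<tau> i \<omega>, \<omega>)) = (\<Sum>i\<in>observed \<omega>. residual j i (\<tau> i \<omega>, \<omega>))"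
  proof (rule sum.mono_neutral_right)
    show "\<forall>i\<in>{i \<in> {1..n}. occ i \<omega>} - observed \<omega>. residual j i (\<tau> i \<omega>, \<omega>) = 0"
    proof
      fix i assume i: "i \<in> {i \<in> {1..n}. occ i \<omega>} - observed \<omega>"
      then have "\<forall>k\<in>{1..n}. Y k (\<tau> i \<omega>) \<omega> = 0"
        using \<tau>_pos[OF _ \<omega>] by (auto simp: observed_def at_risk_times_def)
      then have "(\<Sum>k\<in>{1..n}. intensity k (\<tau> i \<omega>, \<omega>)) = 0"
        by (intro sum.neutral) (auto simp: intensity_def)
      then show "residual j i (\<tau> i \<omega>, \<omega>) = 0" by (simp add: residual_def)
    qed
  qed (auto simp: observed_def)
  also have "\<dots> = (\<Sum>i\<in>observed \<omega>. covar i \<omega> i $ j - risk_mean {1..n} (risk i \<omega>) (covar i \<omega>) \<beta>o $ j)"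
  proof (rule sum.cong)
    fix i assume i: "i \<in> observed \<omega>"
    have S: "risk_sum {1..n} (risk i \<omega>) (covar i \<omega>) \<beta>o = (\<Sum>k\<in>{1..n}. intensity k (\<tau> i \<omega>, \<omega>))"
      by (simp add: risk_sum_def intensity_def)
    have "risk_mean {1..n} (risk i \<omega>) (covar i \<omega>) \<beta>o $ j
      = (\<Sum>k\<in>{1..n}. intensity k (\<tau> i \<omega>, \<omega>) * Z k (\<tau> i \<omega>) \<omega> $ j) / (\<Sum>k\<in>{1..n}. intensity k (\<tau> i \<omega>, \<omega>))"
      unfolding risk_mean_def S by (simp add: intensity_def)
    then show "residual j i (\<tau> i \<omega>, \<omega>) = covar i \<omega> i $ j - risk_mean {1..n} (risk i \<omega>) (covar i \<omega>) \<beta>o $ j"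
      using observed_risk(2)[OF \<omega> i, of \<beta>o] unfolding S by (simp add: residual_def)
  qed simp
  finally have "(\<Sum>i\<in>{i\<in>{1..n}. occ i \<omega>}. residual j i (\<tau> i \<omega>, \<omega>))
    = - (\<Sum>i\<in>observed \<omega>. risk_mean {1..n} (risk i \<omega>) (covar i \<omega>) \<beta>o $ j - covar i \<omega> i $ j)"
    by (simp only: sum_negf[symmetric] minus_diff_eq)
  then show ?thesis by (simp add: score_def)
qed

text \<open>The tail bound for sums over events is applied to the residuals and to their negatives in each of
  the \<open>p\<close> coordinates, hence the factor \<open>2 p\<close>.\<close>

lemma score_tail:
  assumes K: "0 < K" and bound: "AE \<omega> in M. covariate_bound K \<omega>" and z: "0 \<le> z"
  obtains G where "G \<in> sets M" "\<And>\<omega> j. \<omega> \<in> G \<Longrightarrow> \<bar>score \<omega> \<beta>o $ j\<bar> \<le> z"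
    "prob G \<ge> 1 - 2 * real CARD('p) * exp (- (real n * z\<^sup>2 / (2 * K\<^sup>2)))"
proof -
  let ?U = "\<lambda>c j \<omega>. \<Sum>i\<in>{i\<in>{1..n}. occ i \<omega>}. c * residual j i (\<tau> i \<omega>, \<omega>)"
  let ?B = "\<lambda>(c, j). {\<omega> \<in> space M. real n * z \<le> ?U c j \<omega>}"
  let ?p = "exp (- (real n * z\<^sup>2 / (2 * K\<^sup>2)))"
  have tail: "?U c j \<in> borel_measurable M" "prob (?B (c, j)) \<le> ?p" if c: "c \<in> {1, -1}" for c :: real and j
  proof -
    have m: "(\<lambda>x. c * residual j i x) \<in> borel_measurable PS" if "i \<in> {1..n}" for i
      using residual_PS[OF that] by simp
    have b: "AE \<omega> in M. \<forall>i\<in>{1..n}. \<forall>s>0. \<bar>c * residual j i (s, \<omega>)\<bar> \<le> K"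
      using bound AE_space
    proof eventually_elim
      case (elim \<omega>)
      then show ?case using residual_bound[OF elim(2,1)] K c by (auto simp: abs_mult)
    qed
    have ce: "(\<Sum>i\<in>{1..n}. intensity i (s, \<omega>) * (c * residual j i (s, \<omega>))) = 0" for s \<omega>
    proof -
      have "(\<Sum>i\<in>{1..n}. intensity i (s, \<omega>) * (c * residual j i (s, \<omega>)))
        = c * (\<Sum>i\<in>{1..n}. intensity i (s, \<omega>) * residual j i (s, \<omega>))"
        by (simp only: sum_distrib_left mult.left_commute)
      then show ?thesis by (simp only: residual_centered mult_zero_right)
    qed
    note t = event_sum_tail[OF m b K ce]
    show "?U c j \<in> borel_measurable M" by (rule t(1))
    have "(real n * z)\<^sup>2 / (2 * real n * K\<^sup>2) = real n * z\<^sup>2 / (2 * K\<^sup>2)"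
      using n_pos by (simp add: power2_eq_square)
    then show "prob (?B (c, j)) \<le> ?p" using t(2)[of "real n * z"] z by simp
  qed
  let ?I = "{1, -1 :: real} \<times> (UNIV :: 'p set)"
  have B_sets: "?B x \<in> sets M" if x_I: "x \<in> ?I" for x
  proof -
    obtain c j where x: "x = (c, j)" "c \<in> {1, -1}" using x_I by auto
    note tail(1)[OF x(2), of j, measurable]
    show ?thesis unfolding x(1) prod.case by measurable
  qed
  have "prob (\<Union>x\<in>?I. ?B x) \<le> (\<Sum>x\<in>?I. prob (?B x))"
    using B_sets by (intro finite_measure_subadditive_finite) auto
  also have "\<dots> \<le> (\<Sum>x\<in>?I. ?p)" by (intro sum_mono) (use tail(2) in auto)
  also have "\<dots> = 2 * real CARD('p) * ?p" by (simp add: card_cartesian_product)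
  finally have bad: "prob (\<Union>x\<in>?I. ?B x) \<le> 2 * real CARD('p) * ?p" .
  have bad_sets: "(\<Union>x\<in>?I. ?B x) \<in> sets M" using B_sets by (intro sets.finite_UN) auto
  show ?thesis
  proof
    show "space M - (\<Union>x\<in>?I. ?B x) \<in> sets M" using bad_sets by auto
    show "prob (space M - (\<Union>x\<in>?I. ?B x)) \<ge> 1 - 2 * real CARD('p) * ?p"
      using bad prob_compl[OF bad_sets] by simp
    fix \<omega> j assume \<omega>: "\<omega> \<in> space M - (\<Union>x\<in>?I. ?B x)"
    let ?S = "\<Sum>i\<in>{i\<in>{1..n}. occ i \<omega>}. residual j i (\<tau> i \<omega>, \<omega>)"
    have "\<omega> \<notin> ?B (1, j)" "\<omega> \<notin> ?B (-1, j)" "\<omega> \<in> space M" using \<omega> by blast+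
    then have "?S < real n * z" "- ?S < real n * z" by (simp_all add: sum_negf)
    then have "\<bar>?S\<bar> \<le> real n * z" by linarith
    then show "\<bar>score \<omega> \<beta>o $ j\<bar> \<le> z"
      using n_pos \<open>\<omega> \<in> space M\<close> by (simp add: score_residual abs_mult field_simps)
  qed
qed

end

section \<open>Lasso estimation in the Cox model\<close>

theorem theorem3p2:
  fixes M :: "'a measure" and F :: "real \<Rightarrow> 'a measure"
    and n :: nat
    and N :: "nat \<Rightarrow> real \<Rightarrow> 'a \<Rightarrow> nat"
    and Y :: "nat \<Rightarrow> real \<Rightarrow> 'a \<Rightarrow> real"
    and Z :: "nat \<Rightarrow> real \<Rightarrow> 'a \<Rightarrow> real ^ 'p"
    and \<beta>o :: "real ^ 'p" and \<Lambda>0 :: "real \<Rightarrow> real"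
    and \<beta>hat :: "'a \<Rightarrow> real ^ 'p"
    and K \<xi> \<epsilon> lam \<tau> \<eta> C\<kappa> CF :: real and q :: ereal
  assumes cox: "cox_model M F n N Y Z \<beta>o \<Lambda>0"
    and K_pos: "K > 0"
    and covariates_bounded: "AE \<omega> in M. \<forall>i\<in>{1..n}. \<forall>i'\<in>{1..n}. i < i' \<longrightarrow>
           (\<forall>t\<ge>0. \<forall>j. \<bar>Z i t \<omega> $ j - Z i' t \<omega> $ j\<bar> \<le> K)"
    and at_most_one_event: "\<forall>i\<in>{1..n}. \<forall>\<omega>\<in>space M. count_at_infinity (\<lambda>t. N i t \<omega>) \<le> 1"
    and \<xi>: "\<xi> > 1"
    and \<epsilon>: "0 < \<epsilon>" "\<epsilon> < 1"
    and lam: "lam = (\<xi> + 1) / (\<xi> - 1) * K * sqrt (2 / real n * ln (2 * real CARD('p) / \<epsilon>))"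
    and C\<kappa>: "C\<kappa> > 0"
    and \<tau>: "\<tau> = K * (\<xi> + 1) * real (card (support \<beta>o)) * lam / (2 * C\<kappa>\<^sup>2)" "\<tau> \<le> 1 / exp 1"
    and \<eta>: "\<eta> \<le> 1" "\<eta> * exp (- \<eta>) = \<tau>" "\<forall>x. x * exp (- x) = \<tau> \<longrightarrow> \<eta> \<le> x"
    and lasso: "AE \<omega> in M. \<forall>b.
           neg_log_partial_lik n N Y Z \<omega> (\<beta>hat \<omega>) + lam * lq_norm 1 (\<beta>hat \<omega>)
           \<le> neg_log_partial_lik n N Y Z \<omega> b + lam * lq_norm 1 b"
    and q: "1 \<le> q"
    and CF: "CF > 0"
  shows "\<exists>A\<in>sets M.
     (\<forall>\<omega>\<in>A.
        sym_bregman (neg_log_partial_lik n N Y Z \<omega>) (\<beta>hat \<omega>) \<beta>o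
          \<le> 4 * exp \<eta> * \<xi>\<^sup>2 * lam\<^sup>2 * real (card (support \<beta>o)) / ((1 + \<xi>)\<^sup>2 * C\<kappa>\<^sup>2) \<and>
        lq_norm 1 (\<beta>hat \<omega> - \<beta>o)
          \<le> exp \<eta> * (\<xi> + 1) * real (card (support \<beta>o)) * lam / (2 * C\<kappa>\<^sup>2) \<and>
        lq_norm q (\<beta>hat \<omega> - \<beta>o)
          \<le> 2 * exp \<eta> * \<xi> * real (card (support \<beta>o)) powr real_of_ereal (1 / q) * lam
              / ((\<xi> + 1) * CF)) \<and>
     measure M A \<ge>
       measure M {\<omega> \<in> space M.
          compat_factor \<xi> (support \<beta>o) (hessian (neg_log_partial_lik n N Y Z \<omega>) \<beta>o) \<ge> ereal C\<kappa> \<and>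
          cone_invertibility_factor q \<xi> (support \<beta>o) (hessian (neg_log_partial_lik n N Y Z \<omega>) \<beta>o)
            \<ge> ereal CF}
       - \<epsilon>"
proof -
  interpret cox_model M F n N Y Z \<beta>o \<Lambda>0 by (rule cox)
  interpret one_event_cox M F n N Y Z \<beta>o \<Lambda>0
    "\<lambda>i \<omega>. event_occurs (\<lambda>t. N i t \<omega>)" "\<lambda>i \<omega>. event_time (\<lambda>t. N i t \<omega>)"
    by (rule one_event_coxI) (use at_most_one_event in blast)
  let ?lik = "neg_log_partial_lik n N Y Z"
  let ?B = "{\<omega> \<in> space M.
          compat_factor \<xi> (support \<beta>o) (hessian (?lik \<omega>) \<beta>o) \<ge> ereal C\<kappa> \<and>
          cone_invertibility_factor q \<xi> (support \<beta>o) (hessian (?lik \<omega>) \<beta>o) \<ge> ereal CF}"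
  define Ln where "Ln = ln (2 * real CARD('p) / \<epsilon>)"
  define z where "z = K * sqrt (2 / real n * Ln)"
  have "1 \<le> real CARD('p)" using zero_less_card_finite[where 'a = 'p] by linarith
  then have "\<epsilon> < 2 * real CARD('p)" using \<epsilon> by linarith
  then have arg: "1 < 2 * real CARD('p) / \<epsilon>" using \<epsilon> by (simp add: less_divide_eq)
  then have "0 < Ln" by (simp add: Ln_def)
  have n: "0 < real n" using n_pos by simp
  have z0: "0 < z" using \<open>0 < Ln\<close> n K_pos by (simp add: z_def)
  have lam_z: "lam = (\<xi> + 1) / (\<xi> - 1) * z" by (simp add: lam z_def Ln_def)
  then have "0 < lam" using z0 \<xi> by simp
  have z_lam: "lam * (\<xi> - 1) / (\<xi> + 1) = z" using \<xi> by (simp add: lam_z)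
  have cov_bound: "AE \<omega> in M. covariate_bound K \<omega>"
    using covariates_bounded
  proof eventually_elim
    case (elim \<omega>)
    show ?case unfolding covariate_bound_def
    proof (intro ballI allI impI)
      fix i k t j assume ik: "i \<in> {1..n}" "k \<in> {1..n}" "0 \<le> (t::real)"
      have *: "\<bar>Z a t \<omega> $ j - Z b t \<omega> $ j\<bar> \<le> K" if "a < b" "a \<in> {1..n}" "b \<in> {1..n}" for a b
        using elim that ik(3) by blast
      show "\<bar>Z i t \<omega> $ j - Z k t \<omega> $ j\<bar> \<le> K"
      proof (cases i k rule: linorder_cases)
        case less then show ?thesis using * ik by blast
      next
        case equal then show ?thesis using K_pos by simp
      next
        case greater then show ?thesis using *[OF greater ik(2,1)] by (simp add: abs_minus_commute)
      qed
    qed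
  qed
  obtain G where G: "G \<in> sets M" "\<And>\<omega> j. \<omega> \<in> G \<Longrightarrow> \<bar>score \<omega> \<beta>o $ j\<bar> \<le> z"
    "prob G \<ge> 1 - 2 * real CARD('p) * exp (- (real n * z\<^sup>2 / (2 * K\<^sup>2)))"
    using score_tail[OF K_pos cov_bound less_imp_le[OF z0]] by blast
  have "real n * z\<^sup>2 / (2 * K\<^sup>2) = Ln"
    using n K_pos \<open>0 < Ln\<close> by (simp add: z_def power_mult_distrib)
  \<comment> \<open>The penalty level is chosen so that the union bound is exactly \<open>\<epsilon>\<close>.\<close>
  then have "2 * real CARD('p) * exp (- (real n * z\<^sup>2 / (2 * K\<^sup>2))) = \<epsilon>"
    using arg \<epsilon> by (simp add: Ln_def exp_minus)
  then have probG: "prob G \<ge> 1 - \<epsilon>" using G(3) by simp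
  obtain G' where G': "G' \<in> sets M" "prob G' = 1" "\<And>\<omega>. \<omega> \<in> G' \<Longrightarrow> \<omega> \<in> space M \<and> covariate_bound K \<omega> \<and>
      (\<forall>b. ?lik \<omega> (\<beta>hat \<omega>) + lam * lq_norm 1 (\<beta>hat \<omega>) \<le> ?lik \<omega> b + lam * lq_norm 1 b)"
  proof -
    have "AE \<omega> in M. covariate_bound K \<omega> \<and>
      (\<forall>b. ?lik \<omega> (\<beta>hat \<omega>) + lam * lq_norm 1 (\<beta>hat \<omega>) \<le> ?lik \<omega> b + lam * lq_norm 1 b)"
      using cov_bound lasso by eventually_elim blast
    from AE_E_prob[OF this] that show ?thesis by (smt (verit) mem_Collect_eq subset_iff)
  qed
  have \<eta>0: "0 \<le> \<eta>"
  proof (rule ccontr)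
    assume "\<not> 0 \<le> \<eta>"
    then have "\<eta> * exp (- \<eta>) < 0" by (simp add: mult_less_0_iff)
    moreover have "0 \<le> \<tau>" using K_pos \<xi> \<open>0 < lam\<close> by (simp add: \<tau>(1))
    ultimately show False using \<eta>(2) by simp
  qed
  have bounds: "sym_bregman (?lik \<omega>) (\<beta>hat \<omega>) \<beta>o
          \<le> 4 * exp \<eta> * \<xi>\<^sup>2 * lam\<^sup>2 * real (card (support \<beta>o)) / ((1 + \<xi>)\<^sup>2 * C\<kappa>\<^sup>2) \<and>
        lq_norm 1 (\<beta>hat \<omega> - \<beta>o)
          \<le> exp \<eta> * (\<xi> + 1) * real (card (support \<beta>o)) * lam / (2 * C\<kappa>\<^sup>2) \<and>
        lq_norm q (\<beta>hat \<omega> - \<beta>o)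
          \<le> 2 * exp \<eta> * \<xi> * real (card (support \<beta>o)) powr real_of_ereal (1 / q) * lam
              / ((\<xi> + 1) * CF)" if \<omega>: "\<omega> \<in> ?B \<inter> G \<inter> G'" for \<omega>
  proof -
    have sp: "\<omega> \<in> space M" and cb: "covariate_bound K \<omega>"
      and min: "\<And>b. ?lik \<omega> (\<beta>hat \<omega>) + lam * lq_norm 1 (\<beta>hat \<omega>) \<le> ?lik \<omega> b + lam * lq_norm 1 b"
      using \<omega> G'(3) by blast+
    let ?\<theta> = "\<beta>hat \<omega> - \<beta>o"
    let ?H = "hessian (?lik \<omega>) \<beta>o"
    have H: "?H *v ?\<theta> = information \<omega> \<beta>o ?\<theta>" by (rule hessian_neg_log_partial_lik[OF sp])
    have mono: "?\<theta> \<bullet> score \<omega> (\<beta>o + s *\<^sub>R ?\<theta>) \<le> ?\<theta> \<bullet> score \<omega> (\<beta>hat \<omega>)" if s: "0 \<le> s" "s \<le> 1" for s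
    proof (cases "s = 1")
      case False
      then have "0 < 1 - s" using s by simp
      note inc = score_increment[OF sp cb this, of ?\<theta> "\<beta>o + s *\<^sub>R ?\<theta>"]
      have "0 \<le> (1 - s) * exp (- ((1 - s) * (K * lq_norm 1 ?\<theta>))) * (?\<theta> \<bullet> information \<omega> (\<beta>o + s *\<^sub>R ?\<theta>) ?\<theta>)"
        using inc(1) s by simp
      also have "\<dots> \<le> ?\<theta> \<bullet> (score \<omega> (\<beta>o + s *\<^sub>R ?\<theta> + (1 - s) *\<^sub>R ?\<theta>) - score \<omega> (\<beta>o + s *\<^sub>R ?\<theta>))"
        by (rule inc(2))
      also have "\<beta>o + s *\<^sub>R ?\<theta> + (1 - s) *\<^sub>R ?\<theta> = \<beta>hat \<omega>" by (simp add: algebra_simps)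
      finally show ?thesis by (simp add: inner_diff_right)
    qed simp
    note facts = lasso_error_bounds[where f = "?lik \<omega>" and g = "score \<omega>" and H = "?H" and b = "\<beta>hat \<omega>"
        and \<beta> = \<beta>o and K = K and \<xi> = \<xi> and lam = lam and \<eta> = \<eta> and C\<kappa> = C\<kappa> and CF = CF and q = q]
    have eta': "\<eta> * exp (- \<eta>) = K * (\<xi> + 1) * real (card (support \<beta>o)) * lam / (2 * C\<kappa>\<^sup>2)"
      using \<eta>(2) \<tau>(1) by simp
    have psd: "0 \<le> ?\<theta> \<bullet> (?H *v ?\<theta>)" unfolding H by (rule score_increment(1)[OF sp cb zero_less_one])
    have curv: "s * exp (- (s * (K * lq_norm 1 ?\<theta>))) * (?\<theta> \<bullet> (?H *v ?\<theta>))
        < ?\<theta> \<bullet> (score \<omega> (\<beta>o + s *\<^sub>R ?\<theta>) - score \<omega> \<beta>o)"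
      if "0 < s" "0 < ?\<theta> \<bullet> (?H *v ?\<theta>)" for s
      using that unfolding H by (intro score_increment(3)[OF sp cb])
    have sc: "\<bar>score \<omega> \<beta>o $ j\<bar> \<le> lam * (\<xi> - 1) / (\<xi> + 1)" for j
      unfolding z_lam using \<omega> G(2) by blast
    have comp: "ereal C\<kappa> \<le> compat_factor \<xi> (support \<beta>o) ?H"
      "ereal CF \<le> cone_invertibility_factor q \<xi> (support \<beta>o) ?H" using \<omega> by auto
    show ?thesis
      using facts[OF GDERIV_neg_log_partial_lik[OF sp] psd mono curv min sc K_pos \<xi> \<open>0 < lam\<close> C\<kappa> CF \<eta>0 eta' comp]
      by blast
  qed
  \<comment> \<open>If the set on which both factors are large enough is not measurable, its \<open>measure\<close> is \<open>0\<close> by convention and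
      the empty set is a witness.\<close>
  show ?thesis
  proof (cases "?B \<in> sets M")
    case True
    have "prob ?B \<le> prob (?B \<inter> G \<inter> G') + \<epsilon>"
    proof -
      have "prob ?B \<le> prob ((?B \<inter> G \<inter> G') \<union> (space M - G) \<union> (space M - G'))"
        using True G(1) G'(1) by (intro finite_measure_mono) auto
      also have "\<dots> \<le> prob ((?B \<inter> G \<inter> G') \<union> (space M - G)) + prob (space M - G')"
        using True G(1) G'(1) by (intro measure_Un_le) auto
      also have "\<dots> \<le> prob (?B \<inter> G \<inter> G') + prob (space M - G) + prob (space M - G')"
        using True G(1) G'(1) by (intro add_right_mono measure_Un_le) auto
      also have "\<dots> \<le> prob (?B \<inter> G \<inter> G') + \<epsilon>"
        using probG G'(2) prob_compl[OF G(1)] prob_compl[OF G'(1)] by simp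
      finally show ?thesis .
    qed
    then show ?thesis
      using True G(1) G'(1) bounds by (intro bexI[of _ "?B \<inter> G \<inter> G'"]) auto
  next
    case False
    then have "prob ?B = 0" by (rule measure_notin_sets)
    then show ?thesis using \<epsilon> by (intro bexI[of _ "{}"]) auto
  qed
qed

end
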